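(* Let $A$ be a split finite-dimensional algebra over a field with Jacobson radical $J$ satisfying $J^3=0$. Then $A$ satisfies the Auslander--Reiten conjecture: every finitely generated left $A$-module $M$ with $\operatorname{Ext}_A^i(M,M\oplus A)=0$ for every $i>0$ is projective. In particular, this holds for every finite-dimensional algebra $A$ over an algebraically closed field whose radical $J$ satisfies $J^3=0$.
   Context: All modules are finitely generated left modules. A finite-dimensional algebra over a field $k$ is called split if the endomorphism ring of every simple module is $k$. *)

theory Defs
  imports "HOL-Algebra.Algebra"
begin

text \<open>The library locale \<^locale>\<open>module\<close> requires a commutative ring.  We keep its record type,
  whose \<^const>\<open>monoid.mult\<close> and \<^const>\<open>one\<close> fields carry no information for a module, and the library
  locale \<^locale>\<open>submodule\<close>, which does not mention commutativity.\<close>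

locale left_module = R?: ring R + M?: abelian_group M
  for R :: "('a, 'b) ring_scheme" (structure) and M :: "('a, 'm, 'c) module_scheme" (structure) +
  assumes smult_closed [simp, intro]:
      "\<lbrakk>a \<in> carrier R; x \<in> carrier M\<rbrakk> \<Longrightarrow> a \<odot>\<^bsub>M\<^esub> x \<in> carrier M"
    and smult_l_distr:
      "\<lbrakk>a \<in> carrier R; b \<in> carrier R; x \<in> carrier M\<rbrakk> \<Longrightarrow>
        (a \<oplus>\<^bsub>R\<^esub> b) \<odot>\<^bsub>M\<^esub> x = a \<odot>\<^bsub>M\<^esub> x \<oplus>\<^bsub>M\<^esub> b \<odot>\<^bsub>M\<^esub> x"
    and smult_r_distr:
      "\<lbrakk>a \<in> carrier R; x \<in> carrier M; y \<in> carrier M\<rbrakk> \<Longrightarrow>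
        a \<odot>\<^bsub>M\<^esub> (x \<oplus>\<^bsub>M\<^esub> y) = a \<odot>\<^bsub>M\<^esub> x \<oplus>\<^bsub>M\<^esub> a \<odot>\<^bsub>M\<^esub> y"
    and smult_assoc:
      "\<lbrakk>a \<in> carrier R; b \<in> carrier R; x \<in> carrier M\<rbrakk> \<Longrightarrow>
        (a \<otimes>\<^bsub>R\<^esub> b) \<odot>\<^bsub>M\<^esub> x = a \<odot>\<^bsub>M\<^esub> (b \<odot>\<^bsub>M\<^esub> x)"
    and smult_one [simp]:
      "x \<in> carrier M \<Longrightarrow> \<one>\<^bsub>R\<^esub> \<odot>\<^bsub>M\<^esub> x = x"

definition lmod_generates :: "('a, 'b) ring_scheme \<Rightarrow> ('a, 'm, 'c) module_scheme \<Rightarrow> 'm set \<Rightarrow> bool"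
  where "lmod_generates R M B \<longleftrightarrow>
    B \<subseteq> carrier M \<and> (\<forall>N. submodule N R M \<and> B \<subseteq> N \<longrightarrow> N = carrier M)"

definition lmod_fg :: "('a, 'b) ring_scheme \<Rightarrow> ('a, 'm, 'c) module_scheme \<Rightarrow> bool"
  where "lmod_fg R M \<longleftrightarrow> (\<exists>B. finite B \<and> lmod_generates R M B)"

definition lmod_simple :: "('a, 'b) ring_scheme \<Rightarrow> ('a, 'm, 'c) module_scheme \<Rightarrow> bool"
  where "lmod_simple R M \<longleftrightarrow> left_module R M \<and> carrier M \<noteq> {\<zero>\<^bsub>M\<^esub>} \<and>
    (\<forall>N. submodule N R M \<longrightarrow> N = {\<zero>\<^bsub>M\<^esub>} \<or> N = carrier M)"

definition regular_lmod :: "('a, 'b) ring_scheme \<Rightarrow> ('a, 'a) module"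
  where "regular_lmod R =
    \<lparr>carrier = carrier R, monoid.mult = monoid.mult R, one = \<one>\<^bsub>R\<^esub>,
     ring.zero = \<zero>\<^bsub>R\<^esub>, add = add R, smult = monoid.mult R\<rparr>"

definition lmod_dsum ::
    "('a, 'm, 'c) module_scheme \<Rightarrow> ('a, 'n, 'd) module_scheme \<Rightarrow> ('a, 'm \<times> 'n) module"
  where "lmod_dsum M N =
    \<lparr>carrier = carrier M \<times> carrier N,
     monoid.mult = undefined, one = undefined,
     ring.zero = (\<zero>\<^bsub>M\<^esub>, \<zero>\<^bsub>N\<^esub>),
     add = (\<lambda>p q. (fst p \<oplus>\<^bsub>M\<^esub> fst q, snd p \<oplus>\<^bsub>N\<^esub> snd q)),
     smult = (\<lambda>a p. (a \<odot>\<^bsub>M\<^esub> fst p, a \<odot>\<^bsub>N\<^esub> snd p))\<rparr>"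

definition free_lmod :: "('a, 'b) ring_scheme \<Rightarrow> nat \<Rightarrow> ('a, nat \<Rightarrow> 'a) module"
  where "free_lmod R n =
    \<lparr>carrier = {..<n} \<rightarrow>\<^sub>E carrier R,
     monoid.mult = undefined, one = undefined,
     ring.zero = (\<lambda>j\<in>{..<n}. \<zero>\<^bsub>R\<^esub>),
     add = (\<lambda>u v. \<lambda>j\<in>{..<n}. u j \<oplus>\<^bsub>R\<^esub> v j),
     smult = (\<lambda>a u. \<lambda>j\<in>{..<n}. a \<otimes>\<^bsub>R\<^esub> u j)\<rparr>"

text \<open>Homomorphisms are taken extensional (\<^const>\<open>undefined\<close> off the carrier), so that HOL equality of
  the representing functions is equality of homomorphisms.\<close>

definition lmod_hom ::
    "('a, 'b) ring_scheme \<Rightarrow> ('a, 'm, 'c) module_scheme \<Rightarrow> ('a, 'n, 'd) module_scheme \<Rightarrow> ('m \<Rightarrow> 'n) set"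
  where "lmod_hom R M N = {f \<in> carrier M \<rightarrow>\<^sub>E carrier N.
    (\<forall>x\<in>carrier M. \<forall>y\<in>carrier M. f (x \<oplus>\<^bsub>M\<^esub> y) = f x \<oplus>\<^bsub>N\<^esub> f y) \<and>
    (\<forall>a\<in>carrier R. \<forall>x\<in>carrier M. f (a \<odot>\<^bsub>M\<^esub> x) = a \<odot>\<^bsub>N\<^esub> f x)}"

definition lmod_ker :: "('a, 'm, 'c) module_scheme \<Rightarrow> ('a, 'n, 'd) module_scheme \<Rightarrow> ('m \<Rightarrow> 'n) \<Rightarrow> 'm set"
  where "lmod_ker M N f = {x \<in> carrier M. f x = \<zero>\<^bsub>N\<^esub>}"

text \<open>The additive group of homomorphisms, written as a \<^typ>\<open>'a monoid\<close> for use with \<^const>\<open>FactGroup\<close>.\<close>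

definition lmod_Hom ::
    "('a, 'b) ring_scheme \<Rightarrow> ('a, 'm, 'c) module_scheme \<Rightarrow> ('a, 'n, 'd) module_scheme \<Rightarrow> ('m \<Rightarrow> 'n) monoid"
  where "lmod_Hom R M N =
    \<lparr>carrier = lmod_hom R M N,
     monoid.mult = (\<lambda>f g. \<lambda>x\<in>carrier M. f x \<oplus>\<^bsub>N\<^esub> g x),
     one = (\<lambda>x\<in>carrier M. \<zero>\<^bsub>N\<^esub>)\<rparr>"

definition lmod_End :: "('a, 'b) ring_scheme \<Rightarrow> ('a, 'm, 'c) module_scheme \<Rightarrow> ('m \<Rightarrow> 'm) ring"
  where "lmod_End R M =
    \<lparr>carrier = lmod_hom R M M,
     monoid.mult = compose (carrier M),
     one = (\<lambda>x\<in>carrier M. x),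
     ring.zero = (\<lambda>x\<in>carrier M. \<zero>\<^bsub>M\<^esub>),
     add = (\<lambda>f g. \<lambda>x\<in>carrier M. f x \<oplus>\<^bsub>M\<^esub> g x)\<rparr>"

text \<open>The lifting property against all epimorphisms \<open>U \<rightarrow> V\<close>.  A definition cannot quantify over types,
  so the element types of \<open>U\<close> and \<open>V\<close> are parameters; a theorem that concludes
  \<open>lmod_projective R P TYPE('x) TYPE('y)\<close> with free \<open>'x\<close>, \<open>'y\<close> gives the lifting property against
  all modules.\<close>

definition lmod_projective ::
    "('a, 'b) ring_scheme \<Rightarrow> ('a, 'm, 'c) module_scheme \<Rightarrow> 'x itself \<Rightarrow> 'y itself \<Rightarrow> bool"
  where "lmod_projective R P (_ :: 'x itself) (_ :: 'y itself) \<longleftrightarrow> left_module R P \<and>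
    (\<forall>(U :: ('a, 'x) module) (V :: ('a, 'y) module) g f.
       left_module R U \<and> left_module R V \<and>
       g \<in> lmod_hom R U V \<and> g ` carrier U = carrier V \<and> f \<in> lmod_hom R P V \<longrightarrow>
       (\<exists>h \<in> lmod_hom R P U. compose (carrier P) g h = f))"

text \<open>A resolution of \<open>M\<close> by free modules of finite rank,
  \<open>\<cdots> \<rightarrow> R\<^sup>n\<^sup>2 \<rightarrow> R\<^sup>n\<^sup>1 \<rightarrow> R\<^sup>n\<^sup>0 \<rightarrow> M \<rightarrow> 0\<close>, given by the ranks \<open>n i\<close> and the
  differentials \<open>d i\<close> from \<open>free_lmod R (n (Suc i))\<close> to \<open>free_lmod R (n i)\<close>.\<close>

definition free_resolution ::
    "('a, 'b) ring_scheme \<Rightarrow> ('a, 'm, 'c) module_scheme \<Rightarrow>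
     (nat \<Rightarrow> nat) \<Rightarrow> (nat \<Rightarrow> (nat \<Rightarrow> 'a) \<Rightarrow> (nat \<Rightarrow> 'a)) \<Rightarrow> bool"
  where "free_resolution R M n d \<longleftrightarrow>
    (\<forall>i. d i \<in> lmod_hom R (free_lmod R (n (Suc i))) (free_lmod R (n i))) \<and>
    (\<forall>i. d (Suc i) ` carrier (free_lmod R (n (Suc (Suc i)))) =
         lmod_ker (free_lmod R (n (Suc i))) (free_lmod R (n i)) (d i)) \<and>
    (\<exists>\<epsilon> \<in> lmod_hom R (free_lmod R (n 0)) M.
       \<epsilon> ` carrier (free_lmod R (n 0)) = carrier M \<and>
       d 0 ` carrier (free_lmod R (n 1)) = lmod_ker (free_lmod R (n 0)) M \<epsilon>)"

definition ext_cochains ::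
    "('a, 'b) ring_scheme \<Rightarrow> (nat \<Rightarrow> nat) \<Rightarrow> ('a, 'n, 'd) module_scheme \<Rightarrow> nat \<Rightarrow> ((nat \<Rightarrow> 'a) \<Rightarrow> 'n) monoid"
  where "ext_cochains R n N i = lmod_Hom R (free_lmod R (n i)) N"

definition ext_delta ::
    "('a, 'b) ring_scheme \<Rightarrow> (nat \<Rightarrow> nat) \<Rightarrow> (nat \<Rightarrow> (nat \<Rightarrow> 'a) \<Rightarrow> (nat \<Rightarrow> 'a)) \<Rightarrow> nat \<Rightarrow>
     ((nat \<Rightarrow> 'a) \<Rightarrow> 'n) \<Rightarrow> ((nat \<Rightarrow> 'a) \<Rightarrow> 'n)"
  where "ext_delta R n d i f = compose (carrier (free_lmod R (n (Suc i)))) f (d i)"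

fun ext_coboundaries ::
    "('a, 'b) ring_scheme \<Rightarrow> (nat \<Rightarrow> nat) \<Rightarrow> (nat \<Rightarrow> (nat \<Rightarrow> 'a) \<Rightarrow> (nat \<Rightarrow> 'a)) \<Rightarrow>
     ('a, 'n, 'd) module_scheme \<Rightarrow> nat \<Rightarrow> ((nat \<Rightarrow> 'a) \<Rightarrow> 'n) set"
  where
    "ext_coboundaries R n d N 0 = {\<one>\<^bsub>ext_cochains R n N 0\<^esub>}"
  | "ext_coboundaries R n d N (Suc i) = ext_delta R n d i ` carrier (ext_cochains R n N i)"

definition ext_cohomology ::
    "('a, 'b) ring_scheme \<Rightarrow> (nat \<Rightarrow> nat) \<Rightarrow> (nat \<Rightarrow> (nat \<Rightarrow> 'a) \<Rightarrow> (nat \<Rightarrow> 'a)) \<Rightarrow>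
     ('a, 'n, 'd) module_scheme \<Rightarrow> nat \<Rightarrow> ((nat \<Rightarrow> 'a) \<Rightarrow> 'n) set monoid"
  where "ext_cohomology R n d N i =
    (ext_cochains R n N i)\<lparr>carrier :=
       kernel (ext_cochains R n N i) (ext_cochains R n N (Suc i)) (ext_delta R n d i)\<rparr>
    Mod ext_coboundaries R n d N i"

text \<open>\<open>Ext\<^sup>i(M, N)\<close>, computed from a fixed choice of resolution.  It is meaningful when \<open>M\<close> is a finitely
  generated module over a left noetherian ring, where a resolution by free modules of finite rank
  exists and any two of them give isomorphic groups.\<close>

definition lmod_Ext ::
    "('a, 'b) ring_scheme \<Rightarrow> nat \<Rightarrow> ('a, 'm, 'c) module_scheme \<Rightarrow> ('a, 'n, 'd) module_scheme \<Rightarrow>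
     ((nat \<Rightarrow> 'a) \<Rightarrow> 'n) set monoid"
  where "lmod_Ext R i M N =
    (let (n, d) = (SOME (n, d). free_resolution R M n d) in ext_cohomology R n d N i)"

text \<open>The library locale \<^locale>\<open>algebra\<close> is restricted to commutative algebras.\<close>

locale fd_algebra = K?: field K + A?: ring A + module K A
  for K :: "('k, 'c) ring_scheme" (structure) and A :: "('k, 'a, 'd) module_scheme" (structure) +
  assumes smult_mult_left:
      "\<lbrakk>c \<in> carrier K; x \<in> carrier A; y \<in> carrier A\<rbrakk> \<Longrightarrow>
        (c \<odot>\<^bsub>A\<^esub> x) \<otimes>\<^bsub>A\<^esub> y = c \<odot>\<^bsub>A\<^esub> (x \<otimes>\<^bsub>A\<^esub> y)"
    and smult_mult_right:
      "\<lbrakk>c \<in> carrier K; x \<in> carrier A; y \<in> carrier A\<rbrakk> \<Longrightarrow>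
        x \<otimes>\<^bsub>A\<^esub> (c \<odot>\<^bsub>A\<^esub> y) = c \<odot>\<^bsub>A\<^esub> (x \<otimes>\<^bsub>A\<^esub> y)"
    and finite_dimensional: "lmod_fg K A"

definition maximal_left_ideal :: "('a, 'b) ring_scheme \<Rightarrow> 'a set \<Rightarrow> bool"
  where "maximal_left_ideal R L \<longleftrightarrow>
    submodule L R (regular_lmod R) \<and> L \<noteq> carrier R \<and>
    (\<forall>L'. submodule L' R (regular_lmod R) \<and> L \<subseteq> L' \<longrightarrow> L' = L \<or> L' = carrier R)"

definition jacobson_radical :: "('a, 'b) ring_scheme \<Rightarrow> 'a set"
  where "jacobson_radical R = carrier R \<inter> \<Inter>{L. maximal_left_ideal R L}"

text \<open>\<open>End(S) = K\<close> means that the structure map \<open>K \<rightarrow> End(S)\<close>, \<open>c \<mapsto> (s \<mapsto> (c \<cdot> 1) s)\<close>, is an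
  isomorphism.  Every simple module is isomorphic to a quotient \<open>A / L\<close>, whose elements are cosets,
  so the element type \<open>'a set\<close> covers all simple modules up to isomorphism.\<close>

definition split_algebra :: "('k, 'c) ring_scheme \<Rightarrow> ('k, 'a, 'd) module_scheme \<Rightarrow> bool"
  where "split_algebra K A \<longleftrightarrow>
    (\<forall>S :: ('a, 'a set) module. lmod_simple A S \<longrightarrow>
       (\<lambda>c. \<lambda>s\<in>carrier S. (c \<odot>\<^bsub>A\<^esub> \<one>\<^bsub>A\<^esub>) \<odot>\<^bsub>S\<^esub> s) \<in> ring_iso K (lmod_End A S))"

text \<open>The type parameters are the element types of \<open>M\<close> and of the test modules for projectivity; with
  free type variables in the conclusion of a theorem they cover all modules.\<close>

definition auslander_reiten ::
    "('a, 'b) ring_scheme \<Rightarrow> 'm itself \<Rightarrow> 'x itself \<Rightarrow> 'y itself \<Rightarrow> bool"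
  where "auslander_reiten A (_ :: 'm itself) (_ :: 'x itself) (_ :: 'y itself) \<longleftrightarrow>
    (\<forall>M :: ('a, 'm) module.
       left_module A M \<and> lmod_fg A M \<and>
       (\<forall>i>0. trivial_group (lmod_Ext A i M (lmod_dsum M (regular_lmod A)))) \<longrightarrow>
       lmod_projective A M TYPE('x) TYPE('y))"

end

theory Submission
  imports Defs
begin

text \<open>
  Let \<open>\<dots> \<rightarrow> P\<^sub>1 \<rightarrow> P\<^sub>0 \<rightarrow> M\<close> be a minimal projective resolution and \<open>U\<^sub>b \<subseteq> J P\<^sub>b\<close> its syzygies, so that
  \<open>J\<^sup>2 U\<^sub>b = 0\<close>.  Dimension shifting turns the hypothesis into \<open>Ext\<^sup>1(U\<^sub>i, U\<^sub>b) = 0\<close> for \<open>i \<ge> b\<close>.  Precomposition with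
  the differential gives a map \<open>Hom(P\<^sub>i\<^sub>+\<^sub>1, U\<^sub>b) / Hom(P\<^sub>i\<^sub>+\<^sub>1, J U\<^sub>b) \<rightarrow> Hom(P\<^sub>i\<^sub>+\<^sub>2, J U\<^sub>b)\<close> that is onto for
  \<open>i \<ge> b\<close>, bijective for \<open>i > b\<close>, and kills the nonzero class of \<open>P\<^sub>b\<^sub>+\<^sub>1 \<rightarrow> U\<^sub>b\<close> for \<open>i = b\<close> if \<open>U\<^sub>b \<noteq> 0\<close>.
  Hence the difference of the lengths of its source and target is \<open>0\<close> for \<open>i > b\<close> and positive for
  \<open>i = b\<close>.  But \<open>Hom(P, -)\<close> is exact, so these differences are a bilinear pairing of vectors of
  composition multiplicities, and a pairing of finite rank cannot have an infinite triangular matrix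
  with nonzero diagonal.  So some \<open>U\<^sub>b\<close> vanishes, and \<open>Ext\<^sup>i(M, A) = 0\<close> then forces \<open>M\<close> to be projective.
\<close>

section \<open>Modules and homomorphisms\<close>

text \<open>Minimality and J^3 = 0 work together: every map P_i -> U_b carries U_i into J U_b, and
  every map P_i -> J U_b kills U_i, so precomposition with a differential shifts by one radical
  layer. A map on P_(i+1) killed by the next differential comes from P_i by vanishing of Ext, hence
  takes values in J U_b; this is the injectivity. The count involves both P_(i+1) and P_(i+2), so
  with n composition factors of A the pairing lives in dimension 2n.

  Two mismatches shape the rest. Ext is computed from an arbitrarily chosen free resolution, while
  the count needs a minimal one: the minimal syzygies are shown to be summands of the chosen ones up
  to projectives, which suffices to transport vanishing of Ext. And Hom groups carry only central
  scalars, so lengths are taken over a central subring \<open>Z\<close> over which A has finite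
  length, namely the image of the field.

  Module quotients are never formed: W / V is an interval of submodules, Hom(P, V / U) is Hom(P, V)
  over Hom(P, U), and vanishing of Ext^1 is extendability of maps from a kernel.\<close>

context left_module
begin

lemma smult_l_null [simp]: "x \<in> carrier M \<Longrightarrow> \<zero>\<^bsub>R\<^esub> \<odot>\<^bsub>M\<^esub> x = \<zero>\<^bsub>M\<^esub>"
  by (metis M.add.r_cancel_one' R.r_zero R.zero_closed smult_closed smult_l_distr)

lemma smult_r_null [simp]: "a \<in> carrier R \<Longrightarrow> a \<odot>\<^bsub>M\<^esub> \<zero>\<^bsub>M\<^esub> = \<zero>\<^bsub>M\<^esub>"
  by (metis M.add.r_cancel_one' M.r_zero M.zero_closed smult_closed smult_r_distr)

lemma smult_minus_one: 
  assumes x: "x \<in> carrier M" shows "(\<ominus>\<^bsub>R\<^esub> \<one>\<^bsub>R\<^esub>) \<odot>\<^bsub>M\<^esub> x = \<ominus>\<^bsub>M\<^esub> x"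
proof -
  have "(\<ominus>\<^bsub>R\<^esub> \<one>\<^bsub>R\<^esub>) \<odot>\<^bsub>M\<^esub> x \<oplus>\<^bsub>M\<^esub> x = (\<ominus>\<^bsub>R\<^esub> \<one>\<^bsub>R\<^esub> \<oplus>\<^bsub>R\<^esub> \<one>\<^bsub>R\<^esub>) \<odot>\<^bsub>M\<^esub> x"
    using x by (simp add: smult_l_distr)
  also have "\<dots> = \<zero>\<^bsub>M\<^esub>" using x by (simp add: R.l_neg)
  finally show ?thesis using x by (simp add: M.minus_equality)
qed

lemma smult_r_minus:
  assumes "a \<in> carrier R" "x \<in> carrier M" shows "a \<odot>\<^bsub>M\<^esub> (\<ominus>\<^bsub>M\<^esub> x) = \<ominus>\<^bsub>M\<^esub> (a \<odot>\<^bsub>M\<^esub> x)"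
proof -
  have "a \<odot>\<^bsub>M\<^esub> (\<ominus>\<^bsub>M\<^esub> x) \<oplus>\<^bsub>M\<^esub> a \<odot>\<^bsub>M\<^esub> x = a \<odot>\<^bsub>M\<^esub> (\<ominus>\<^bsub>M\<^esub> x \<oplus>\<^bsub>M\<^esub> x)"
    using assms by (simp add: smult_r_distr)
  also have "\<dots> = \<zero>\<^bsub>M\<^esub>" using assms by (simp add: M.l_neg)
  finally show ?thesis using assms by (simp add: M.minus_equality)
qed

lemma diff_eq_zero:
  assumes "x \<in> carrier M" "y \<in> carrier M" shows "x \<ominus>\<^bsub>M\<^esub> y = \<zero>\<^bsub>M\<^esub> \<longleftrightarrow> x = y"
  using assms by (metis M.add.inv_closed M.add.inv_solve_right' M.l_zero M.minus_eq M.zero_closed)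

lemma diff_add_cancel:
  "x \<in> carrier M \<Longrightarrow> y \<in> carrier M \<Longrightarrow> (x \<ominus>\<^bsub>M\<^esub> y) \<oplus>\<^bsub>M\<^esub> y = x"
  unfolding a_minus_def by (simp add: M.a_assoc M.l_neg)

text \<open>Negatives are multiples by -1, so closure under inverses, which the library predicate
  demands, follows from closure under scalars.\<close>

lemma submodule_iff:
  "submodule N R M \<longleftrightarrow> N \<subseteq> carrier M \<and> \<zero>\<^bsub>M\<^esub> \<in> N \<and>
     (\<forall>x\<in>N. \<forall>y\<in>N. x \<oplus>\<^bsub>M\<^esub> y \<in> N) \<and> (\<forall>a\<in>carrier R. \<forall>x\<in>N. a \<odot>\<^bsub>M\<^esub> x \<in> N)"
proof
  assume "submodule N R M"
  then interpret submodule N R M .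
  show "N \<subseteq> carrier M \<and> \<zero>\<^bsub>M\<^esub> \<in> N \<and>
     (\<forall>x\<in>N. \<forall>y\<in>N. x \<oplus>\<^bsub>M\<^esub> y \<in> N) \<and> (\<forall>a\<in>carrier R. \<forall>x\<in>N. a \<odot>\<^bsub>M\<^esub> x \<in> N)"
    using subset one_closed m_closed by auto
next
  assume h: "N \<subseteq> carrier M \<and> \<zero>\<^bsub>M\<^esub> \<in> N \<and>
     (\<forall>x\<in>N. \<forall>y\<in>N. x \<oplus>\<^bsub>M\<^esub> y \<in> N) \<and> (\<forall>a\<in>carrier R. \<forall>x\<in>N. a \<odot>\<^bsub>M\<^esub> x \<in> N)"
  have "\<ominus>\<^bsub>M\<^esub> x \<in> N" if "x \<in> N" for x
    using h that smult_minus_one[of x] by (metis R.a_inv_closed R.one_closed subsetD)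
  then show "submodule N R M"
    using h by (intro submodule.intro subgroup.intro)
      (auto simp: submodule_axioms_def a_inv_def)
qed

lemma submodule_minus:
  "submodule N R M \<Longrightarrow> x \<in> N \<Longrightarrow> y \<in> N \<Longrightarrow> x \<ominus>\<^bsub>M\<^esub> y \<in> N"
  unfolding submodule_iff a_minus_def
  by (metis R.a_inv_closed R.one_closed smult_minus_one subsetD)

lemma submodule_self [simp]: "submodule (carrier M) R M"
  by (simp add: submodule_iff)

lemma submodule_zero [simp]: "submodule {\<zero>\<^bsub>M\<^esub>} R M"
  by (simp add: submodule_iff)

lemma submodule_inter: "submodule U R M \<Longrightarrow> submodule V R M \<Longrightarrow> submodule (U \<inter> V) R M"
  by (auto simp: submodule_iff)

lemma submodule_Inter:
  "S \<noteq> {} \<Longrightarrow> (\<And>U. U \<in> S \<Longrightarrow> submodule U R M) \<Longrightarrow> submodule (\<Inter>S) R M"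
  unfolding submodule_iff by blast

lemma mem_set_add: "x \<in> U <+>\<^bsub>M\<^esub> V \<longleftrightarrow> (\<exists>u\<in>U. \<exists>v\<in>V. x = u \<oplus>\<^bsub>M\<^esub> v)"
  by (auto simp: set_add_def')

lemma submodule_set_add:
  assumes "submodule U R M" "submodule V R M" shows "submodule (U <+>\<^bsub>M\<^esub> V) R M"
  unfolding submodule_iff
proof (intro conjI ballI subsetI)
  note h = assms[unfolded submodule_iff]
  show "\<And>x. x \<in> U <+>\<^bsub>M\<^esub> V \<Longrightarrow> x \<in> carrier M" using h by (auto simp: mem_set_add)
  show "\<zero>\<^bsub>M\<^esub> \<in> U <+>\<^bsub>M\<^esub> V" using h unfolding mem_set_add
    by (metis M.r_zero M.zero_closed)
  fix x y assume "x \<in> U <+>\<^bsub>M\<^esub> V" "y \<in> U <+>\<^bsub>M\<^esub> V"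
  then obtain u v u' v' where *: "u \<in> U" "v \<in> V" "u' \<in> U" "v' \<in> V" 
    "x = u \<oplus>\<^bsub>M\<^esub> v" "y = u' \<oplus>\<^bsub>M\<^esub> v'" by (auto simp: mem_set_add)
  have "x \<oplus>\<^bsub>M\<^esub> y = (u \<oplus>\<^bsub>M\<^esub> u') \<oplus>\<^bsub>M\<^esub> (v \<oplus>\<^bsub>M\<^esub> v')"
    using * h by (simp add: M.a_ac subset_eq)
  then show "x \<oplus>\<^bsub>M\<^esub> y \<in> U <+>\<^bsub>M\<^esub> V" using * h unfolding mem_set_add by blast
next
  note h = assms[unfolded submodule_iff]
  fix a x assume a: "a \<in> carrier R" and "x \<in> U <+>\<^bsub>M\<^esub> V"
  then obtain u v where *: "u \<in> U" "v \<in> V" "x = u \<oplus>\<^bsub>M\<^esub> v" by (auto simp: mem_set_add)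
  then have "a \<odot>\<^bsub>M\<^esub> x = a \<odot>\<^bsub>M\<^esub> u \<oplus>\<^bsub>M\<^esub> a \<odot>\<^bsub>M\<^esub> v" using a h by (simp add: smult_r_distr subset_eq)
  then show "a \<odot>\<^bsub>M\<^esub> x \<in> U <+>\<^bsub>M\<^esub> V" using * a h unfolding mem_set_add by blast
qed

lemma set_add_upper1: "submodule U R M \<Longrightarrow> submodule V R M \<Longrightarrow> U \<subseteq> U <+>\<^bsub>M\<^esub> V"
  unfolding submodule_iff mem_set_add subset_iff by (metis M.r_zero)

lemma set_add_upper2: "submodule U R M \<Longrightarrow> submodule V R M \<Longrightarrow> V \<subseteq> U <+>\<^bsub>M\<^esub> V"
  unfolding submodule_iff mem_set_add subset_iff by (metis M.l_zero)

lemma set_add_least: "submodule W R M \<Longrightarrow> U \<subseteq> W \<Longrightarrow> V \<subseteq> W \<Longrightarrow> U <+>\<^bsub>M\<^esub> V \<subseteq> W"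
  unfolding submodule_iff mem_set_add subset_iff by blast

lemma sub_left_module:
  assumes "submodule N R M" shows "left_module R (M\<lparr>carrier := N\<rparr>)"
proof -
  interpret N: submodule N R M by fact
  have am: "abelian_monoid (M\<lparr>carrier := N\<rparr>)"
    using comm_monoid.submonoid_is_comm_monoid[OF M.a_comm_monoid N.subgroup_is_submonoid]
    by (simp add: abelian_monoid_def)
  have "abelian_group_axioms (M\<lparr>carrier := N\<rparr>)"
    using N.subgroup_is_group[OF M.a_group] am
    by (simp add: abelian_group_axioms_def comm_group_def abelian_monoid_def)
  with am have "abelian_group (M\<lparr>carrier := N\<rparr>)" by (rule abelian_group.intro)
  moreover have "left_module_axioms R (M\<lparr>carrier := N\<rparr>)"
    using N.subset by (intro left_module_axioms.intro)
      (auto simp: smult_l_distr smult_r_distr smult_assoc subset_eq)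
  ultimately show ?thesis by (intro left_module.intro R.ring_axioms)
qed

lemma submodule_sub_iff:
  assumes "submodule N R M"
  shows "submodule U R (M\<lparr>carrier := N\<rparr>) \<longleftrightarrow> submodule U R M \<and> U \<subseteq> N"
proof -
  interpret N: left_module R "M\<lparr>carrier := N\<rparr>" by (rule sub_left_module[OF assms])
  show ?thesis using assms unfolding submodule_iff N.submodule_iff by auto
qed

end

section \<open>Homomorphisms as plain functions\<close>

text \<open>This is \<open>lmod_hom\<close> without extensionality: composites, sums and
  restrictions to a smaller carrier are again of this kind with no need to restrict them.
  \<open>restrict_lmod_hom\<close> leads back to \<open>lmod_hom\<close>.\<close>

definition lmod_map ::
    "('a, 'b) ring_scheme \<Rightarrow> ('a, 'm, 'c) module_scheme \<Rightarrow> ('a, 'n, 'd) module_scheme \<Rightarrow> ('m \<Rightarrow> 'n) \<Rightarrow> bool"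
  where "lmod_map R M N f \<longleftrightarrow> f \<in> carrier M \<rightarrow> carrier N \<and>
    (\<forall>x\<in>carrier M. \<forall>y\<in>carrier M. f (x \<oplus>\<^bsub>M\<^esub> y) = f x \<oplus>\<^bsub>N\<^esub> f y) \<and>
    (\<forall>a\<in>carrier R. \<forall>x\<in>carrier M. f (a \<odot>\<^bsub>M\<^esub> x) = a \<odot>\<^bsub>N\<^esub> f x)"

lemma lmod_mapD:
  assumes "lmod_map R M N f"
  shows "\<And>x. x \<in> carrier M \<Longrightarrow> f x \<in> carrier N"
    and "\<And>x y. x \<in> carrier M \<Longrightarrow> y \<in> carrier M \<Longrightarrow> f (x \<oplus>\<^bsub>M\<^esub> y) = f x \<oplus>\<^bsub>N\<^esub> f y"
    and "\<And>a x. a \<in> carrier R \<Longrightarrow> x \<in> carrier M \<Longrightarrow> f (a \<odot>\<^bsub>M\<^esub> x) = a \<odot>\<^bsub>N\<^esub> f x"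
  using assms by (auto simp: lmod_map_def)

lemma lmod_hom_iff: "f \<in> lmod_hom R M N \<longleftrightarrow> f \<in> extensional (carrier M) \<and> lmod_map R M N f"
  by (auto simp: lmod_hom_def lmod_map_def PiE_def)

lemma lmod_map_cong:
  assumes "left_module R M" "\<And>x. x \<in> carrier M \<Longrightarrow> f x = g x"
  shows "lmod_map R M N f \<longleftrightarrow> lmod_map R M N g"
proof -
  interpret left_module R M by fact
  show ?thesis using assms(2) by (auto simp: lmod_map_def Pi_iff)
qed

lemma restrict_lmod_hom:
  assumes "left_module R M" "lmod_map R M N f" shows "restrict f (carrier M) \<in> lmod_hom R M N"
  using lmod_map_cong[OF assms(1), of f "restrict f (carrier M)" N] assms(2)
  by (auto simp: lmod_hom_iff)

lemma lmod_map_zero: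
  assumes "left_module R M" "left_module R N" "lmod_map R M N f" shows "f \<zero>\<^bsub>M\<^esub> = \<zero>\<^bsub>N\<^esub>"
proof -
  interpret M: left_module R M by fact
  interpret N: left_module R N by fact
  show ?thesis using lmod_mapD[OF assms(3)] by (metis M.M.l_zero M.M.zero_closed N.M.add.l_cancel_one')
qed

lemma lmod_map_minus:
  assumes "left_module R M" "left_module R N" "lmod_map R M N f" "x \<in> carrier M" "y \<in> carrier M"
  shows "f (x \<ominus>\<^bsub>M\<^esub> y) = f x \<ominus>\<^bsub>N\<^esub> f y"
proof -
  interpret M: left_module R M by fact
  interpret N: left_module R N by fact
  show ?thesis using lmod_mapD[OF assms(3)] assms(4,5) unfolding a_minus_def
    by (metis M.smult_minus_one N.smult_minus_one M.M.a_inv_closed M.R.a_inv_closed M.R.one_closed)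
qed

lemma lmod_map_comp:
  "lmod_map R M N f \<Longrightarrow> lmod_map R N Q g \<Longrightarrow> lmod_map R M Q (\<lambda>x. g (f x))"
  by (auto simp: lmod_map_def Pi_iff)

lemma lmod_map_id: "lmod_map R M M (\<lambda>x. x)"
  by (simp add: lmod_map_def)

lemma lmod_map_null: "left_module R N \<Longrightarrow> lmod_map R M N (\<lambda>x. \<zero>\<^bsub>N\<^esub>)"
proof -
  assume "left_module R N" then interpret left_module R N .
  show ?thesis by (simp add: lmod_map_def)
qed

lemma lmod_map_add:
  assumes "left_module R N" "lmod_map R M N f" "lmod_map R M N g"
  shows "lmod_map R M N (\<lambda>x. f x \<oplus>\<^bsub>N\<^esub> g x)"
proof -
  interpret left_module R N by fact
  show ?thesis using assms(2,3)
    by (auto simp: lmod_map_def Pi_iff smult_r_distr M.a_ac)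
qed

lemma lmod_map_diff:
  assumes "left_module R N" "lmod_map R M N f" "lmod_map R M N g"
  shows "lmod_map R M N (\<lambda>x. f x \<ominus>\<^bsub>N\<^esub> g x)"
proof -
  interpret left_module R N by fact
  show ?thesis using assms(2,3)
    by (auto simp: lmod_map_def Pi_iff smult_r_distr M.a_ac smult_r_minus a_minus_def M.minus_add)
qed

lemma lmod_map_dom: "lmod_map R M N f \<Longrightarrow> U \<subseteq> carrier M \<Longrightarrow> lmod_map R (M\<lparr>carrier := U\<rparr>) N f"
  by (auto simp: lmod_map_def Pi_iff subset_iff)

lemma lmod_map_cod_iff:
  "U \<subseteq> carrier N \<Longrightarrow> lmod_map R M (N\<lparr>carrier := U\<rparr>) f \<longleftrightarrow> lmod_map R M N f \<and> f ` carrier M \<subseteq> U"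
  by (auto simp: lmod_map_def)

lemma submodule_image:
  assumes "left_module R M" "left_module R N" "lmod_map R M N f" "submodule U R M"
  shows "submodule (f ` U) R N"
proof -
  interpret M: left_module R M by fact
  interpret N: left_module R N by fact
  note U = assms(4)[unfolded M.submodule_iff] and f = lmod_mapD[OF assms(3)]
  show ?thesis unfolding N.submodule_iff
  proof (intro conjI ballI)
    show "f ` U \<subseteq> carrier N" using U f by auto
    show "\<zero>\<^bsub>N\<^esub> \<in> f ` U" using U lmod_map_zero[OF assms(1-3)] by (metis imageI)
    show "x \<oplus>\<^bsub>N\<^esub> y \<in> f ` U" if "x \<in> f ` U" "y \<in> f ` U" for x y
    proof -
      from that obtain u v where "u \<in> U" "v \<in> U" "x = f u" "y = f v" by blast
      then show ?thesis using U f(2)[of u v] by (metis imageI subsetD)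
    qed
    show "a \<odot>\<^bsub>N\<^esub> x \<in> f ` U" if "a \<in> carrier R" "x \<in> f ` U" for a x
    proof -
      from that obtain u where "u \<in> U" "x = f u" by blast
      then show ?thesis using U f(3)[of a u] that(1) by (metis imageI subsetD)
    qed
  qed
qed

lemma submodule_range:
  assumes "left_module R M" "left_module R N" "lmod_map R M N f" shows "submodule (f ` carrier M) R N"
  using submodule_image[OF assms left_module.submodule_self[OF assms(1)]] .

lemma submodule_vimage:
  assumes "left_module R M" "left_module R N" "lmod_map R M N f" "submodule W R N"
  shows "submodule {x \<in> carrier M. f x \<in> W} R M"
proof -
  interpret M: left_module R M by fact
  interpret N: left_module R N by fact
  show ?thesis using assms(4) lmod_mapD[OF assms(3)] lmod_map_zero[OF assms(1-3)]
    unfolding M.submodule_iff N.submodule_iff by auto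
qed

lemma submodule_ker:
  assumes "left_module R M" "left_module R N" "lmod_map R M N f"
  shows "submodule (lmod_ker M N f) R M"
proof -
  interpret N: left_module R N by fact
  show ?thesis using submodule_vimage[OF assms N.submodule_zero] by (simp add: lmod_ker_def)
qed

text \<open>The universal property of M / ker p, with the image of \<open>p\<close> standing for the
  quotient. Two preimages of a point differ by an element of the kernel of \<open>p\<close>, which
  \<open>h\<close> kills, so an arbitrary choice of preimages gives a well-defined map.\<close>

lemma lmod_map_factor:
  assumes M: "left_module R M" and N: "left_module R N" and Q: "left_module R Q"
    and p: "lmod_map R M N p" and h: "lmod_map R M Q h"
    and ker: "\<And>x. x \<in> carrier M \<Longrightarrow> p x = \<zero>\<^bsub>N\<^esub> \<Longrightarrow> h x = \<zero>\<^bsub>Q\<^esub>"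
  obtains q where "lmod_map R (N\<lparr>carrier := p ` carrier M\<rparr>) Q q"
    "\<And>x. x \<in> carrier M \<Longrightarrow> q (p x) = h x"
proof -
  interpret M: left_module R M by fact
  interpret N: left_module R N by fact
  interpret Q: left_module R Q by fact
  note p' = lmod_mapD[OF p] and h' = lmod_mapD[OF h]
  define q where "q y = h (SOME x. x \<in> carrier M \<and> p x = y)" for y
  have q: "q (p x) = h x" if x: "x \<in> carrier M" for x
  proof -
    define z where "z = (SOME z. z \<in> carrier M \<and> p z = p x)"
    have z: "z \<in> carrier M" "p z = p x"
      unfolding z_def using someI[of "\<lambda>z. z \<in> carrier M \<and> p z = p x"] x by auto
    have "p (z \<ominus>\<^bsub>M\<^esub> x) = \<zero>\<^bsub>N\<^esub>"
      using lmod_map_minus[OF M N p z(1) x] z x p' by (simp add: N.M.r_neg a_minus_def)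
    then have "h z \<ominus>\<^bsub>Q\<^esub> h x = \<zero>\<^bsub>Q\<^esub>"
      using lmod_map_minus[OF M Q h z(1) x] ker z x by simp
    then have "h z = h x" using Q.diff_eq_zero h'(1) z x by blast
    then show ?thesis by (simp add: q_def z_def)
  qed
  have "lmod_map R (N\<lparr>carrier := p ` carrier M\<rparr>) Q q"
    unfolding lmod_map_def
  proof (intro conjI ballI)
    show "q \<in> carrier (N\<lparr>carrier := p ` carrier M\<rparr>) \<rightarrow> carrier Q"
      using q h' by auto
    fix x y assume "x \<in> carrier (N\<lparr>carrier := p ` carrier M\<rparr>)" "y \<in> carrier (N\<lparr>carrier := p ` carrier M\<rparr>)"
    then show "q (x \<oplus>\<^bsub>N\<lparr>carrier := p ` carrier M\<rparr>\<^esub> y) = q x \<oplus>\<^bsub>Q\<^esub> q y"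
      using q h' p' by (auto simp flip: p'(2,3))
  next
    fix a y assume "a \<in> carrier R" "y \<in> carrier (N\<lparr>carrier := p ` carrier M\<rparr>)"
    then show "q (a \<odot>\<^bsub>N\<lparr>carrier := p ` carrier M\<rparr>\<^esub> y) = a \<odot>\<^bsub>Q\<^esub> q y"
      using q h' p' by (auto simp flip: p'(2,3))
  qed
  then show ?thesis using q that by blast
qed

context ring
begin

abbreviation reg :: "('a, 'a) module" where "reg \<equiv> regular_lmod R"

lemma reg_module: "left_module R reg"
proof -
  have ag: "abelian_group (regular_lmod R)"
    by (rule abelian_groupI) (auto simp: regular_lmod_def a_ac intro: l_neg)
  show ?thesis
    by (intro left_module.intro ring_axioms ag left_module_axioms.intro)
      (auto simp: regular_lmod_def l_distr r_distr m_assoc)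
qed

lemma regular_simps [simp]:
  "carrier (regular_lmod R) = carrier R" "\<zero>\<^bsub>regular_lmod R\<^esub> = \<zero>"
  "x \<oplus>\<^bsub>regular_lmod R\<^esub> y = x \<oplus> y" "a \<odot>\<^bsub>regular_lmod R\<^esub> x = a \<otimes> x"
  by (auto simp: regular_lmod_def)

lemma lmod_map_smult:
  assumes "left_module R M" "y \<in> carrier M"
  shows "lmod_map R (regular_lmod R) M (\<lambda>a. a \<odot>\<^bsub>M\<^esub> y)"
proof -
  interpret M: left_module R M by fact
  show ?thesis using assms(2) by (auto simp: lmod_map_def M.smult_l_distr M.smult_assoc)
qed

end

section \<open>Free modules, projectivity and stable retracts\<close>

text \<open>As a function of \<open>u\<close> this is the homomorphism from a free module that sends
  the k-th basis vector to \<open>y k\<close>.\<close>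

primrec lmod_comb :: "('a, 'm, 'c) module_scheme \<Rightarrow> (nat \<Rightarrow> 'a) \<Rightarrow> (nat \<Rightarrow> 'm) \<Rightarrow> nat \<Rightarrow> 'm"
  where
    "lmod_comb M u y 0 = \<zero>\<^bsub>M\<^esub>"
  | "lmod_comb M u y (Suc k) = lmod_comb M u y k \<oplus>\<^bsub>M\<^esub> u k \<odot>\<^bsub>M\<^esub> y k"

lemma (in left_module) lmod_comb_closed:
  assumes "submodule U R M" "\<And>k. k < n \<Longrightarrow> u k \<in> carrier R" "\<And>k. k < n \<Longrightarrow> y k \<in> U"
  shows "lmod_comb M u y n \<in> U"
  using assms(2,3) by (induction n) (use assms(1) in \<open>auto simp: submodule_iff\<close>)

context ring
begin

abbreviation free :: "nat \<Rightarrow> ('a, nat \<Rightarrow> 'a) module" where "free \<equiv> free_lmod R"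

definition free_unit :: "nat \<Rightarrow> nat \<Rightarrow> nat \<Rightarrow> 'a"
  where "free_unit n k = (\<lambda>j\<in>{..<n}. if j = k then \<one> else \<zero>)"

lemma free_module: "left_module R (free n)"
proof -
  have "abelian_group (free n)"
  proof (rule abelian_groupI)
    fix x assume "x \<in> carrier (free n)"
    then show "\<exists>y\<in>carrier (free n). y \<oplus>\<^bsub>free n\<^esub> x = \<zero>\<^bsub>free n\<^esub>"
      by (intro bexI[of _ "\<lambda>j\<in>{..<n}. \<ominus>\<^bsub>R\<^esub> x j"]) (auto simp: free_lmod_def PiE_iff l_neg fun_eq_iff)
  qed (auto simp: free_lmod_def PiE_iff a_ac fun_eq_iff extensional_def)
  then show ?thesis
    by (intro left_module.intro ring_axioms left_module_axioms.intro)
      (auto simp: free_lmod_def PiE_iff fun_eq_iff l_distr r_distr m_assoc extensional_def)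
qed

lemma free_unit_closed [simp]: "free_unit n k \<in> carrier (free n)"
  by (auto simp: free_unit_def free_lmod_def)

lemma free_carrier: "u \<in> carrier (free n) \<Longrightarrow> k < n \<Longrightarrow> u k \<in> carrier R"
  by (auto simp: free_lmod_def)

lemma lmod_comb_map:
  assumes "left_module R M" "\<And>k. k < n \<Longrightarrow> y k \<in> carrier M"
  shows "lmod_map R (free n) M (\<lambda>u. lmod_comb M u y n)"
proof -
  interpret M: left_module R M by fact
  have cl: "lmod_comb M u y m \<in> carrier M"
    if "u \<in> carrier (free n)" "m \<le> n" for u m
    using M.lmod_comb_closed[OF M.submodule_self, of m u y] that assms(2) free_carrier by force
  have add: "lmod_comb M (u \<oplus>\<^bsub>free n\<^esub> v) y m = lmod_comb M u y m \<oplus>\<^bsub>M\<^esub> lmod_comb M v y m"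
    if uv: "u \<in> carrier (free n)" "v \<in> carrier (free n)" and "m \<le> n" for u v m
    using \<open>m \<le> n\<close>
  proof (induction m)
    case (Suc m)
    then have "m < n" by simp
    moreover have "(u \<oplus>\<^bsub>free n\<^esub> v) m = u m \<oplus> v m"
      using \<open>m < n\<close> by (simp add: free_lmod_def)
    ultimately show ?case using Suc assms(2) cl[OF uv(1), of m] cl[OF uv(2), of m]
        free_carrier[OF uv(1)] free_carrier[OF uv(2)]
      by (simp add: M.smult_l_distr M.M.a_ac)
  qed simp
  have smult: "lmod_comb M (a \<odot>\<^bsub>free n\<^esub> u) y m = a \<odot>\<^bsub>M\<^esub> lmod_comb M u y m"
    if u: "u \<in> carrier (free n)" "a \<in> carrier R" and "m \<le> n" for u a m
    using \<open>m \<le> n\<close>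
  proof (induction m)
    case (Suc m)
    then have "m < n" by simp
    moreover have "(a \<odot>\<^bsub>free n\<^esub> u) m = a \<otimes> u m"
      using \<open>m < n\<close> by (simp add: free_lmod_def)
    ultimately show ?case using Suc assms(2) cl[OF u(1), of m] u free_carrier[OF u(1)]
      by (simp add: M.smult_assoc M.smult_r_distr)
  qed (use u in simp)
  show ?thesis unfolding lmod_map_def using cl add smult by auto
qed

lemma lmod_comb_unit:
  assumes "left_module R M" "\<And>k. k < n \<Longrightarrow> y k \<in> carrier M" "k < n"
  shows "lmod_comb M (free_unit n k) y n = y k"
proof -
  interpret M: left_module R M by fact
  have "lmod_comb M (free_unit n k) y m = (if k < m then y k else \<zero>\<^bsub>M\<^esub>)" if "m \<le> n" for m
    using that
  proof (induction m)
    case (Suc m)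
    then show ?case using assms(2)[of m] assms(2)[of k] assms(3)
      by (cases "m = k") (auto simp: free_unit_def)
  qed simp
  then show ?thesis using assms(3) by simp
qed

text \<open>Serves as an induction principle: a condition that cuts out a submodule holds on all of
  a free module once it holds on the standard basis.\<close>

lemma free_generated:
  assumes U: "submodule U R (free n)" and e: "\<And>k. k < n \<Longrightarrow> free_unit n k \<in> U"
  shows "U = carrier (free n)"
proof
  interpret F: left_module R "free n" by (rule free_module)
  show "U \<subseteq> carrier (free n)" using U by (simp add: F.submodule_iff)
  show "carrier (free n) \<subseteq> U"
  proof
    fix u assume u: "u \<in> carrier (free n)"
    \<comment> \<open>The first m terms rebuild \<open>u\<close> truncated after m
      coordinates.\<close>
    have "lmod_comb (free n) u (free_unit n) m = (\<lambda>j\<in>{..<n}. if j < m then u j else \<zero>)"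
      if "m \<le> n" for m
      using that
    proof (induction m)
      case 0
      then show ?case by (simp add: free_lmod_def)
    next
      case (Suc m)
      then show ?case using free_carrier[OF u]
        by (auto simp: free_lmod_def free_unit_def fun_eq_iff less_Suc_eq)
    qed
    from this[of n] have "lmod_comb (free n) u (free_unit n) n = u"
      using u by (auto simp: free_lmod_def fun_eq_iff PiE_iff extensional_def)
    moreover have "lmod_comb (free n) u (free_unit n) n \<in> U"
      by (rule F.lmod_comb_closed[OF U]) (use e free_carrier[OF u] in auto)
    ultimately show "u \<in> U" by simp
  qed
qed

end

section \<open>Finitely generated projectives and lifting\<close>

text \<open>Finitely generated projective modules, as direct summands of free modules of finite
  rank. Unlike the lifting property this mentions no test modules, so it needs no type parameters
  and yields lifting at every type.\<close>

definition free_retract :: "('a, 'b) ring_scheme \<Rightarrow> ('a, 'p, 'c) module_scheme \<Rightarrow> bool"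
  where "free_retract R P \<longleftrightarrow> left_module R P \<and>
    (\<exists>n s r. lmod_map R P (free_lmod R n) s \<and> lmod_map R (free_lmod R n) P r \<and>
      (\<forall>x\<in>carrier P. r (s x) = x))"

lemma free_retract_left_module: "free_retract R P \<Longrightarrow> left_module R P"
  by (simp add: free_retract_def)

lemma (in ring) free_retract_free: "free_retract R (free_lmod R n)"
  unfolding free_retract_def using free_module lmod_map_id by blast

text \<open>Projectivity against W -> W / U, without the quotient. Lifts are chosen on the standard
  basis and extended linearly; the vectors where the result is right modulo \<open>U\<close> form a
  submodule containing the basis.\<close>

lemma free_retract_lift_mod:
  assumes P: "free_retract R P" and W: "left_module R W" and V: "left_module R V"
    and f: "lmod_map R P W f" and T: "lmod_map R V W T" and U: "submodule U R W"
    and ex: "\<And>x. x \<in> carrier P \<Longrightarrow> \<exists>v\<in>carrier V. f x \<ominus>\<^bsub>W\<^esub> T v \<in> U"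
  obtains g where "lmod_map R P V g" "\<And>x. x \<in> carrier P \<Longrightarrow> f x \<ominus>\<^bsub>W\<^esub> T (g x) \<in> U"
proof -
  interpret W: left_module R W by fact
  obtain n s r where s: "lmod_map R P (free_lmod R n) s" and r: "lmod_map R (free_lmod R n) P r"
    and rs: "\<And>x. x \<in> carrier P \<Longrightarrow> r (s x) = x"
    using P unfolding free_retract_def by blast
  let ?F = "free_lmod R n"
  have F: "left_module R ?F" by (rule W.R.free_module)
  have "\<exists>v\<in>carrier V. f (r (W.R.free_unit n k)) \<ominus>\<^bsub>W\<^esub> T v \<in> U" for k
    using ex lmod_mapD(1)[OF r] W.R.free_unit_closed by blast
  then obtain y where y: "\<And>k. y k \<in> carrier V" "\<And>k. f (r (W.R.free_unit n k)) \<ominus>\<^bsub>W\<^esub> T (y k) \<in> U"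
    by metis
  define g where "g u = lmod_comb V u y n" for u
  have g: "lmod_map R ?F V g" unfolding g_def by (rule W.R.lmod_comb_map[OF V y(1)])
  have gu: "g (W.R.free_unit n k) = y k" if "k < n" for k
    unfolding g_def by (rule W.R.lmod_comb_unit[OF V y(1) that])
  have d: "lmod_map R ?F W (\<lambda>u. f (r u) \<ominus>\<^bsub>W\<^esub> T (g u))"
    by (intro lmod_map_diff W lmod_map_comp[OF r f] lmod_map_comp[OF g T])
  have "{u \<in> carrier ?F. f (r u) \<ominus>\<^bsub>W\<^esub> T (g u) \<in> U} = carrier ?F"
    by (rule W.R.free_generated[OF submodule_vimage[OF F W d U]]) (use y gu in auto)
  then have "f (r u) \<ominus>\<^bsub>W\<^esub> T (g u) \<in> U" if "u \<in> carrier ?F" for u using that by blast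
  then have "f x \<ominus>\<^bsub>W\<^esub> T (g (s x)) \<in> U" if "x \<in> carrier P" for x
    using that lmod_mapD(1)[OF s] rs by metis
  with lmod_map_comp[OF s g] show ?thesis using that by blast
qed

lemma free_retract_lift:
  assumes "free_retract R P" "left_module R W" "left_module R V"
    "lmod_map R P W f" "lmod_map R V W T" "f ` carrier P \<subseteq> T ` carrier V"
  obtains g where "lmod_map R P V g" "\<And>x. x \<in> carrier P \<Longrightarrow> T (g x) = f x"
proof -
  interpret W: left_module R W by fact
  note f = lmod_mapD(1)[OF assms(4)] and T = lmod_mapD(1)[OF assms(5)]
  have ex: "\<exists>v\<in>carrier V. f x \<ominus>\<^bsub>W\<^esub> T v \<in> {\<zero>\<^bsub>W\<^esub>}" if "x \<in> carrier P" for x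
  proof -
    obtain v where v: "v \<in> carrier V" "f x = T v" using assms(6) \<open>x \<in> carrier P\<close> by blast
    then have "f x \<ominus>\<^bsub>W\<^esub> T v = \<zero>\<^bsub>W\<^esub>" using W.diff_eq_zero[OF T[OF v(1)] T[OF v(1)]] by simp
    then show ?thesis using v(1) by blast
  qed
  obtain g where g: "lmod_map R P V g" "\<And>x. x \<in> carrier P \<Longrightarrow> f x \<ominus>\<^bsub>W\<^esub> T (g x) \<in> {\<zero>\<^bsub>W\<^esub>}"
    using free_retract_lift_mod[OF assms(1-5) W.submodule_zero ex] by blast
  have "T (g x) = f x" if "x \<in> carrier P" for x
    using g(2)[OF that] W.diff_eq_zero[OF f[OF that] T[OF lmod_mapD(1)[OF g(1) that]]] by simp
  with g(1) show ?thesis using that by blast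
qed

lemma retract_projective:
  fixes P :: "('a, 'p, 'e) module_scheme" and E :: "('a, 'm) module"
  assumes P: "free_retract R P" and E: "left_module R E"
    and s: "lmod_map R E P s" and r: "lmod_map R P E r" and rs: "\<And>x. x \<in> carrier E \<Longrightarrow> r (s x) = x"
  shows "lmod_projective R E TYPE('x) TYPE('y)"
  unfolding lmod_projective_def
proof (intro conjI E allI impI)
  fix U :: "('a, 'x) module" and V :: "('a, 'y) module" and g f
  assume "left_module R U \<and> left_module R V \<and> g \<in> lmod_hom R U V \<and> g ` carrier U = carrier V \<and> f \<in> lmod_hom R E V"
  then have U: "left_module R U" and V: "left_module R V" and g: "lmod_map R U V g" "g ` carrier U = carrier V"
    and f: "lmod_map R E V f" "f \<in> extensional (carrier E)" by (auto simp: lmod_hom_iff)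
  have fr: "lmod_map R P V (\<lambda>x. f (r x))" by (rule lmod_map_comp[OF r f(1)])
  obtain h where h: "lmod_map R P U h" "\<And>x. x \<in> carrier P \<Longrightarrow> g (h x) = f (r x)"
    using free_retract_lift[OF P V U fr g(1)] lmod_mapD(1)[OF fr] g(2) by blast
  show "\<exists>h\<in>lmod_hom R E U. compose (carrier E) g h = f"
  proof (intro bexI)
    show "restrict (\<lambda>x. h (s x)) (carrier E) \<in> lmod_hom R E U"
      by (rule restrict_lmod_hom[OF E lmod_map_comp[OF s h(1)]])
    show "compose (carrier E) g (restrict (\<lambda>x. h (s x)) (carrier E)) = f"
      by (rule extensionalityI[OF _ f(2)]) (use h(2) rs lmod_mapD(1)[OF s] in \<open>auto simp: compose_def\<close>)
  qed
qed

text \<open>For \<open>Z\<close> the kernel of an epimorphism from a projective module \<open>P\<close> onto \<open>E\<close>, this is the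
  vanishing of \<open>Ext\<^sup>1(E, Y)\<close>.\<close>

definition extends ::
    "('a, 'b) ring_scheme \<Rightarrow> ('a, 'p, 'c) module_scheme \<Rightarrow> 'p set \<Rightarrow> ('a, 'y, 'd) module_scheme \<Rightarrow> bool"
  where "extends R P Z Y \<longleftrightarrow> (\<forall>f. lmod_map R (P\<lparr>carrier := Z\<rparr>) Y f \<longrightarrow>
    (\<exists>g. lmod_map R P Y g \<and> (\<forall>x\<in>Z. g x = f x)))"

lemma extends_retract:
  assumes "extends R P Z B" "lmod_map R Y B s" "lmod_map R B Y r" "\<And>x. x \<in> carrier Y \<Longrightarrow> r (s x) = x"
  shows "extends R P Z Y"
  unfolding extends_def
proof (intro allI impI)
  fix f assume f: "lmod_map R (P\<lparr>carrier := Z\<rparr>) Y f"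
  obtain g where g: "lmod_map R P B g" "\<forall>x\<in>Z. g x = s (f x)"
    using assms(1)[unfolded extends_def, rule_format, OF lmod_map_comp[OF f assms(2)]] by blast
  have "\<forall>x\<in>Z. r (g x) = f x" using g(2) assms(4) lmod_mapD(1)[OF f] by simp
  then show "\<exists>g. lmod_map R P Y g \<and> (\<forall>x\<in>Z. g x = f x)"
    using lmod_map_comp[OF g(1) assms(3)] by (intro exI[of _ "\<lambda>x. r (g x)"]) auto
qed

lemma extends_free:
  assumes P: "left_module R P" and "extends R P Z (regular_lmod R)" shows "extends R P Z (free_lmod R n)"
  unfolding extends_def
proof (intro allI impI)
  interpret P: left_module R P by fact
  fix f assume f: "lmod_map R (P\<lparr>carrier := Z\<rparr>) (free_lmod R n) f"
  have fk: "lmod_map R (P\<lparr>carrier := Z\<rparr>) (regular_lmod R) (\<lambda>x. f x k)" if "k < n" for k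
    using lmod_mapD[OF f] that unfolding lmod_map_def 
    by (auto simp: free_lmod_def PiE_iff)
  have "\<exists>g. k < n \<longrightarrow> lmod_map R P (regular_lmod R) g \<and> (\<forall>x\<in>Z. g x = f x k)" for k
    using assms(2)[unfolded extends_def, rule_format, OF fk] by blast
  then obtain G where G: "\<And>k. k < n \<Longrightarrow> lmod_map R P (regular_lmod R) (G k)"
    "\<And>k x. k < n \<Longrightarrow> x \<in> Z \<Longrightarrow> G k x = f x k" by metis
  define g where "g x = (\<lambda>k\<in>{..<n}. G k x)" for x
  have "lmod_map R P (free_lmod R n) g"
    using lmod_mapD[OF G(1)] unfolding lmod_map_def g_def
    by (auto simp: free_lmod_def PiE_iff fun_eq_iff)
  moreover have "g x = f x" if "x \<in> Z" for x
    using G(2) that lmod_mapD(1)[OF f, of x] by (auto simp: g_def fun_eq_iff free_lmod_def PiE_iff extensional_def)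
  ultimately show "\<exists>g. lmod_map R P (free_lmod R n) g \<and> (\<forall>x\<in>Z. g x = f x)" by blast
qed

lemma extends_free_retract:
  assumes "left_module R P" "extends R P Z (regular_lmod R)" "free_retract R Q" shows "extends R P Z Q"
  using assms(3) extends_retract[OF extends_free[OF assms(1,2)]] unfolding free_retract_def by blast

text \<open>Dimension shifting along 0 -> ker p -> B -> Y -> 0. With E = Q / im \<pi> it is the
  exactness of Ext^1(E, Y) -> Ext^2(E, ker p) -> Ext^2(E, B), where Ext^2(E, -) is read as Ext^1(im
  \<pi>, -).\<close>

lemma extends_shift:
  assumes P: "left_module R P" and Q: "free_retract R Q" and B: "left_module R B" and Y: "left_module R Y"
    and \<pi>: "lmod_map R P Q \<pi>" and p: "lmod_map R B Y p" "p ` carrier B = carrier Y"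
    and eB: "extends R P (lmod_ker P Q \<pi>) B" and eY: "extends R Q (\<pi> ` carrier P) Y"
  shows "extends R P (lmod_ker P Q \<pi>) (B\<lparr>carrier := lmod_ker B Y p\<rparr>)"
  unfolding extends_def
proof (intro allI impI)
  interpret P: left_module R P by fact
  interpret B: left_module R B by fact
  interpret Y: left_module R Y by fact
  have Q': "left_module R Q" using Q by (rule free_retract_left_module)
  let ?Z = "lmod_ker P Q \<pi>"
  fix f assume f0: "lmod_map R (P\<lparr>carrier := ?Z\<rparr>) (B\<lparr>carrier := lmod_ker B Y p\<rparr>) f"
  have fk: "f x \<in> carrier B" "p (f x) = \<zero>\<^bsub>Y\<^esub>" if "x \<in> ?Z" for x
    using lmod_mapD(1)[OF f0] that by (auto simp: lmod_ker_def)
  have f: "lmod_map R (P\<lparr>carrier := ?Z\<rparr>) B f"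
    using f0 by (subst (asm) lmod_map_cod_iff) (auto simp: lmod_ker_def)
  obtain G where G: "lmod_map R P B G" "\<And>x. x \<in> ?Z \<Longrightarrow> G x = f x"
    using eB[unfolded extends_def, rule_format, OF f] by blast
  obtain q where q: "lmod_map R (Q\<lparr>carrier := \<pi> ` carrier P\<rparr>) Y q"
    "\<And>x. x \<in> carrier P \<Longrightarrow> q (\<pi> x) = p (G x)"
  proof (rule lmod_map_factor[OF P Q' Y \<pi> lmod_map_comp[OF G(1) p(1)]])
    fix x assume "x \<in> carrier P" "\<pi> x = \<zero>\<^bsub>Q\<^esub>"
    then have "x \<in> ?Z" by (simp add: lmod_ker_def)
    then show "p (G x) = \<zero>\<^bsub>Y\<^esub>" using fk G by simp
  qed blast
  obtain h where h: "lmod_map R Q Y h" "\<And>x. x \<in> \<pi> ` carrier P \<Longrightarrow> h x = q x"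
    using eY[unfolded extends_def, rule_format, OF q(1)] by blast
  obtain L where L: "lmod_map R Q B L" "\<And>x. x \<in> carrier Q \<Longrightarrow> p (L x) = h x"
    using free_retract_lift[OF Q Y B h(1) p(1)] lmod_mapD(1)[OF h(1)] p(2) by blast
  \<comment> \<open>\<open>G\<close> extends \<open>f\<close> but need not stay in the kernel of
    \<open>p\<close>. Its error p o G factors through \<pi> and lifts to \<open>L\<close> on
    \<open>Q\<close>; subtracting L o \<pi> removes the error and changes nothing on the kernel of
    \<pi>.\<close>
  define g where "g x = G x \<ominus>\<^bsub>B\<^esub> L (\<pi> x)" for x
  have g: "lmod_map R P B g" unfolding g_def
    by (intro lmod_map_diff B G(1) lmod_map_comp[OF \<pi> L(1)])
  have "p (g x) = \<zero>\<^bsub>Y\<^esub>" if x: "x \<in> carrier P" for x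
  proof -
    have Gx: "G x \<in> carrier B" and Lx: "L (\<pi> x) \<in> carrier B" and px: "\<pi> x \<in> carrier Q"
      using x lmod_mapD(1)[OF G(1)] lmod_mapD(1)[OF L(1)] lmod_mapD(1)[OF \<pi>] by auto
    have "p (g x) = p (G x) \<ominus>\<^bsub>Y\<^esub> p (L (\<pi> x))"
      unfolding g_def by (rule lmod_map_minus[OF B Y p(1) Gx Lx])
    also have "p (L (\<pi> x)) = p (G x)" using L(2)[OF px] h(2) q(2)[OF x] x by simp
    finally show ?thesis using Y.diff_eq_zero lmod_mapD(1)[OF p(1) Gx] by simp
  qed
  then have gk: "lmod_map R P (B\<lparr>carrier := lmod_ker B Y p\<rparr>) g"
    using g lmod_mapD(1)[OF g] by (subst lmod_map_cod_iff) (auto simp: lmod_ker_def)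
  have "g x = f x" if x: "x \<in> ?Z" for x
  proof -
    have "L (\<pi> x) = \<zero>\<^bsub>B\<^esub>" using x lmod_map_zero[OF Q' B L(1)] by (simp add: lmod_ker_def)
    then show ?thesis using G(2)[OF x] fk(1)[OF x] by (simp add: g_def a_minus_def)
  qed
  with gk show "\<exists>g. lmod_map R P (B\<lparr>carrier := lmod_ker B Y p\<rparr>) g \<and> (\<forall>x\<in>?Z. g x = f x)"
    by blast
qed

text \<open>Extended to \<open>P\<close>, the section \<open>s\<close> gives a projection p' o S of
  \<open>P\<close> onto the kernel of \<open>p\<close>. The complementary map x - p' (S x) kills
  that kernel and descends to a section of \<open>p\<close>. Splitting of one step of a resolution
  thus passes to the step before it.\<close>

lemma split_epi_descend:
  assumes P: "left_module R P" and E: "left_module R E" and P': "left_module R P'"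
    and p: "lmod_map R P E p" "p ` carrier P = carrier E"
    and p': "lmod_map R P' P p'" "p' ` carrier P' = lmod_ker P E p"
    and s: "lmod_map R (P\<lparr>carrier := lmod_ker P E p\<rparr>) P' s" "\<And>x. x \<in> lmod_ker P E p \<Longrightarrow> p' (s x) = x"
    and e: "extends R P (lmod_ker P E p) P'"
  obtains t where "lmod_map R E P t" "\<And>x. x \<in> carrier E \<Longrightarrow> p (t x) = x"
proof -
  interpret P: left_module R P by fact
  interpret E: left_module R E by fact
  obtain S where S: "lmod_map R P P' S" "\<And>x. x \<in> lmod_ker P E p \<Longrightarrow> S x = s x"
    using e[unfolded extends_def, rule_format, OF s(1)] by blast
  have pS: "lmod_map R P P (\<lambda>x. p' (S x))" by (rule lmod_map_comp[OF S(1) p'(1)])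
  have d: "lmod_map R P P (\<lambda>x. x \<ominus>\<^bsub>P\<^esub> p' (S x))"
    by (intro lmod_map_diff P lmod_map_id pS)
  have ker: "x \<ominus>\<^bsub>P\<^esub> p' (S x) = \<zero>\<^bsub>P\<^esub>" if "x \<in> carrier P" "p x = \<zero>\<^bsub>E\<^esub>" for x
  proof -
    have "x \<in> lmod_ker P E p" using that by (simp add: lmod_ker_def)
    then have "p' (S x) = x" using S(2) s(2) by simp
    then show ?thesis using that P.diff_eq_zero by simp
  qed
  obtain t where t: "lmod_map R (E\<lparr>carrier := p ` carrier P\<rparr>) P t"
    "\<And>x. x \<in> carrier P \<Longrightarrow> t (p x) = x \<ominus>\<^bsub>P\<^esub> p' (S x)"
    using lmod_map_factor[OF P E P p(1) d ker] by blast
  have "p (t (p x)) = p x" if x: "x \<in> carrier P" for x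
  proof -
    have k: "p' (S x) \<in> lmod_ker P E p" using p'(2) lmod_mapD(1)[OF S(1) x] by blast
    then have "p (x \<ominus>\<^bsub>P\<^esub> p' (S x)) = p x \<ominus>\<^bsub>E\<^esub> \<zero>\<^bsub>E\<^esub>"
      using lmod_map_minus[OF P E p(1) x] by (simp add: lmod_ker_def)
    then show ?thesis using t(2)[OF x] lmod_mapD(1)[OF p(1) x] by (simp add: a_minus_def)
  qed
  then have "p (t x) = x" if "x \<in> carrier E" for x
  proof -
    have "x \<in> p ` carrier P" using that p(2) by simp
    then obtain y where y: "y \<in> carrier P" "x = p y" by (rule imageE)
    show ?thesis unfolding y(2) by (rule \<open>\<And>x. x \<in> carrier P \<Longrightarrow> p (t (p x)) = p x\<close>[OF y(1)])
  qed
  moreover have "lmod_map R E P t" using t(1)[unfolded p(2)] by simp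
  ultimately show ?thesis using that by blast
qed

section \<open>Comparing syzygies of different resolutions\<close>

text \<open>\<open>E\<close> is a direct summand of the sum of \<open>N\<close> and a projective
  \<open>G\<close>, that is, a summand of \<open>N\<close> in the stable category. A definition
  cannot quantify over types, so the element type of \<open>G\<close> is fixed to one that holds the
  terms of the minimal resolution.\<close>

definition stable_retract ::
    "('a, 'b) ring_scheme \<Rightarrow> ('a, 'm, 'c) module_scheme \<Rightarrow> ('a, 'n, 'd) module_scheme \<Rightarrow> bool"
  where "stable_retract R E N \<longleftrightarrow> (\<exists>a b q p (G :: ('a, nat \<Rightarrow> 'a) module).
    free_retract R G \<and> lmod_map R E N a \<and> lmod_map R N E b \<and> lmod_map R E G q \<and> lmod_map R G E p \<and>
    (\<forall>x\<in>carrier E. x = b (a x) \<oplus>\<^bsub>E\<^esub> p (q x)))"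

lemma stable_retract_refl:
  assumes "left_module R E" shows "stable_retract R E E"
proof -
  interpret left_module R E by fact
  have "lmod_map R E (free_lmod R 0) (\<lambda>_. \<zero>\<^bsub>free_lmod R 0\<^esub>)"
    by (rule lmod_map_null[OF R.free_module])
  then show ?thesis unfolding stable_retract_def
    using R.free_retract_free[of 0] lmod_map_id lmod_map_null[OF assms] M.r_zero by metis
qed

text \<open>\<open>a\<close>, \<open>b\<close> and the map out of the projective factor are lifted
  along \<open>p\<close> and \<open>r\<close>. The defect \<open>s\<close> of the lifted identity is
  killed by \<open>p\<close>, so it sends all of \<open>P\<close> into the kernel; on the kernel
  itself the lifted projective part is zero.\<close>

lemma stable_retract_syzygy_maps:
  fixes P :: "('a, 'p, 'c) module_scheme" and F :: "('a, 'q, 'd) module_scheme"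
  assumes sr: "stable_retract R E N" and E: "left_module R E" and N: "left_module R N"
    and P: "free_retract R P" and F: "free_retract R F"
    and p: "lmod_map R P E p" "p ` carrier P = carrier E"
    and r: "lmod_map R F N r" "r ` carrier F = carrier N"
  obtains \<alpha> \<beta> s where "lmod_map R P F \<alpha>" "\<alpha> ` lmod_ker P E p \<subseteq> lmod_ker F N r"
    "lmod_map R F P \<beta>" "\<beta> ` lmod_ker F N r \<subseteq> lmod_ker P E p"
    "lmod_map R P P s" "s ` carrier P \<subseteq> lmod_ker P E p"
    "\<And>x. x \<in> lmod_ker P E p \<Longrightarrow> x = \<beta> (\<alpha> x) \<oplus>\<^bsub>P\<^esub> s x"
proof -
  have P': "left_module R P" and F': "left_module R F" using P F by (auto intro: free_retract_left_module)
  interpret P: left_module R P by fact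
  interpret F: left_module R F by fact
  interpret E: left_module R E by fact
  interpret N: left_module R N by fact
  obtain a b q c and G :: "('a, nat \<Rightarrow> 'a) module" where G: "free_retract R G"
    and a: "lmod_map R E N a" and b: "lmod_map R N E b" and q: "lmod_map R E G q" and c: "lmod_map R G E c"
    and id: "\<And>x. x \<in> carrier E \<Longrightarrow> x = b (a x) \<oplus>\<^bsub>E\<^esub> c (q x)"
    using sr unfolding stable_retract_def by blast
  have G': "left_module R G" using G by (rule free_retract_left_module)
  note ap = lmod_map_comp[OF p(1) a] and br = lmod_map_comp[OF r(1) b] and qp = lmod_map_comp[OF p(1) q]
  obtain \<alpha> where \<alpha>: "lmod_map R P F \<alpha>" "\<And>x. x \<in> carrier P \<Longrightarrow> r (\<alpha> x) = a (p x)"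
    using free_retract_lift[OF P N F' ap r(1)] lmod_mapD(1)[OF ap] r(2) by blast
  obtain \<beta> where \<beta>: "lmod_map R F P \<beta>" "\<And>x. x \<in> carrier F \<Longrightarrow> p (\<beta> x) = b (r x)"
    using free_retract_lift[OF F E P' br p(1)] lmod_mapD(1)[OF br] p(2) by blast
  obtain d where d: "lmod_map R G P d" "\<And>x. x \<in> carrier G \<Longrightarrow> p (d x) = c x"
    using free_retract_lift[OF G E P' c p(1)] lmod_mapD(1)[OF c] p(2) by blast
  define s where "s x = x \<ominus>\<^bsub>P\<^esub> (\<beta> (\<alpha> x) \<oplus>\<^bsub>P\<^esub> d (q (p x)))" for x
  have s: "lmod_map R P P s" unfolding s_def
    by (intro lmod_map_diff lmod_map_add P' lmod_map_id lmod_map_comp[OF \<alpha>(1) \<beta>(1)] lmod_map_comp[OF qp d(1)])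
  have cl: "\<beta> (\<alpha> x) \<in> carrier P" "d (q (p x)) \<in> carrier P" "\<alpha> x \<in> carrier F" "q (p x) \<in> carrier G" "p x \<in> carrier E"
    if "x \<in> carrier P" for x
    using that lmod_mapD(1)[OF \<alpha>(1)] lmod_mapD(1)[OF \<beta>(1)] lmod_mapD(1)[OF qp] lmod_mapD(1)[OF d(1)] lmod_mapD(1)[OF p(1)]
    by auto
  have "p (s x) = \<zero>\<^bsub>E\<^esub>" if x: "x \<in> carrier P" for x
  proof -
    have "p (s x) = p x \<ominus>\<^bsub>E\<^esub> (p (\<beta> (\<alpha> x)) \<oplus>\<^bsub>E\<^esub> p (d (q (p x))))"
      using cl[OF x] x lmod_mapD(2)[OF p(1)] unfolding s_def
      by (subst lmod_map_minus[OF P' E p(1)]) auto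
    also have "\<dots> = p x \<ominus>\<^bsub>E\<^esub> p x"
      using id[OF cl(5)[OF x]] \<beta>(2)[OF cl(3)[OF x]] \<alpha>(2)[OF x] d(2)[OF cl(4)[OF x]] by simp
    finally show ?thesis using cl(5)[OF x] E.diff_eq_zero by simp
  qed
  then have s': "s ` carrier P \<subseteq> lmod_ker P E p" using lmod_mapD(1)[OF s] by (auto simp: lmod_ker_def)
  have zero: "x = \<beta> (\<alpha> x) \<oplus>\<^bsub>P\<^esub> s x" if "x \<in> lmod_ker P E p" for x
  proof -
    have x: "x \<in> carrier P" "p x = \<zero>\<^bsub>E\<^esub>" using that by (auto simp: lmod_ker_def)
    have "d (q (p x)) = \<zero>\<^bsub>P\<^esub>"
      using x(2) lmod_map_zero[OF E G' q] lmod_map_zero[OF G' P' d(1)] by simp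
    then have "s x = x \<ominus>\<^bsub>P\<^esub> \<beta> (\<alpha> x)" using cl[OF x(1)] by (simp add: s_def)
    then show ?thesis using P.diff_add_cancel[OF x(1) cl(1)[OF x(1)]] cl(1)[OF x(1)] x
      by (simp add: P.M.a_comm)
  qed
  have "\<alpha> ` lmod_ker P E p \<subseteq> lmod_ker F N r"
    using \<alpha>(2) cl(3) lmod_map_zero[OF E N a] by (auto simp: lmod_ker_def)
  moreover have "\<beta> ` lmod_ker F N r \<subseteq> lmod_ker P E p"
    using \<beta>(2) lmod_mapD(1)[OF \<beta>(1)] lmod_map_zero[OF N E b] by (auto simp: lmod_ker_def)
  ultimately show ?thesis using that \<alpha>(1) \<beta>(1) s s' zero by blast
qed

text \<open>The projective through which the defect \<open>s\<close> factors is now \<open>P\<close>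
  itself: the inclusion of the kernel followed by \<open>s\<close>.\<close>

lemma stable_retract_syzygy:
  fixes P :: "('a, nat \<Rightarrow> 'a) module" and F :: "('a, 'q, 'd) module_scheme"
  assumes sr: "stable_retract R E N" and E: "left_module R E" and N: "left_module R N"
    and P: "free_retract R P" and F: "free_retract R F"
    and p: "lmod_map R P E p" "p ` carrier P = carrier E"
    and r: "lmod_map R F N r" "r ` carrier F = carrier N"
  shows "stable_retract R (P\<lparr>carrier := lmod_ker P E p\<rparr>) (F\<lparr>carrier := lmod_ker F N r\<rparr>)"
proof -
  obtain \<alpha> \<beta> s where h: "lmod_map R P F \<alpha>" "\<alpha> ` lmod_ker P E p \<subseteq> lmod_ker F N r"
    "lmod_map R F P \<beta>" "\<beta> ` lmod_ker F N r \<subseteq> lmod_ker P E p"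
    "lmod_map R P P s" "s ` carrier P \<subseteq> lmod_ker P E p"
    "\<And>x. x \<in> lmod_ker P E p \<Longrightarrow> x = \<beta> (\<alpha> x) \<oplus>\<^bsub>P\<^esub> s x"
    using stable_retract_syzygy_maps[OF assms] by blast
  have k: "lmod_ker P E p \<subseteq> carrier P" "lmod_ker F N r \<subseteq> carrier F" by (auto simp: lmod_ker_def)
  show ?thesis unfolding stable_retract_def
  proof (intro exI conjI ballI)
    show "lmod_map R (P\<lparr>carrier := lmod_ker P E p\<rparr>) (F\<lparr>carrier := lmod_ker F N r\<rparr>) \<alpha>"
      using h(1,2) k lmod_map_dom by (subst lmod_map_cod_iff) auto
    show "lmod_map R (F\<lparr>carrier := lmod_ker F N r\<rparr>) (P\<lparr>carrier := lmod_ker P E p\<rparr>) \<beta>"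
      using h(3,4) k lmod_map_dom by (subst lmod_map_cod_iff) auto
    show "lmod_map R (P\<lparr>carrier := lmod_ker P E p\<rparr>) P (\<lambda>x. x)"
      using k by (intro lmod_map_dom lmod_map_id)
    show "lmod_map R P (P\<lparr>carrier := lmod_ker P E p\<rparr>) s"
      using h k by (subst lmod_map_cod_iff) auto
  qed (use P h in auto)
qed

text \<open>On the kernel of \<open>p\<close> the map \<open>f\<close> is the sum of f o \<beta> o
  \<alpha> and f o s. The factor f o \<beta> lives on the kernel of \<open>r\<close> and extends to
  \<open>F\<close> by hypothesis, while f o s is already defined on all of \<open>P\<close>.\<close>

lemma stable_retract_extends:
  fixes P :: "('a, 'p, 'c) module_scheme" and F :: "('a, 'q, 'd) module_scheme"
  assumes sr: "stable_retract R E N" and E: "left_module R E" and N: "left_module R N"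
    and P: "free_retract R P" and F: "free_retract R F"
    and p: "lmod_map R P E p" "p ` carrier P = carrier E"
    and r: "lmod_map R F N r" "r ` carrier F = carrier N"
    and Y: "left_module R Y" and e: "extends R F (lmod_ker F N r) Y"
  shows "extends R P (lmod_ker P E p) Y"
  unfolding extends_def
proof (intro allI impI)
  obtain \<alpha> \<beta> s where h: "lmod_map R P F \<alpha>" "\<alpha> ` lmod_ker P E p \<subseteq> lmod_ker F N r"
    "lmod_map R F P \<beta>" "\<beta> ` lmod_ker F N r \<subseteq> lmod_ker P E p"
    "lmod_map R P P s" "s ` carrier P \<subseteq> lmod_ker P E p"
    "\<And>x. x \<in> lmod_ker P E p \<Longrightarrow> x = \<beta> (\<alpha> x) \<oplus>\<^bsub>P\<^esub> s x"
    using stable_retract_syzygy_maps[OF sr E N P F p r] by blast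
  have k: "lmod_ker P E p \<subseteq> carrier P" "lmod_ker F N r \<subseteq> carrier F" by (auto simp: lmod_ker_def)
  fix f assume f: "lmod_map R (P\<lparr>carrier := lmod_ker P E p\<rparr>) Y f"
  have b: "lmod_map R (F\<lparr>carrier := lmod_ker F N r\<rparr>) (P\<lparr>carrier := lmod_ker P E p\<rparr>) \<beta>"
    using h(3,4) k lmod_map_dom by (subst lmod_map_cod_iff) auto
  have s: "lmod_map R P (P\<lparr>carrier := lmod_ker P E p\<rparr>) s"
    using h k by (subst lmod_map_cod_iff) auto
  obtain g where g: "lmod_map R F Y g" "\<And>x. x \<in> lmod_ker F N r \<Longrightarrow> g x = f (\<beta> x)"
    using e[unfolded extends_def, rule_format, OF lmod_map_comp[OF b f]] by blast
  have "lmod_map R P Y (\<lambda>x. g (\<alpha> x) \<oplus>\<^bsub>Y\<^esub> f (s x))"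
    by (intro lmod_map_add Y lmod_map_comp[OF h(1) g(1)] lmod_map_comp[OF s f])
  moreover have "g (\<alpha> x) \<oplus>\<^bsub>Y\<^esub> f (s x) = f x" if x: "x \<in> lmod_ker P E p" for x
  proof -
    have 1: "\<alpha> x \<in> lmod_ker F N r" and 2: "s x \<in> lmod_ker P E p" using x h(2,6) k by blast+
    have 3: "\<beta> (\<alpha> x) \<in> lmod_ker P E p" using 1 h(4) by blast
    have "f x = f (\<beta> (\<alpha> x) \<oplus>\<^bsub>P\<^esub> s x)" using h(7)[OF x] by simp
    also have "\<dots> = f (\<beta> (\<alpha> x)) \<oplus>\<^bsub>Y\<^esub> f (s x)" using lmod_mapD(2)[OF f, of "\<beta> (\<alpha> x)" "s x"] 2 3 by simp
    finally show ?thesis using g(2)[OF 1] by simp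
  qed
  ultimately show "\<exists>g. lmod_map R P Y g \<and> (\<forall>x\<in>lmod_ker P E p. g x = f x)" by blast
qed

section \<open>Length\<close>

text \<open>In the three notions of this group the interval of submodules between \<open>V\<close>
  and \<open>W\<close> plays the part of the quotient W / V.\<close>

definition submodule_chain ::
    "('a, 'b) ring_scheme \<Rightarrow> ('a, 'm, 'c) module_scheme \<Rightarrow> 'm set \<Rightarrow> 'm set \<Rightarrow> nat \<Rightarrow> bool"
  where "submodule_chain R M V W k \<longleftrightarrow> (\<exists>C. C 0 = V \<and> C k = W \<and>
    (\<forall>i\<le>k. submodule (C i) R M) \<and> (\<forall>i<k. C i \<subset> C (Suc i)))"

definition finite_length ::
    "('a, 'b) ring_scheme \<Rightarrow> ('a, 'm, 'c) module_scheme \<Rightarrow> 'm set \<Rightarrow> 'm set \<Rightarrow> bool"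
  where "finite_length R M V W \<longleftrightarrow> (\<exists>n. \<forall>k. submodule_chain R M V W k \<longrightarrow> k \<le> n)"

text \<open>The maximum exists if chain lengths are bounded (\<open>finite_length\<close>) and some
  chain joins \<open>V\<close> to \<open>W\<close>; otherwise the value carries no
  information.\<close>

definition mlength ::
    "('a, 'b) ring_scheme \<Rightarrow> ('a, 'm, 'c) module_scheme \<Rightarrow> 'm set \<Rightarrow> 'm set \<Rightarrow> nat"
  where "mlength R M V W = (GREATEST k. submodule_chain R M V W k)"

lemma strict_steps_mono:
  assumes "\<And>i. i < k \<Longrightarrow> C i \<subset> C (Suc i)" "i \<le> j" "j \<le> k" shows "C i \<subseteq> (C j :: 'a set)"
  using assms(2,3)
proof (induction j)
  case (Suc j) then show ?case using assms(1)[of j] by (cases "i = Suc j") auto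
qed simp

text \<open>Any strictly monotone operation between intervals preserves chains; this covers change
  of scalars, change of the ambient module and the isomorphism theorem.\<close>

lemma submodule_chain_map:
  assumes "submodule_chain R M V W k"
    and "\<And>U. submodule U R M \<Longrightarrow> V \<subseteq> U \<Longrightarrow> U \<subseteq> W \<Longrightarrow> submodule (f U) S N"
    and "\<And>U U'. submodule U R M \<Longrightarrow> submodule U' R M \<Longrightarrow> V \<subseteq> U \<Longrightarrow> U \<subset> U' \<Longrightarrow> U' \<subseteq> W \<Longrightarrow> f U \<subset> f U'"
  shows "submodule_chain S N (f V) (f W) k"
proof -
  obtain C where C: "C 0 = V" "C k = W" "\<And>i. i \<le> k \<Longrightarrow> submodule (C i) R M"
    "\<And>i. i < k \<Longrightarrow> C i \<subset> C (Suc i)"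
    using assms(1) unfolding submodule_chain_def by blast
  note mono = strict_steps_mono[of k C, OF C(4)]
  have b: "V \<subseteq> C i" "C i \<subseteq> W" if "i \<le> k" for i
    using mono[of 0 i] mono[of i k] that C(1,2) by auto
  show ?thesis unfolding submodule_chain_def
  proof (intro exI[of _ "\<lambda>i. f (C i)"] conjI allI impI)
    show "f (C i) \<subset> f (C (Suc i))" if "i < k" for i
      using that C(3)[of i] C(3)[of "Suc i"] C(4)[of i] b[of i] b[of "Suc i"] by (intro assms(3)) auto
  qed (use C assms(2) b in auto)
qed

lemma submodule_chain_append:
  assumes "submodule_chain R M V U a" "submodule_chain R M U W b"
  shows "submodule_chain R M V W (a + b)"
proof -
  obtain C where C: "C 0 = V" "C a = U" "\<And>i. i \<le> a \<Longrightarrow> submodule (C i) R M" "\<And>i. i < a \<Longrightarrow> C i \<subset> C (Suc i)"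
    using assms(1) unfolding submodule_chain_def by blast
  obtain D where D: "D 0 = U" "D b = W" "\<And>i. i \<le> b \<Longrightarrow> submodule (D i) R M" "\<And>i. i < b \<Longrightarrow> D i \<subset> D (Suc i)"
    using assms(2) unfolding submodule_chain_def by blast
  define F where "F i = (if i \<le> a then C i else D (i - a))" for i
  have Fa: "F (a + j) = D j" for j using C(2) D(1) by (cases j) (auto simp: F_def)
  show ?thesis unfolding submodule_chain_def
  proof (intro exI[of _ F] conjI allI impI)
    show "F 0 = V" using C by (simp add: F_def)
    show "F (a + b) = W" using Fa D by simp
    show "submodule (F i) R M" if "i \<le> a + b" for i
      using that C(3) D(3) by (auto simp: F_def)
    show "F i \<subset> F (Suc i)" if "i < a + b" for i
    proof (cases "i < a")
      case True then show ?thesis using C(4)[of i] by (simp add: F_def)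
    next
      case False
      then obtain j where "i = a + j" by (metis le_add_diff_inverse not_less)
      then show ?thesis using Fa[of j] Fa[of "Suc j"] D(4)[of j] that by simp
    qed
  qed
qed

lemma submodule_chain_bounds:
  assumes "submodule_chain R M V W k"
  shows "submodule V R M" "submodule W R M" "V \<subseteq> W" "0 < k \<Longrightarrow> V \<subset> W"
proof -
  obtain C where C: "C 0 = V" "C k = W" "\<And>i. i \<le> k \<Longrightarrow> submodule (C i) R M"
    "\<And>i. i < k \<Longrightarrow> C i \<subset> C (Suc i)"
    using assms unfolding submodule_chain_def by blast
  have st: "i < j \<Longrightarrow> j \<le> k \<Longrightarrow> C i \<subset> C j" for i j
  proof (induction j)
    case (Suc j) then show ?case using C(4)[of j] by (cases "i = j") auto
  qed simp
  show "submodule V R M" "submodule W R M" using C by (metis order_refl zero_le)+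
  show *: "0 < k \<Longrightarrow> V \<subset> W" using st[of 0 k] C by auto
  show "V \<subseteq> W" using * C by (cases "k = 0") auto
qed

lemma submodule_chain_step:
  assumes "submodule V R M" "submodule W R M" "V \<subset> W" shows "submodule_chain R M V W 1"
  unfolding submodule_chain_def
  by (rule exI[of _ "\<lambda>i. if i = 0 then V else W"]) (use assms in auto)

lemma submodule_chain_refl: "submodule V R M \<Longrightarrow> submodule_chain R M V V 0"
  unfolding submodule_chain_def by auto

lemma submodule_chain_ex:
  assumes "submodule V R M" "submodule W R M" "V \<subseteq> W"
  obtains k where "submodule_chain R M V W k"
  using submodule_chain_step[OF assms(1,2)] submodule_chain_refl[OF assms(1)] assms(3) by blast

lemma mlength_ge:
  assumes "finite_length R M V W" "submodule_chain R M V W k" shows "k \<le> mlength R M V W"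
  using assms unfolding mlength_def finite_length_def by (metis Greatest_le_nat)

lemma mlength_chain:
  assumes "finite_length R M V W" "submodule V R M" "submodule W R M" "V \<subseteq> W"
  shows "submodule_chain R M V W (mlength R M V W)"
proof -
  obtain k where "submodule_chain R M V W k" using submodule_chain_ex assms by metis
  then show ?thesis using assms(1) unfolding mlength_def finite_length_def by (metis GreatestI_nat)
qed

lemma mlength_self: 
  assumes "submodule V R M" shows "mlength R M V V = 0" "finite_length R M V V"
proof -
  have *: "k \<le> 0" if "submodule_chain R M V V k" for k
    using submodule_chain_bounds(4)[OF that] by auto
  then show "finite_length R M V V" unfolding finite_length_def by blast
  from mlength_chain[OF this assms assms] * show "mlength R M V V = 0" by auto
qed

lemma finite_length_sub:
  assumes "finite_length R M V W" "submodule V R M" "submodule W R M"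
    "submodule V' R M" "submodule W' R M" "V \<subseteq> V'" "W' \<subseteq> W"
  shows "finite_length R M V' W'"
proof -
  obtain n where n: "\<And>k. submodule_chain R M V W k \<Longrightarrow> k \<le> n"
    using assms(1) unfolding finite_length_def by blast
  have "k \<le> n" if k: "submodule_chain R M V' W' k" for k
  proof -
    obtain a where a: "submodule_chain R M V V' a" using submodule_chain_ex assms by metis
    obtain b where b: "submodule_chain R M W' W b" using submodule_chain_ex assms by metis
    from n[OF submodule_chain_append[OF submodule_chain_append[OF a k] b]] show ?thesis by simp
  qed
  then show ?thesis unfolding finite_length_def by blast
qed

lemma mlength_strict:
  assumes "finite_length R M V W'" "submodule V R M" "submodule W R M" "submodule W' R M" "V \<subseteq> W" "W \<subset> W'"
  shows "mlength R M V W < mlength R M V W'"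
proof -
  have "finite_length R M V W" using finite_length_sub[OF assms(1,2,4,2,3)] assms(6) by blast
  from mlength_chain[OF this assms(2,3,5)]
  have "submodule_chain R M V W' (mlength R M V W + 1)"
    using submodule_chain_append submodule_chain_step[OF assms(3,4,6)] by blast
  from mlength_ge[OF assms(1) this] show ?thesis by simp
qed

lemma mlength_mono:
  assumes "finite_length R M V W'" "submodule V R M" "submodule W R M" "submodule W' R M" "V \<subseteq> W" "W \<subseteq> W'"
  shows "mlength R M V W \<le> mlength R M V W'"
proof (cases "W = W'")
  case False
  then have "W \<subset> W'" using assms(6) by blast
  from mlength_strict[OF assms(1-5) this] show ?thesis by simp
qed simp

context left_module
begin

text \<open>The chain is followed through its traces \<open>C j\<close> \<inter> \<open>U\<close>
  and \<open>C j\<close> + \<open>U\<close> on the two intervals. By the modular law each strict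
  step enlarges at least one trace, so the sum of the two lengths grows by at least one per step.
  Bounding every chain gives finiteness and one half of additivity at once.\<close>

lemma mlength_add_aux:
  assumes V: "submodule V R M" and U: "submodule U R M"
    and fin: "finite_length R M V U" "finite_length R M U W" and VU: "V \<subseteq> U" and UW: "U \<subseteq> W"
    and ch: "submodule_chain R M V W k"
  shows "k \<le> mlength R M V U + mlength R M U W"
proof -
  obtain C where C: "C 0 = V" "C k = W" "\<And>i. i \<le> k \<Longrightarrow> submodule (C i) R M"
    "\<And>i. i < k \<Longrightarrow> C i \<subset> C (Suc i)"
    using ch unfolding submodule_chain_def by blast
  have W: "submodule W R M" using C by (metis order_refl)
  note mono = strict_steps_mono[of k C, OF C(4)]
  have b: "V \<subseteq> C i" "C i \<subseteq> W" if "i \<le> k" for i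
    using mono[of 0 i] mono[of i k] that C(1,2) by auto
  let ?I = "\<lambda>j. C j \<inter> U" and ?S = "\<lambda>j. C j <+>\<^bsub>M\<^esub> U"
  have sub: "submodule (?I j) R M" "submodule (?S j) R M" "V \<subseteq> ?I j" "?I j \<subseteq> U" "U \<subseteq> ?S j" "?S j \<subseteq> W"
    if "j \<le> k" for j
    using C(3)[OF that] U b[OF that] VU UW W
    by (auto intro: submodule_inter submodule_set_add dest: set_add_upper2[OF C(3)[OF that] U, THEN subsetD]
        set_add_least[OF W b(2)[OF that] UW, THEN subsetD])
  have fI: "finite_length R M V (?I j)" and fS: "finite_length R M U (?S j)" if "j \<le> k" for j
    using finite_length_sub[OF fin(1) V U V sub(1)[OF that]] sub(4)[OF that]
      finite_length_sub[OF fin(2) U W U sub(2)[OF that]] sub(6)[OF that] by auto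
  have "j \<le> mlength R M V (?I j) + mlength R M U (?S j)" if "j \<le> k" for j
    using that
  proof (induction j)
    case (Suc j)
    then have j: "j \<le> k" "Suc j \<le> k" "j < k" by auto
    have IS: "?I j \<subseteq> ?I (Suc j)" "?S j \<subseteq> ?S (Suc j)"
      using C(4)[OF j(3)] unfolding subset_iff mem_set_add by blast+
    have le: "mlength R M V (?I j) \<le> mlength R M V (?I (Suc j))"
      "mlength R M U (?S j) \<le> mlength R M U (?S (Suc j))"
      using mlength_mono[OF fI[OF j(2)] V sub(1)[OF j(1)] sub(1)[OF j(2)] sub(3)[OF j(1)] IS(1)]
        mlength_mono[OF fS[OF j(2)] U sub(2)[OF j(1)] sub(2)[OF j(2)] sub(5)[OF j(1)] IS(2)] by auto
    \<comment> \<open>Modular law: if neither trace moved, an x in \<open>C (Suc j)\<close> is y + u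
      with y in \<open>C j\<close> and u in \<open>U\<close>; then u = x - y lies in both
      \<open>C (Suc j)\<close> and \<open>U\<close>, hence in \<open>C j\<close>.\<close>
    have "?I j \<noteq> ?I (Suc j) \<or> ?S j \<noteq> ?S (Suc j)"
    proof (rule ccontr)
      assume "\<not> ?thesis"
      then have eq: "?I j = ?I (Suc j)" "?S j = ?S (Suc j)" by auto
      note s1 = C(3)[OF j(1), unfolded submodule_iff] and s2 = C(3)[OF j(2), unfolded submodule_iff]
      have "C (Suc j) \<subseteq> C j"
      proof
        fix x assume x: "x \<in> C (Suc j)"
        then have "x \<in> ?S j" using eq(2) set_add_upper1[OF C(3)[OF j(2)] U] by blast
        then obtain y u where yu: "y \<in> C j" "u \<in> U" "x = y \<oplus>\<^bsub>M\<^esub> u" by (auto simp: mem_set_add)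
        have car: "y \<in> carrier M" "u \<in> carrier M" "x \<in> carrier M" using yu s1 x s2 U[unfolded submodule_iff] by auto
        have "x \<ominus>\<^bsub>M\<^esub> y = u" using car yu(3) 
          by (metis M.a_comm M.add.inv_solve_right' M.minus_eq)
        moreover have "x \<ominus>\<^bsub>M\<^esub> y \<in> C (Suc j)"
          using submodule_minus[OF C(3)[OF j(2)] x] yu(1) C(4)[OF j(3)] by blast
        ultimately have "u \<in> C j" using yu(2) eq(1) by blast
        then show "x \<in> C j" using yu s1 by blast
      qed
      then show False using C(4)[OF j(3)] by blast
    qed
    then have "mlength R M V (?I j) < mlength R M V (?I (Suc j)) \<or>
      mlength R M U (?S j) < mlength R M U (?S (Suc j))"
      using mlength_strict[OF fI[OF j(2)] V sub(1)[OF j(1)] sub(1)[OF j(2)] sub(3)[OF j(1)]]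
        mlength_strict[OF fS[OF j(2)] U sub(2)[OF j(1)] sub(2)[OF j(2)] sub(5)[OF j(1)]] IS by blast
    then show ?case using Suc.IH[OF j(1)] le by linarith
  qed simp
  from this[of k] have "k \<le> mlength R M V (?I k) + mlength R M U (?S k)" by simp
  moreover have "?I k = U" using C(2) UW by auto
  moreover have "?S k = W" using sub(6)[of k] set_add_upper1[OF W U] C(2) by auto
  ultimately show ?thesis by simp
qed

lemma mlength_add:
  assumes V: "submodule V R M" and U: "submodule U R M" and W: "submodule W R M"
    and fin: "finite_length R M V U" "finite_length R M U W" and VU: "V \<subseteq> U" and UW: "U \<subseteq> W"
  shows "finite_length R M V W" "mlength R M V W = mlength R M V U + mlength R M U W"
proof -
  show f: "finite_length R M V W" unfolding finite_length_def
    using mlength_add_aux[OF V U fin VU UW] by blast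
  have "mlength R M V U + mlength R M U W \<le> mlength R M V W"
    using mlength_ge[OF f submodule_chain_append[OF mlength_chain[OF fin(1) V U VU] mlength_chain[OF fin(2) U W UW]]] .
  moreover have "mlength R M V W \<le> mlength R M V U + mlength R M U W"
    using mlength_add_aux[OF V U fin VU UW] mlength_chain[OF f V W] VU UW by blast
  ultimately show "mlength R M V W = mlength R M V U + mlength R M U W" by simp
qed

text \<open>A member of greatest length is maximal, because length strictly increases along strict
  inclusions and is bounded by the length of the whole module.\<close>

lemma ex_maximal_submodule:
  assumes fin: "finite_length R M {\<zero>\<^bsub>M\<^esub>} (carrier M)" and "S \<noteq> {}" and S: "\<And>U. U \<in> S \<Longrightarrow> submodule U R M"
  obtains U where "U \<in> S" "\<And>U'. U' \<in> S \<Longrightarrow> U \<subseteq> U' \<Longrightarrow> U' = U"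
proof -
  let ?l = "mlength R M {\<zero>\<^bsub>M\<^esub>}"
  have z: "{\<zero>\<^bsub>M\<^esub>} \<subseteq> U" "U \<subseteq> carrier M" if "U \<in> S" for U using S[OF that] by (auto simp: submodule_iff)
  have f: "finite_length R M {\<zero>\<^bsub>M\<^esub>} U" if "U \<in> S" for U
    using finite_length_sub[OF fin submodule_zero submodule_self submodule_zero S[OF that]] z that by auto
  obtain U0 where "U0 \<in> S" using assms(2) by blast
  have "\<forall>U. U \<in> S \<longrightarrow> ?l U < Suc (?l (carrier M))"
    using mlength_mono[OF fin submodule_zero S submodule_self] z less_Suc_eq_le by blast
  from ex_has_greatest_nat[of "\<lambda>U. U \<in> S", OF \<open>U0 \<in> S\<close> this]
  obtain U where U: "U \<in> S" "\<And>U'. U' \<in> S \<Longrightarrow> ?l U' \<le> ?l U" by metis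
  have "U' = U" if "U' \<in> S" "U \<subseteq> U'" for U'
    using mlength_strict[OF f[OF that(1)] submodule_zero S[OF U(1)] S[OF that(1)] z(1)[OF U(1)]] U(2)[OF that(1)] that(2)
    by (metis not_less psubsetI)
  then show ?thesis using that U(1) by blast
qed

lemma ex_minimal_submodule:
  assumes fin: "finite_length R M {\<zero>\<^bsub>M\<^esub>} (carrier M)" and "S \<noteq> {}" and S: "\<And>U. U \<in> S \<Longrightarrow> submodule U R M"
  obtains U where "U \<in> S" "\<And>U'. U' \<in> S \<Longrightarrow> U' \<subseteq> U \<Longrightarrow> U' = U"
proof -
  let ?l = "mlength R M {\<zero>\<^bsub>M\<^esub>}"
  have z: "{\<zero>\<^bsub>M\<^esub>} \<subseteq> U" "U \<subseteq> carrier M" if "U \<in> S" for U using S[OF that] by (auto simp: submodule_iff)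
  have f: "finite_length R M {\<zero>\<^bsub>M\<^esub>} U" if "U \<in> S" for U
    using finite_length_sub[OF fin submodule_zero submodule_self submodule_zero S[OF that]] z that by auto
  obtain U0 where "U0 \<in> S" using assms(2) by blast
  then obtain U where U: "U \<in> S" "\<And>U'. U' \<in> S \<Longrightarrow> ?l U \<le> ?l U'"
    using ex_has_least_nat[of "\<lambda>U. U \<in> S" U0 ?l] by blast
  have "U' = U" if "U' \<in> S" "U' \<subseteq> U" for U'
    using mlength_strict[OF f[OF U(1)] submodule_zero S[OF that(1)] S[OF U(1)] z(1)[OF that(1)]] U(2)[OF that(1)] that(2)
    by (metis not_less psubsetI)
  then show ?thesis using that U(1) by blast
qed

end

section \<open>Isomorphism theorem and embeddings for intervals\<close>

text \<open>Sending \<open>U\<close> to T U + W' and taking preimages inside \<open>V\<close> are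
  mutually inverse, inclusion-preserving operations between the two intervals. They express the
  isomorphism of \<open>V\<close> modulo the preimage of \<open>W'\<close> with T V + W' modulo
  \<open>W'\<close>.\<close>

lemma submodule_chain_iso:
  assumes M: "left_module R M" and N: "left_module R N" and T: "lmod_map R M N T"
    and V: "submodule V R M" and W': "submodule W' R N"
  shows "submodule_chain R M {v \<in> V. T v \<in> W'} V k \<longleftrightarrow> submodule_chain R N W' (T ` V <+>\<^bsub>N\<^esub> W') k"
proof -
  interpret M: left_module R M by fact
  interpret N: left_module R N by fact
  let ?V' = "{v \<in> V. T v \<in> W'}" and ?W = "T ` V <+>\<^bsub>N\<^esub> W'"
  let ?f = "\<lambda>U. T ` U <+>\<^bsub>N\<^esub> W'" and ?g = "\<lambda>U. {v \<in> V. T v \<in> U}"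
  have V': "V \<subseteq> carrier M" and W'': "W' \<subseteq> carrier N" using V W' by (auto simp: M.submodule_iff N.submodule_iff)
  note Tc = lmod_mapD(1)[OF T]
  have subf: "submodule (?f U) R N" if "submodule U R M" for U
    by (rule N.submodule_set_add[OF submodule_image[OF M N T that] W'])
  have subg: "submodule (?g U) R M" if "submodule U R N" for U
  proof -
    have "?g U = V \<inter> {v \<in> carrier M. T v \<in> U}" using V' by auto
    then show ?thesis using M.submodule_inter[OF V submodule_vimage[OF M N T that]] by simp
  qed
  have gf: "?g (?f U) = U" if U: "submodule U R M" "?V' \<subseteq> U" "U \<subseteq> V" for U
  proof
    show "U \<subseteq> ?g (?f U)" using N.set_add_upper1[OF submodule_image[OF M N T U(1)] W'] U(3) by blast
    show "?g (?f U) \<subseteq> U"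
    proof
      fix v assume "v \<in> ?g (?f U)"
      then obtain u w where vuw: "v \<in> V" "u \<in> U" "w \<in> W'" "T v = T u \<oplus>\<^bsub>N\<^esub> w" by (auto simp: N.mem_set_add)
      have car: "v \<in> carrier M" "u \<in> carrier M" "w \<in> carrier N" "T u \<in> carrier N"
        using vuw V' U(3) W'' Tc by auto
      have "T (v \<ominus>\<^bsub>M\<^esub> u) = T v \<ominus>\<^bsub>N\<^esub> T u" by (rule lmod_map_minus[OF M N T car(1,2)])
      also have "\<dots> = w" using car vuw(4)
        by (metis N.M.a_comm N.M.add.inv_solve_right' N.M.add.m_closed N.M.minus_eq)
      finally have "v \<ominus>\<^bsub>M\<^esub> u \<in> ?V'" using vuw U(3) M.submodule_minus[OF V vuw(1), of u] by auto
      then have "v \<ominus>\<^bsub>M\<^esub> u \<in> U" using U(2) by blast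
      then have "(v \<ominus>\<^bsub>M\<^esub> u) \<oplus>\<^bsub>M\<^esub> u \<in> U" using vuw(2) U(1) by (simp add: M.submodule_iff)
      then show "v \<in> U" using M.diff_add_cancel[OF car(1,2)] by simp
    qed
  qed
  have fg: "?f (?g U) = U" if U: "submodule U R N" "W' \<subseteq> U" "U \<subseteq> ?W" for U
  proof
    show "?f (?g U) \<subseteq> U" by (rule N.set_add_least[OF U(1) _ U(2)]) auto
    show "U \<subseteq> ?f (?g U)"
    proof
      fix x assume x: "x \<in> U"
      then have "x \<in> ?W" using U(3) by blast
      then obtain v w where vw: "v \<in> V" "w \<in> W'" "x = T v \<oplus>\<^bsub>N\<^esub> w" by (auto simp: N.mem_set_add)
      have car: "w \<in> carrier N" "T v \<in> carrier N" using vw V' W'' Tc by auto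
      have "x \<ominus>\<^bsub>N\<^esub> w = T v" using car vw(3)
        by (metis N.M.add.inv_solve_right' N.M.add.m_closed N.M.minus_eq)
      then have "T v \<in> U" using N.submodule_minus[OF U(1) x] vw(2) U(2) by (metis subsetD)
      then show "x \<in> ?f (?g U)" using vw by (auto simp: N.mem_set_add)
    qed
  qed
  have fV': "?f ?V' = W'" by (rule fg[OF W']) (use N.set_add_upper2[OF submodule_image[OF M N T V] W'] in auto)
  have gW: "?g ?W = V" by (rule gf[OF V]) auto
  show ?thesis
  proof
    assume "submodule_chain R M ?V' V k"
    then have "submodule_chain R N (?f ?V') (?f V) k"
    proof (rule submodule_chain_map[where f = ?f])
      fix U U' assume h: "submodule U R M" "submodule U' R M" "?V' \<subseteq> U" "U \<subset> U'" "U' \<subseteq> V"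
      have "?f U \<subseteq> ?f U'" using h(4) unfolding subset_iff N.mem_set_add by blast
      moreover have "?f U \<noteq> ?f U'" using gf[OF h(1,3)] gf[OF h(2)] h by blast
      ultimately show "?f U \<subset> ?f U'" by blast
    qed (use subf in auto)
    then show "submodule_chain R N W' ?W k" using fV' by simp
  next
    assume "submodule_chain R N W' ?W k"
    then have "submodule_chain R M (?g W') (?g ?W) k"
    proof (rule submodule_chain_map[where f = ?g])
      fix U U' assume h: "submodule U R N" "submodule U' R N" "W' \<subseteq> U" "U \<subset> U'" "U' \<subseteq> ?W"
      have "?g U \<subseteq> ?g U'" using h(4) by auto
      moreover have "?g U \<noteq> ?g U'" using fg[OF h(1,3)] fg[OF h(2)] h by (metis (no_types, lifting) psubset_imp_subset subset_trans psubsetE)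
      ultimately show "?g U \<subset> ?g U'" by blast
    qed (use subg in auto)
    then show "submodule_chain R M ?V' V k" using gW by simp
  qed
qed

lemma mlength_iso:
  assumes "left_module R M" "left_module R N" "lmod_map R M N T" "submodule V R M" "submodule W' R N"
    and "V' = {v \<in> V. T v \<in> W'}" "W = T ` V <+>\<^bsub>N\<^esub> W'"
  shows "mlength R M V' V = mlength R N W' W" "finite_length R M V' V \<longleftrightarrow> finite_length R N W' W"
  unfolding mlength_def finite_length_def assms(6,7) submodule_chain_iso[OF assms(1-5)] by auto

text \<open>The maps \<open>T k\<close> embed \<open>M\<close> into the n-th power of
  \<open>N\<close>. Instead of forming the power, \<open>M\<close> is filtered by
  \<open>V k\<close>, the common kernel of the maps with index at least k; then \<open>T k\<close>
  embeds \<open>V (Suc k)\<close> modulo \<open>V k\<close> into \<open>N\<close>.\<close>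

lemma finite_length_separating:
  assumes M: "left_module R M" and N: "left_module R N"
    and T: "\<And>k. k < (n :: nat) \<Longrightarrow> lmod_map R M N (T k)"
    and fin: "finite_length R N {\<zero>\<^bsub>N\<^esub>} (carrier N)"
    and sep: "\<And>v. v \<in> carrier M \<Longrightarrow> (\<And>k. k < n \<Longrightarrow> T k v = \<zero>\<^bsub>N\<^esub>) \<Longrightarrow> v = \<zero>\<^bsub>M\<^esub>"
  shows "finite_length R M {\<zero>\<^bsub>M\<^esub>} (carrier M)"
proof -
  interpret M: left_module R M by fact
  interpret N: left_module R N by fact
  define V where "V k = {v \<in> carrier M. \<forall>j. k \<le> j \<and> j < n \<longrightarrow> T j v = \<zero>\<^bsub>N\<^esub>}" for k :: nat
  have V: "submodule (V k) R M" for k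
    unfolding M.submodule_iff V_def using lmod_mapD[OF T] lmod_map_zero[OF M N T] by auto
  have V0: "V 0 = {\<zero>\<^bsub>M\<^esub>}"
    using sep V[of 0] by (auto simp: V_def M.submodule_iff)
  have "finite_length R M {\<zero>\<^bsub>M\<^esub>} (V k)" if "k \<le> n" for k
    using that
  proof (induction k)
    case 0
    show ?case using V0 mlength_self(2)[OF V[of 0]] by simp
  next
    case (Suc k)
    then have Tk: "lmod_map R M N (T k)" using T by simp
    have eq: "V k = {v \<in> V (Suc k). T k v \<in> {\<zero>\<^bsub>N\<^esub>}}"
      using Suc.prems by (auto simp: V_def) (metis le_eq_less_or_eq Suc_leI)
    have sub: "submodule (T k ` V (Suc k) <+>\<^bsub>N\<^esub> {\<zero>\<^bsub>N\<^esub>}) R N"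
      by (rule N.submodule_set_add[OF submodule_image[OF M N Tk V] N.submodule_zero])
    have "finite_length R N {\<zero>\<^bsub>N\<^esub>} (T k ` V (Suc k) <+>\<^bsub>N\<^esub> {\<zero>\<^bsub>N\<^esub>})"
      using sub by (intro finite_length_sub[OF fin N.submodule_zero N.submodule_self N.submodule_zero sub])
        (auto simp: N.submodule_iff)
    then have "finite_length R M (V k) (V (Suc k))"
      using mlength_iso(2)[OF M N Tk V N.submodule_zero eq refl] by simp
    moreover have "{\<zero>\<^bsub>M\<^esub>} \<subseteq> V k" using V[of k] by (simp add: M.submodule_iff)
    moreover have "V k \<subseteq> V (Suc k)" by (auto simp: V_def)
    ultimately show ?case
      using M.mlength_add(1)[OF M.submodule_zero V V Suc.IH] Suc.prems by simp
  qed
  moreover have "V n = carrier M" by (auto simp: V_def)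
  ultimately show ?thesis by (metis order_refl)
qed

section \<open>The radical\<close>

lemma (in left_module) submodule_chain_sub_iff:
  assumes N: "submodule N R M" and W: "W \<subseteq> N"
  shows "submodule_chain R (M\<lparr>carrier := N\<rparr>) V W k \<longleftrightarrow> submodule_chain R M V W k"
proof
  assume "submodule_chain R (M\<lparr>carrier := N\<rparr>) V W k"
  from submodule_chain_map[OF this, where f = "\<lambda>U. U" and S = R and N = M]
  show "submodule_chain R M V W k" using submodule_sub_iff[OF N] by blast
next
  assume "submodule_chain R M V W k"
  from submodule_chain_map[OF this, where f = "\<lambda>U. U" and S = R and N = "M\<lparr>carrier := N\<rparr>"]
  show "submodule_chain R (M\<lparr>carrier := N\<rparr>) V W k" using submodule_sub_iff[OF N] W by blast
qed

lemma (in left_module) submodule_span1: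
  "x \<in> carrier M \<Longrightarrow> submodule L R (regular_lmod R) \<Longrightarrow> submodule ((\<lambda>a. a \<odot>\<^bsub>M\<^esub> x) ` L) R M"
  by (rule submodule_image[OF R.reg_module left_module_axioms R.lmod_map_smult[OF left_module_axioms]])

section \<open>The Jacobson radical as a two-sided ideal\<close>

context ring
begin

text \<open>Since \<open>r\<close> generates the simple module R / L, right multiplication by
  \<open>r\<close> induces an isomorphism of R / (L : r) with R / L. The proof argues with elements
  instead of quotients.\<close>

lemma maximal_left_ideal_colon:
  assumes L: "maximal_left_ideal R L" and r: "r \<in> carrier R" "r \<notin> L"
  shows "maximal_left_ideal R {x \<in> carrier R. x \<otimes> r \<in> L}"
proof -
  let ?C = "{x \<in> carrier R. x \<otimes> r \<in> L}"
  interpret M: left_module R "reg" by (rule reg_module)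
  have sL: "submodule L R reg"
    and max: "\<And>L'. submodule L' R reg \<Longrightarrow> L \<subseteq> L' \<Longrightarrow> L' = L \<or> L' = carrier R"
    using L by (auto simp: maximal_left_ideal_def)
  have T: "lmod_map R reg reg (\<lambda>a. a \<otimes> r)"
    using lmod_map_smult[OF reg_module, of r] r(1) by simp
  have sC: "submodule ?C R reg"
    using submodule_vimage[OF reg_module reg_module T sL] by simp
  have "\<one> \<notin> ?C" using r by simp
  then have ne: "?C \<noteq> carrier R" using one_closed by blast
  have "L' = ?C \<or> L' = carrier R" if L': "submodule L' R reg" "?C \<subseteq> L'" for L'
  proof (cases "L' = ?C")
    case False
    note sub = L'(1)[unfolded M.submodule_iff, simplified]
    obtain x where x: "x \<in> L'" "x \<otimes> r \<notin> L" using False L'(2) sub by blast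
    let ?S = "L <+>\<^bsub>reg\<^esub> (\<lambda>a. a \<otimes> r) ` L'"
    have im: "submodule ((\<lambda>a. a \<otimes> r) ` L') R reg"
      by (rule submodule_image[OF reg_module reg_module T L'(1)])
    have "x \<otimes> r \<in> ?S" using M.set_add_upper2[OF sL im] x(1) by blast
    then have "?S = carrier R"
      using max[OF M.submodule_set_add[OF sL im] M.set_add_upper1[OF sL im]] x(2) by blast
    \<comment> \<open>From r = l + y r it follows that 1 - y lies in (L : r), hence in
      \<open>L'\<close>, and so does 1.\<close>
    then have "r \<in> ?S" using r by simp
    then obtain l y where ly: "l \<in> L" "y \<in> L'" "r = l \<oplus> y \<otimes> r" unfolding M.mem_set_add by auto
    have car: "l \<in> carrier R" "y \<in> carrier R" using ly sL sub by (auto simp: M.submodule_iff)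
    have "(\<one> \<ominus> y) \<otimes> r = r \<ominus> y \<otimes> r" using car r by (simp add: l_distr a_minus_def l_minus)
    also have "\<dots> = l" using ly(3) car r
      by (metis M.M.add.inv_solve_right' a_minus_def add.inv_solve_right' add.m_closed m_closed)
    finally have "\<one> \<ominus> y \<in> ?C" using ly(1) car by simp
    then have "(\<one> \<ominus> y) \<oplus> y \<in> L'" using L'(2) sub ly(2) by blast
    then have "\<one> \<in> L'" using M.diff_add_cancel[of \<one> y] car by (simp add: a_minus_def a_assoc l_neg)
    then have "a \<in> L'" if "a \<in> carrier R" for a using sub that r_one by metis
    then show ?thesis using sub by blast
  qed simp
  then show ?thesis unfolding maximal_left_ideal_def using sC ne by blast
qed

abbreviation J :: "'a set" where "J \<equiv> jacobson_radical R"

text \<open>The radical is defined by left ideals only. For \<open>r\<close> outside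
  \<open>L\<close>, the element \<open>a\<close> lies in the maximal left ideal (L : r), which says
  that a r lies in \<open>L\<close>.\<close>

lemma jacobson_right:
  assumes "a \<in> J" "r \<in> carrier R" shows "a \<otimes> r \<in> J"
proof -
  interpret M: left_module R "reg" by (rule reg_module)
  have a: "a \<in> carrier R" using assms(1) by (simp add: jacobson_radical_def)
  have "a \<otimes> r \<in> L" if L: "maximal_left_ideal R L" for L
  proof (cases "r \<in> L")
    case True
    have "submodule L R reg" using L by (simp add: maximal_left_ideal_def)
    then show ?thesis using True a by (simp add: M.submodule_iff)
  next
    case False
    from maximal_left_ideal_colon[OF L assms(2) this] assms(1) show ?thesis
      by (auto simp: jacobson_radical_def)
  qed
  then show ?thesis using a assms(2) by (simp add: jacobson_radical_def)
qed

text \<open>The submodule J U generated by products. As an intersection it avoids finite sums of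
  products; \<open>jmul_least\<close> is its induction principle.\<close>

definition jmul :: "('a, 'm, 'c) module_scheme \<Rightarrow> 'm set \<Rightarrow> 'm set"
  where "jmul M U = \<Inter>{N. submodule N R M \<and> (\<forall>a\<in>J. \<forall>u\<in>U. a \<odot>\<^bsub>M\<^esub> u \<in> N)}"

lemma jmul_mem: "a \<in> J \<Longrightarrow> u \<in> U \<Longrightarrow> a \<odot>\<^bsub>M\<^esub> u \<in> jmul M U"
  by (auto simp: jmul_def)

lemma jmul_least:
  "submodule N R M \<Longrightarrow> (\<And>a u. a \<in> J \<Longrightarrow> u \<in> U \<Longrightarrow> a \<odot>\<^bsub>M\<^esub> u \<in> N) \<Longrightarrow> jmul M U \<subseteq> N"
  by (auto simp: jmul_def)

lemma jacobson_carrier: "a \<in> J \<Longrightarrow> a \<in> carrier R"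
  by (simp add: jacobson_radical_def)

lemma jmul_submodule:
  assumes "left_module R M" "U \<subseteq> carrier M" shows "submodule (jmul M U) R M"
proof -
  interpret M: left_module R M by fact
  have "carrier M \<in> {N. submodule N R M \<and> (\<forall>a\<in>J. \<forall>u\<in>U. a \<odot>\<^bsub>M\<^esub> u \<in> N)}"
    using assms(2) jacobson_carrier by auto
  then show ?thesis unfolding jmul_def by (intro M.submodule_Inter) blast+
qed

lemma jmul_subset:
  assumes "left_module R M" "submodule U R M" shows "jmul M U \<subseteq> U"
proof -
  interpret M: left_module R M by fact
  show ?thesis
    by (rule jmul_least) (use assms(2) jacobson_carrier in \<open>auto simp: M.submodule_iff\<close>)
qed

lemma jmul_map:
  assumes M: "left_module R M" and N: "left_module R N" and f: "lmod_map R M N f"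
    and U: "U \<subseteq> carrier M" and W: "W \<subseteq> carrier N" "f ` U \<subseteq> W"
  shows "f ` jmul M U \<subseteq> jmul N W"
proof -
  have "jmul M U \<subseteq> {x \<in> carrier M. f x \<in> jmul N W}"
  proof (rule jmul_least[OF submodule_vimage[OF M N f jmul_submodule[OF N W(1)]]])
    fix a u assume a: "a \<in> J" and u: "u \<in> U"
    interpret M: left_module R M by fact
    have u': "u \<in> carrier M" using u U by blast
    have "f (a \<odot>\<^bsub>M\<^esub> u) = a \<odot>\<^bsub>N\<^esub> f u" using lmod_mapD(3)[OF f] jacobson_carrier[OF a] u' by simp
    moreover have "a \<odot>\<^bsub>N\<^esub> f u \<in> jmul N W" using jmul_mem[OF a, of "f u" W N] u W(2) by blast
    ultimately show "a \<odot>\<^bsub>M\<^esub> u \<in> {x \<in> carrier M. f x \<in> jmul N W}"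
      using jacobson_carrier[OF a] u' by simp
  qed
  then show ?thesis by blast
qed

text \<open>Closure under scalars is where \<open>J\<close> must be a right ideal: a (r x) = (a r) x
  with a r again in \<open>J\<close>.\<close>

lemma submodule_annihilated:
  assumes "left_module R M" and W: "submodule W R M"
  shows "submodule {x \<in> carrier M. \<forall>a\<in>J. a \<odot>\<^bsub>M\<^esub> x \<in> W} R M"
proof -
  interpret M: left_module R M by fact
  note w = W[unfolded M.submodule_iff]
  show ?thesis unfolding M.submodule_iff
  proof (intro conjI ballI)
    show "\<zero>\<^bsub>M\<^esub> \<in> {x \<in> carrier M. \<forall>a\<in>J. a \<odot>\<^bsub>M\<^esub> x \<in> W}"
      using w jacobson_carrier by simp
  next
    fix x y assume "x \<in> {x \<in> carrier M. \<forall>a\<in>J. a \<odot>\<^bsub>M\<^esub> x \<in> W}"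
      "y \<in> {x \<in> carrier M. \<forall>a\<in>J. a \<odot>\<^bsub>M\<^esub> x \<in> W}"
    then show "x \<oplus>\<^bsub>M\<^esub> y \<in> {x \<in> carrier M. \<forall>a\<in>J. a \<odot>\<^bsub>M\<^esub> x \<in> W}"
      using w jacobson_carrier by (simp add: M.smult_r_distr)
  next
    fix r x assume "r \<in> carrier R" "x \<in> {x \<in> carrier M. \<forall>a\<in>J. a \<odot>\<^bsub>M\<^esub> x \<in> W}"
    then show "r \<odot>\<^bsub>M\<^esub> x \<in> {x \<in> carrier M. \<forall>a\<in>J. a \<odot>\<^bsub>M\<^esub> x \<in> W}"
      using jacobson_carrier jacobson_right by (auto simp flip: M.smult_assoc)
  qed auto
qed

end

section \<open>Algebras of finite length over central scalars\<close>

text \<open>Finiteness and counting both go through \<open>Z\<close>. Submodules over the ring are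
  also submodules over \<open>Z\<close>, so finite length over \<open>Z\<close> gives chain
  conditions, and centrality of \<open>Z\<close> makes Hom groups into modules over it.\<close>

locale artin_algebra = ring R for R :: "('a, 'b) ring_scheme" (structure) +
  fixes Z :: "'a set"
  assumes subring: "subring Z R"
    and central: "\<lbrakk>z \<in> Z; a \<in> carrier R\<rbrakk> \<Longrightarrow> z \<otimes> a = a \<otimes> z"
    and finite_length_self:
      "finite_length (R\<lparr>carrier := Z\<rparr>) reg {\<zero>} (carrier R)"
begin

abbreviation RZ :: "('a, 'b) ring_scheme" where "RZ \<equiv> R\<lparr>carrier := Z\<rparr>"

abbreviation flen :: "('a, 'm, 'c) module_scheme \<Rightarrow> bool"
  where "flen M \<equiv> finite_length RZ M {\<zero>\<^bsub>M\<^esub>} (carrier M)"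

lemma Z_carrier: "z \<in> Z \<Longrightarrow> z \<in> carrier R"
  using subringE(1)[OF subring] by blast

lemma scalars_left_module:
  assumes "left_module R M" shows "left_module RZ M"
proof -
  interpret M: left_module R M by fact
  have "left_module_axioms RZ M"
    by (rule left_module_axioms.intro)
      (auto simp: Z_carrier M.smult_l_distr M.smult_r_distr M.smult_assoc)
  then show ?thesis
    by (intro left_module.intro subring_is_ring[OF subring] M.M.abelian_group_axioms)
qed

lemma scalars_submodule:
  assumes "left_module R M" "submodule U R M" shows "submodule U RZ M"
proof -
  interpret M: left_module R M by fact
  interpret M': left_module RZ M by (rule scalars_left_module[OF assms(1)])
  show ?thesis using assms(2) Z_carrier unfolding M.submodule_iff M'.submodule_iff by auto
qed

lemma scalars_map: "lmod_map R M N f \<Longrightarrow> lmod_map RZ M N f"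
  using Z_carrier by (auto simp: lmod_map_def)

lemma ex_maximal:
  assumes "left_module R M" "flen M" "S \<noteq> {}" "\<And>U. U \<in> S \<Longrightarrow> submodule U R M"
  obtains U where "U \<in> S" "\<And>U'. U' \<in> S \<Longrightarrow> U \<subseteq> U' \<Longrightarrow> U' = U"
  using left_module.ex_maximal_submodule[OF scalars_left_module[OF assms(1)] assms(2,3)]
    scalars_submodule[OF assms(1) assms(4)] by blast

lemma ex_minimal:
  assumes "left_module R M" "flen M" "S \<noteq> {}" "\<And>U. U \<in> S \<Longrightarrow> submodule U R M"
  obtains U where "U \<in> S" "\<And>U'. U' \<in> S \<Longrightarrow> U' \<subseteq> U \<Longrightarrow> U' = U"
  using left_module.ex_minimal_submodule[OF scalars_left_module[OF assms(1)] assms(2,3)]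
    scalars_submodule[OF assms(1) assms(4)] by blast

lemma flen_sub:
  assumes M: "left_module R M" and "flen M" and U: "submodule U R M"
  shows "flen (M\<lparr>carrier := U\<rparr>)" "finite_length RZ M {\<zero>\<^bsub>M\<^esub>} U"
proof -
  interpret M: left_module RZ M by (rule scalars_left_module[OF M])
  have U': "submodule U RZ M" by (rule scalars_submodule[OF M U])
  show *: "finite_length RZ M {\<zero>\<^bsub>M\<^esub>} U"
    using U' by (intro finite_length_sub[OF assms(2) M.submodule_zero M.submodule_self M.submodule_zero])
      (auto simp: M.submodule_iff)
  then show "flen (M\<lparr>carrier := U\<rparr>)"
    using M.submodule_chain_sub_iff[OF U'] by (simp add: finite_length_def)
qed

lemma flen_regular: "flen reg"
  using finite_length_self by simp

lemma flen_free: "flen (free n)"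
proof (rule finite_length_separating[where T = "\<lambda>k u. u k"])
  show "left_module RZ (free n)" "left_module RZ reg"
    by (intro scalars_left_module free_module reg_module)+
  show "lmod_map RZ (free n) reg (\<lambda>u. u k)" if "k < n" for k
    using that Z_carrier by (auto simp: lmod_map_def free_lmod_def)
qed (use flen_regular in \<open>auto simp: free_lmod_def fun_eq_iff PiE_iff extensional_def\<close>)

text \<open>The form in which semisimplicity of R / J enters: \<open>W\<close> has a complement
  modulo the radical. A minimal \<open>V\<close> with W + V = R works. If a maximal left ideal
  \<open>L\<close> missed some element of W \<inter> V, then L + (W \<inter> V) = R, and V \<inter>
  L would be a smaller choice.\<close>

lemma ex_left_ideal_complement:
  assumes W: "submodule W R reg"
  obtains V where "submodule V R reg" "W <+>\<^bsub>reg\<^esub> V = carrier R"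
    "W \<inter> V \<subseteq> J"
proof -
  interpret M: left_module R "reg" by (rule reg_module)
  let ?S = "{V. submodule V R reg \<and> W <+>\<^bsub>reg\<^esub> V = carrier R}"
  have "carrier R \<in> ?S"
    using M.set_add_upper2[OF W M.submodule_self] M.set_add_least[OF M.submodule_self _ order_refl, of W] W M.submodule_self
    by (auto simp: M.submodule_iff)
  then obtain V where V: "V \<in> ?S" and min: "\<And>V'. V' \<in> ?S \<Longrightarrow> V' \<subseteq> V \<Longrightarrow> V' = V"
    using ex_minimal[OF reg_module flen_regular, of ?S] by blast
  have V': "submodule V R reg" "W <+>\<^bsub>reg\<^esub> V = carrier R" using V by auto
  have "x \<in> L" if x: "x \<in> W" "x \<in> V" and L: "maximal_left_ideal R L" for x L
  proof (rule ccontr)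
    assume "x \<notin> L"
    have sL: "submodule L R reg"
      and max: "\<And>L'. submodule L' R reg \<Longrightarrow> L \<subseteq> L' \<Longrightarrow> L' = L \<or> L' = carrier R"
      using L by (auto simp: maximal_left_ideal_def)
    have WV: "submodule (W \<inter> V) R reg" by (rule M.submodule_inter[OF W V'(1)])
    have "L <+>\<^bsub>reg\<^esub> (W \<inter> V) = carrier R"
      using max[OF M.submodule_set_add[OF sL WV] M.set_add_upper1[OF sL WV]]
        M.set_add_upper2[OF sL WV] x \<open>x \<notin> L\<close> by blast
    then have split: "\<exists>l\<in>L. \<exists>w\<in>W \<inter> V. v = l \<oplus> w" if "v \<in> carrier R" for v
      using that M.mem_set_add[of v L "W \<inter> V"] by simp
    have sVL: "submodule (V \<inter> L) R reg" by (rule M.submodule_inter[OF V'(1) sL])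
    note w = W[unfolded M.submodule_iff, simplified] and v = V'(1)[unfolded M.submodule_iff, simplified]
      and l = sL[unfolded M.submodule_iff, simplified]
    have "carrier R \<subseteq> W <+>\<^bsub>reg\<^esub> (V \<inter> L)"
    proof
      fix r assume "r \<in> carrier R"
      then obtain a b where ab: "a \<in> W" "b \<in> V" "r = a \<oplus> b"
        using V'(2) M.mem_set_add[of r W V] by auto
      obtain c d where cd: "c \<in> L" "d \<in> W" "d \<in> V" "b = c \<oplus> d" using split[of b] ab v by blast
      have car: "a \<in> carrier R" "b \<in> carrier R" "c \<in> carrier R" "d \<in> carrier R"
        using ab cd w v l by auto
      have "b \<ominus>\<^bsub>reg\<^esub> d = c" using car cd(4)
        by (metis M.M.add.inv_solve_right' M.M.minus_eq regular_simps(1,3) add.m_closed)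
      then have "c \<in> V" using M.submodule_minus[OF V'(1) ab(2) cd(3)] by simp
      moreover have "r = (a \<oplus> d) \<oplus> c" using ab cd car by (simp add: a_ac)
      ultimately show "r \<in> W <+>\<^bsub>reg\<^esub> (V \<inter> L)"
        unfolding M.mem_set_add using ab cd w by auto
    qed
    moreover have "W <+>\<^bsub>reg\<^esub> (V \<inter> L) \<subseteq> carrier R"
      using M.submodule_set_add[OF W sVL] by (simp add: M.submodule_iff)
    ultimately have "V \<inter> L \<in> ?S" using sVL by blast
    then show False using min[of "V \<inter> L"] x \<open>x \<notin> L\<close> by blast
  qed
  then have "W \<inter> V \<subseteq> J" using V'(1) by (auto simp: jacobson_radical_def M.submodule_iff)
  then show ?thesis using that V' by blast
qed

text \<open>\<open>V\<close> is maximal among the submodules that contain J M but not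
  \<open>x\<close>. For \<open>y\<close> outside U = V + R x, a supplement \<open>B\<close> of the
  left ideal (U : y) makes V + B y larger than \<open>V\<close>, so it contains x = v + b y. Then b
  y lies in \<open>U\<close>, so \<open>b\<close> lies in (U : y) \<inter> B and hence in
  \<open>J\<close>; thus b y lies in J M and \<open>x\<close> in \<open>V\<close>, a
  contradiction.\<close>

lemma ex_supplement:
  assumes M: "left_module R M" "flen M" and x: "x \<in> carrier M" "x \<notin> jmul M (carrier M)"
  obtains V where "submodule V R M" "x \<notin> V" "\<And>y. y \<in> carrier M \<Longrightarrow> \<exists>v\<in>V. \<exists>a\<in>carrier R. y = v \<oplus>\<^bsub>M\<^esub> a \<odot>\<^bsub>M\<^esub> x"
proof -
  interpret M: left_module R M by fact
  interpret L: left_module R "reg" by (rule reg_module)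
  let ?S = "{V. submodule V R M \<and> jmul M (carrier M) \<subseteq> V \<and> x \<notin> V}"
  have "jmul M (carrier M) \<in> ?S" using jmul_submodule[OF M(1), of "carrier M"] x by auto
  then obtain V where V: "V \<in> ?S" and max: "\<And>V'. V' \<in> ?S \<Longrightarrow> V \<subseteq> V' \<Longrightarrow> V' = V"
    using ex_maximal[OF M, of ?S] by blast
  have sV: "submodule V R M" "jmul M (carrier M) \<subseteq> V" "x \<notin> V" using V by auto
  define U where "U = V <+>\<^bsub>M\<^esub> (\<lambda>a. a \<odot>\<^bsub>M\<^esub> x) ` carrier R"
  have sU: "submodule U R M" unfolding U_def
    using M.submodule_set_add[OF sV(1) M.submodule_span1[OF x(1)]] L.submodule_self by simp
  have VU: "V \<subseteq> U" unfolding U_def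
    using M.set_add_upper1[OF sV(1) M.submodule_span1[OF x(1)]] L.submodule_self by simp
  have "y \<in> U" if y: "y \<in> carrier M" for y
  proof (rule ccontr)
    assume "y \<notin> U"
    have Ty: "lmod_map R reg M (\<lambda>a. a \<odot>\<^bsub>M\<^esub> y)" by (rule lmod_map_smult[OF M(1) y])
    obtain B where B: "submodule B R reg"
      "{a \<in> carrier R. a \<odot>\<^bsub>M\<^esub> y \<in> U} <+>\<^bsub>reg\<^esub> B = carrier R"
      "{a \<in> carrier R. a \<odot>\<^bsub>M\<^esub> y \<in> U} \<inter> B \<subseteq> J"
      using ex_left_ideal_complement submodule_vimage[OF reg_module M(1) Ty sU] by auto
    have Bc: "B \<subseteq> carrier R" using B(1) by (simp add: L.submodule_iff)
    let ?V = "V <+>\<^bsub>M\<^esub> (\<lambda>a. a \<odot>\<^bsub>M\<^esub> y) ` B"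
    have By: "submodule ((\<lambda>a. a \<odot>\<^bsub>M\<^esub> y) ` B) R M" by (rule M.submodule_span1[OF y B(1)])
    have sV': "submodule ?V R M" by (rule M.submodule_set_add[OF sV(1) By])
    have VV': "V \<subseteq> ?V" by (rule M.set_add_upper1[OF sV(1) By])
    note vv = sV(1)[unfolded M.submodule_iff] and uu = sU[unfolded M.submodule_iff]
    \<comment> \<open>Otherwise 1 = a + b, with a y in \<open>U\<close> and b y in \<open>V\<close>,
      would place \<open>y\<close> in \<open>U\<close>.\<close>
    have "?V \<noteq> V"
    proof
      assume eq: "?V = V"
      have "\<one> \<in> {a \<in> carrier R. a \<odot>\<^bsub>M\<^esub> y \<in> U} <+>\<^bsub>reg\<^esub> B" using B(2) by simp
      then obtain a b where ab: "a \<in> carrier R" "a \<odot>\<^bsub>M\<^esub> y \<in> U" "b \<in> B" "\<one> = a \<oplus> b"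
        unfolding L.mem_set_add by auto
      have "b \<odot>\<^bsub>M\<^esub> y \<in> V" using M.set_add_upper2[OF sV(1) By] ab(3) eq by blast
      then have "b \<odot>\<^bsub>M\<^esub> y \<in> U" using VU by blast
      then have "a \<odot>\<^bsub>M\<^esub> y \<oplus>\<^bsub>M\<^esub> b \<odot>\<^bsub>M\<^esub> y \<in> U" using ab(2) uu by blast
      moreover have "a \<odot>\<^bsub>M\<^esub> y \<oplus>\<^bsub>M\<^esub> b \<odot>\<^bsub>M\<^esub> y = \<one> \<odot>\<^bsub>M\<^esub> y"
        using ab Bc y by (subst ab(4), subst M.smult_l_distr) auto
      ultimately show False using \<open>y \<notin> U\<close> y by simp
    qed
    then have "x \<in> ?V" using max[of ?V] sV' VV' sV(2) by blast
    then obtain v b where vb: "v \<in> V" "b \<in> B" "x = v \<oplus>\<^bsub>M\<^esub> b \<odot>\<^bsub>M\<^esub> y" unfolding M.mem_set_add by blast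
    have car: "v \<in> carrier M" "b \<in> carrier R" "b \<odot>\<^bsub>M\<^esub> y \<in> carrier M" using vb vv Bc y by auto
    have "x \<in> U" unfolding U_def
      using M.set_add_upper2[OF sV(1) M.submodule_span1[OF x(1) L.submodule_self]] x(1)
      by (force simp: image_iff)
    then have "x \<ominus>\<^bsub>M\<^esub> v \<in> U" using M.submodule_minus[OF sU] vb(1) VU by blast
    moreover have "x \<ominus>\<^bsub>M\<^esub> v = b \<odot>\<^bsub>M\<^esub> y" using car vb(3) x(1)
      by (metis M.M.a_comm M.M.add.inv_solve_right' M.M.minus_eq)
    ultimately have "b \<in> J" using B(3) vb(2) car(2) by auto
    then have "b \<odot>\<^bsub>M\<^esub> y \<in> V" using jmul_mem[of b y "carrier M" M] y sV(2) by blast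
    then have "x \<in> V" using vb vv by blast
    then show False using sV(3) by blast
  qed
  then have "\<exists>v\<in>V. \<exists>a\<in>carrier R. y = v \<oplus>\<^bsub>M\<^esub> a \<odot>\<^bsub>M\<^esub> x" if "y \<in> carrier M" for y
    using that unfolding U_def M.mem_set_add by blast
  then show ?thesis using that sV by blast
qed

end

section \<open>Projective covers and minimal resolutions\<close>

lemma (in ring) ex_free_image:
  assumes M: "left_module R M" and y: "\<And>k. k < n \<Longrightarrow> y k \<in> carrier M"
  obtains f where "lmod_map R (free n) M f" "\<And>k. k < n \<Longrightarrow> y k \<in> f ` carrier (free n)"
    "\<And>U. submodule U R M \<Longrightarrow> (\<And>k. k < n \<Longrightarrow> y k \<in> U) \<Longrightarrow> f ` carrier (free n) \<subseteq> U"
proof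
  interpret M: left_module R M by fact
  show "lmod_map R (free n) M (\<lambda>u. lmod_comb M u y n)" by (rule lmod_comb_map[OF M y])
  show "y k \<in> (\<lambda>u. lmod_comb M u y n) ` carrier (free n)" if "k < n" for k
    by (rule image_eqI[OF _ free_unit_closed[of n k]]) (rule lmod_comb_unit[OF M y that, symmetric])
  show "(\<lambda>u. lmod_comb M u y n) ` carrier (free n) \<subseteq> U"
    if "submodule U R M" "\<And>k. k < n \<Longrightarrow> y k \<in> U" for U
  proof (rule image_subsetI)
    fix u assume "u \<in> carrier (free n)"
    then show "lmod_comb M u y n \<in> U" by (intro M.lmod_comb_closed[OF that(1)] that(2) free_carrier)
  qed
qed

lemma (in ring) fg_free_image:
  assumes M: "left_module R M" and "lmod_fg R M"
  obtains n f where "lmod_map R (free n) M f" "f ` carrier (free n) = carrier M"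
proof -
  obtain B where B: "finite B" "B \<subseteq> carrier M" "\<And>N. submodule N R M \<Longrightarrow> B \<subseteq> N \<Longrightarrow> N = carrier M"
    using assms(2) unfolding lmod_fg_def lmod_generates_def by blast
  obtain y :: "nat \<Rightarrow> _" and n where y: "B = y ` {i. i < n}"
    using finite_imp_nat_seg_image_inj_on[OF B(1)] by blast
  have "\<And>k. k < n \<Longrightarrow> y k \<in> carrier M" using y B(2) by blast
  then obtain f where f: "lmod_map R (free n) M f" "\<And>k. k < n \<Longrightarrow> y k \<in> f ` carrier (free n)"
    using ex_free_image[OF M] by metis
  interpret F: left_module R "free n" by (rule free_module)
  have "f ` carrier (free n) = carrier M"
    by (rule B(3)[OF submodule_image[OF free_module M f(1) F.submodule_self]]) (use y f(2) in blast)
  then show ?thesis using that f(1) by blast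
qed

context artin_algebra
begin

text \<open>The noetherian property in the form that resolutions require. Finite length provides a
  maximal image of a finite free module inside \<open>U\<close>, and adjoining any element of
  \<open>U\<close> as one more generator cannot enlarge it.\<close>

lemma submodule_free_image:
  assumes M: "left_module R M" "flen M" and U: "submodule U R M"
  obtains n f where "lmod_map R (free n) M f" "f ` carrier (free n) = U"
proof -
  interpret M: left_module R M by fact
  let ?S = "{V. V \<subseteq> U \<and> (\<exists>n f. lmod_map R (free n) M f \<and> f ` carrier (free n) = V)}"
  have sub: "submodule V R M" if "V \<in> ?S" for V
    using that submodule_range[OF free_module M(1) _] by auto
  have "(\<lambda>_. \<zero>\<^bsub>M\<^esub>) ` carrier (free 0) \<in> ?S"
    using U lmod_map_null[OF M(1), of "free 0"]
    by (intro CollectI conjI exI[of _ "\<lambda>_. \<zero>\<^bsub>M\<^esub>"] exI[of _ 0] refl) (auto simp: M.submodule_iff)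
  then have "?S \<noteq> {}" by blast
  from ex_maximal[OF M this sub] obtain V where V: "V \<in> ?S" and max: "\<And>V'. V' \<in> ?S \<Longrightarrow> V \<subseteq> V' \<Longrightarrow> V' = V"
    by blast
  obtain n f where f: "lmod_map R (free n) M f" "f ` carrier (free n) = V" "V \<subseteq> U" using V by blast
  have "u \<in> V" if u: "u \<in> U" for u
  proof -
    \<comment> \<open>The old generators occupy the positions below n, the new one the position
      n.\<close>
    define y where "y k = (if k < n then f (free_unit n k) else u)" for k
    have uM: "u \<in> carrier M" using u U by (auto simp: M.submodule_iff)
    have yM: "y k \<in> carrier M" for k
      using uM lmod_mapD(1)[OF f(1) free_unit_closed] by (simp add: y_def)
    obtain f' where f': "lmod_map R (free (Suc n)) M f'"
      "\<And>k. k < Suc n \<Longrightarrow> y k \<in> f' ` carrier (free (Suc n))"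
      "\<And>U. submodule U R M \<Longrightarrow> (\<And>k. k < Suc n \<Longrightarrow> y k \<in> U) \<Longrightarrow> f' ` carrier (free (Suc n)) \<subseteq> U"
    proof (rule ex_free_image[where n = "Suc n" and y = y, OF M(1) yM])
      fix f
      assume "lmod_map R (free (Suc n)) M f"
        "\<And>k. k < Suc n \<Longrightarrow> y k \<in> f ` carrier (free (Suc n))"
        "\<And>U. submodule U R M \<Longrightarrow> (\<And>k. k < Suc n \<Longrightarrow> y k \<in> U) \<Longrightarrow> f ` carrier (free (Suc n)) \<subseteq> U"
      then show thesis by (rule that)
    qed
    let ?V = "f' ` carrier (free (Suc n))"
    have sV: "submodule ?V R M"
      by (rule submodule_range[OF free_module M(1) f'(1)])
    have yU: "y k \<in> U" for k
    proof (cases "k < n")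
      case True
      have "f (free_unit n k) \<in> V" unfolding f(2)[symmetric] by (rule imageI[OF free_unit_closed])
      then show ?thesis using f(3) True by (auto simp: y_def)
    qed (use u in \<open>simp add: y_def\<close>)
    have "?V \<subseteq> U" by (rule f'(3)[OF U yU])
    then have "?V \<in> ?S" using f'(1) by (intro CollectI conjI exI[of _ f'] exI[of _ "Suc n"] refl) auto
    moreover have "V \<subseteq> ?V"
    proof -
      have "{x \<in> carrier (free n). f x \<in> ?V} = carrier (free n)"
      proof (rule free_generated[OF submodule_vimage[OF free_module M(1) f(1) sV]])
        fix k assume "k < n"
        then show "free_unit n k \<in> {x \<in> carrier (free n). f x \<in> ?V}"
          using f'(2)[of k] free_unit_closed by (simp add: y_def)
      qed
      then show ?thesis using f(2) by blast
    qed
    ultimately have "?V = V" by (rule max)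
    then show "u \<in> V" using f'(2)[of n] by (simp add: y_def)
  qed
  then have "V = U" using f(3) by blast
  then show ?thesis using that f by blast
qed

text \<open>The cover is cut out of the free module. Among the endomorphisms \<open>g\<close> with f
  o g = f, one whose image \<open>C\<close> has least length is taken. As g o g qualifies too,
  \<open>g\<close> maps \<open>C\<close> onto \<open>C\<close>, hence bijectively by length, so
  \<open>C\<close> is a direct summand. A kernel element outside J C would let \<open>f\<close> be
  lifted through a proper submodule of \<open>C\<close>, giving a shorter image.\<close>

lemma ex_projective_cover:
  assumes M: "left_module R M" and f: "lmod_map R (free n) M f"
  obtains P :: "('a, nat \<Rightarrow> 'a) module" and p where "free_retract R P" "flen P" "lmod_map R P M p"
    "p ` carrier P = f ` carrier (free n)" "lmod_ker P M p \<subseteq> jmul P (carrier P)"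
proof -
  let ?F = "free n"
  interpret M: left_module R M by fact
  interpret F: left_module R ?F by (rule free_module)
  interpret F': left_module RZ ?F by (rule scalars_left_module[OF free_module])
  let ?l = "mlength RZ ?F {\<zero>\<^bsub>?F\<^esub>}"
  let ?G = "\<lambda>g. lmod_map R ?F ?F g \<and> (\<forall>x\<in>carrier ?F. f (g x) = f x)"
  have "?G (\<lambda>x. x)" using lmod_map_id by blast
  from ex_has_least_nat[of ?G, OF this, of "\<lambda>g. ?l (g ` carrier ?F)"]
  obtain g where g: "lmod_map R ?F ?F g" "\<And>x. x \<in> carrier ?F \<Longrightarrow> f (g x) = f x"
    and min: "\<And>h. ?G h \<Longrightarrow> ?l (g ` carrier ?F) \<le> ?l (h ` carrier ?F)" by blast
  define C where "C = g ` carrier ?F"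
  have C: "submodule C R ?F" unfolding C_def by (rule submodule_image[OF free_module free_module g(1) F.submodule_self])
  have C': "submodule C RZ ?F" by (rule scalars_submodule[OF free_module C])
  have Csub: "C \<subseteq> carrier ?F" "\<zero>\<^bsub>?F\<^esub> \<in> C" using C by (auto simp: F.submodule_iff)
  have fC: "finite_length RZ ?F {\<zero>\<^bsub>?F\<^esub>} C" by (rule flen_sub(2)[OF free_module flen_free C])
  have nlt: "h ` carrier ?F = C" if h: "?G h" "h ` carrier ?F \<subseteq> C" for h
  proof (rule ccontr)
    assume ne: "\<not> ?thesis"
    have sh: "submodule (h ` carrier ?F) R ?F"
      using submodule_image[OF free_module free_module _ F.submodule_self] h by blast
    then have "{\<zero>\<^bsub>?F\<^esub>} \<subseteq> h ` carrier ?F" by (auto simp: F.submodule_iff)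
    from mlength_strict[OF fC F'.submodule_zero scalars_submodule[OF free_module sh] C' this] ne h(2)
    have "?l (h ` carrier ?F) < ?l C" by blast
    then show False using min[OF h(1)] by (simp add: C_def)
  qed
  have gg: "lmod_map R ?F ?F (\<lambda>x. g (g x))" by (rule lmod_map_comp[OF g(1) g(1)])
  have "g ` C = (\<lambda>x. g (g x)) ` carrier ?F" by (auto simp: C_def)
  also have "\<dots> = C" using gg g lmod_mapD(1)[OF g(1)] by (intro nlt) (auto simp: C_def)
  finally have gC: "g ` C = C" .
  \<comment> \<open>\<open>K\<close> is the kernel of \<open>g\<close> on \<open>C\<close>. Since
    \<open>g\<close> maps \<open>C\<close> onto itself, C / K has the length of \<open>C\<close>,
    which leaves length zero for \<open>K\<close>.\<close>
  define K where "K = {v \<in> C. g v \<in> {\<zero>\<^bsub>?F\<^esub>}}"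
  have sK: "submodule K RZ ?F"
  proof -
    have "K = C \<inter> {v \<in> carrier ?F. g v \<in> {\<zero>\<^bsub>?F\<^esub>}}" using Csub by (auto simp: K_def)
    then show ?thesis
      using F.submodule_inter[OF C submodule_vimage[OF free_module free_module g(1) F.submodule_zero]]
      by (simp add: scalars_submodule[OF free_module])
  qed
  have K0: "{\<zero>\<^bsub>?F\<^esub>} \<subseteq> K" "K \<subseteq> C" using sK by (auto simp: F'.submodule_iff K_def)
  have fK: "finite_length RZ ?F K C" "finite_length RZ ?F {\<zero>\<^bsub>?F\<^esub>} K"
    using finite_length_sub[OF fC F'.submodule_zero C' sK C'] finite_length_sub[OF fC F'.submodule_zero C' F'.submodule_zero sK] K0
    by auto
  have "C <+>\<^bsub>?F\<^esub> {\<zero>\<^bsub>?F\<^esub>} = C"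
    using F.set_add_upper1[OF C F.submodule_zero] F.set_add_least[OF C order_refl] Csub by blast
  then have "mlength RZ ?F K C = ?l C"
    using mlength_iso(1)[OF F'.left_module_axioms F'.left_module_axioms scalars_map[OF g(1)] C' F'.submodule_zero K_def refl] gC by simp
  then have "?l K = 0" using F'.mlength_add(2)[OF F'.submodule_zero sK C' fK(2,1) K0] by simp
  then have K: "K = {\<zero>\<^bsub>?F\<^esub>}"
    using mlength_strict[OF fK(2) F'.submodule_zero F'.submodule_zero sK order_refl] K0 by fastforce
  have inj: "x = y" if "x \<in> C" "y \<in> C" "g x = g y" for x y
  proof -
    have xy: "x \<in> carrier ?F" "y \<in> carrier ?F" using that Csub by auto
    have "g (x \<ominus>\<^bsub>?F\<^esub> y) = \<zero>\<^bsub>?F\<^esub>"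
      using lmod_map_minus[OF free_module free_module g(1) xy] that(3)
        F.diff_eq_zero lmod_mapD(1)[OF g(1)] xy by simp
    then have "x \<ominus>\<^bsub>?F\<^esub> y \<in> K" using F.submodule_minus[OF C that(1,2)] by (simp add: K_def)
    then show ?thesis using K F.diff_eq_zero[OF xy] by simp
  qed
  define P where "P = ?F\<lparr>carrier := C\<rparr>"
  have P: "left_module R P" unfolding P_def by (rule F.sub_left_module[OF C])
  have Pc: "carrier P = C" by (simp add: P_def)
  \<comment> \<open>An idempotent made from \<open>g\<close>: applying the inverse of
    \<open>g\<close> on \<open>C\<close> after \<open>g\<close> keeps the image \<open>C\<close> and
    becomes the identity there.\<close>
  define r where "r x = inv_into C g (g x)" for x
  have r: "r x \<in> C" "g (r x) = g x" if "x \<in> carrier ?F" for x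
  proof -
    have "g x \<in> g ` C" using gC that by (auto simp: C_def)
    then show "r x \<in> C" "g (r x) = g x" unfolding r_def by (rule inv_into_into, rule f_inv_into_f)
  qed
  note gD = lmod_mapD[OF g(1)] and CC = C[unfolded F.submodule_iff]
  have rmap: "lmod_map R ?F P r"
    unfolding lmod_map_def
  proof (intro conjI ballI)
    show "r \<in> carrier ?F \<rightarrow> carrier P" using r by (simp add: P_def)
  next
    fix x y assume xy: "x \<in> carrier ?F" "y \<in> carrier ?F"
    have rc: "r x \<in> carrier ?F" "r y \<in> carrier ?F" using r xy Csub by auto
    have "r (x \<oplus>\<^bsub>?F\<^esub> y) = r x \<oplus>\<^bsub>?F\<^esub> r y"
    proof (rule inj)
      show "r (x \<oplus>\<^bsub>?F\<^esub> y) \<in> C" using r(1) xy by simp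
      show "r x \<oplus>\<^bsub>?F\<^esub> r y \<in> C" using r(1) xy CC by blast
      have "g (r (x \<oplus>\<^bsub>?F\<^esub> y)) = g (x \<oplus>\<^bsub>?F\<^esub> y)" using r(2) xy by simp
      also have "\<dots> = g x \<oplus>\<^bsub>?F\<^esub> g y" by (rule gD(2)[OF xy])
      also have "\<dots> = g (r x) \<oplus>\<^bsub>?F\<^esub> g (r y)" by (simp only: r(2)[OF xy(1)] r(2)[OF xy(2)])
      also have "\<dots> = g (r x \<oplus>\<^bsub>?F\<^esub> r y)" by (rule gD(2)[OF rc, symmetric])
      finally show "g (r (x \<oplus>\<^bsub>?F\<^esub> y)) = g (r x \<oplus>\<^bsub>?F\<^esub> r y)" .
    qed
    then show "r (x \<oplus>\<^bsub>?F\<^esub> y) = r x \<oplus>\<^bsub>P\<^esub> r y" by (simp add: P_def)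
  next
    fix a x assume xy: "a \<in> carrier R" "x \<in> carrier ?F"
    have rc: "r x \<in> carrier ?F" using r xy Csub by auto
    have "r (a \<odot>\<^bsub>?F\<^esub> x) = a \<odot>\<^bsub>?F\<^esub> r x"
    proof (rule inj)
      show "r (a \<odot>\<^bsub>?F\<^esub> x) \<in> C" using r(1) xy by simp
      show "a \<odot>\<^bsub>?F\<^esub> r x \<in> C" using r(1) xy CC by blast
      have "g (r (a \<odot>\<^bsub>?F\<^esub> x)) = g (a \<odot>\<^bsub>?F\<^esub> x)" using r(2) xy by simp
      also have "\<dots> = a \<odot>\<^bsub>?F\<^esub> g x" by (rule gD(3)[OF xy])
      also have "\<dots> = a \<odot>\<^bsub>?F\<^esub> g (r x)" by (simp only: r(2)[OF xy(2)])
      also have "\<dots> = g (a \<odot>\<^bsub>?F\<^esub> r x)" by (rule gD(3)[OF xy(1) rc, symmetric])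
      finally show "g (r (a \<odot>\<^bsub>?F\<^esub> x)) = g (a \<odot>\<^bsub>?F\<^esub> r x)" .
    qed
    then show "r (a \<odot>\<^bsub>?F\<^esub> x) = a \<odot>\<^bsub>P\<^esub> r x" by (simp add: P_def)
  qed
  have rC: "r x = x" if "x \<in> C" for x
    by (rule inj[OF r(1)[OF subsetD[OF Csub(1) that]] that r(2)[OF subsetD[OF Csub(1) that]]])
  have "lmod_map R P ?F (\<lambda>x. x)" unfolding P_def by (intro lmod_map_dom lmod_map_id Csub)
  then have fr: "free_retract R P" unfolding free_retract_def
    using P rmap rC by (intro conjI exI[of _ n] exI[of _ "\<lambda>x. x"] exI[of _ r]) (auto simp: Pc)
  have fP: "flen P" unfolding P_def by (rule flen_sub(1)[OF free_module flen_free C])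
  have fmap: "lmod_map R P M f" unfolding P_def by (intro lmod_map_dom f Csub)
  have fim: "f ` carrier P = f ` carrier ?F"
  proof -
    have "f ` carrier P = (\<lambda>x. f (g x)) ` carrier ?F" by (simp add: Pc C_def image_image)
    also have "\<dots> = f ` carrier ?F" by (rule image_cong[OF refl g(2)])
    finally show ?thesis .
  qed
  have "x \<in> jmul P (carrier P)" if x: "x \<in> lmod_ker P M f" for x
  proof (rule ccontr)
    assume nx: "x \<notin> jmul P (carrier P)"
    have xP: "x \<in> carrier P" "f x = \<zero>\<^bsub>M\<^esub>" using x by (auto simp: lmod_ker_def)
    interpret P: left_module R P by fact
    obtain V where V: "submodule V R P" "x \<notin> V"
      "\<And>y. y \<in> carrier P \<Longrightarrow> \<exists>v\<in>V. \<exists>a\<in>carrier R. y = v \<oplus>\<^bsub>P\<^esub> a \<odot>\<^bsub>P\<^esub> x"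
      using ex_supplement[OF P fP xP(1) nx] by blast
    have VC: "V \<subseteq> C" "V \<noteq> C" using V(1,2) xP(1) Pc by (auto simp: P.submodule_iff)
    have V': "submodule V R ?F" using V(1) F.submodule_sub_iff[OF C] by (simp add: P_def)
    \<comment> \<open>Multiples of \<open>x\<close> die under \<open>f\<close>, so \<open>V\<close>
      alone already has the full image and \<open>f\<close> lifts along its restriction to
      \<open>V\<close>.\<close>
    have "f ` carrier ?F \<subseteq> f ` carrier (?F\<lparr>carrier := V\<rparr>)"
    proof -
      have "f y \<in> f ` V" if y: "y \<in> carrier P" for y
      proof -
        obtain v a where va: "v \<in> V" "a \<in> carrier R" "y = v \<oplus>\<^bsub>P\<^esub> a \<odot>\<^bsub>P\<^esub> x" using V(3)[OF y] by blast
        have vP: "v \<in> carrier P" using va VC Pc by blast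
        have "f y = f v \<oplus>\<^bsub>M\<^esub> a \<odot>\<^bsub>M\<^esub> f x"
          unfolding va(3) using lmod_mapD[OF fmap] vP va(2) xP(1) by simp
        also have "\<dots> = f v" using xP(2) va(2) lmod_mapD(1)[OF fmap vP] by simp
        finally show ?thesis using va(1) by blast
      qed
      then have "f ` carrier P \<subseteq> f ` V" by (rule image_subsetI)
      then show ?thesis using fim by simp
    qed
    then obtain h where h: "lmod_map R ?F (?F\<lparr>carrier := V\<rparr>) h" "\<And>z. z \<in> carrier ?F \<Longrightarrow> f (h z) = f z"
      using free_retract_lift[OF free_retract_free M F.sub_left_module[OF V'] f lmod_map_dom[OF f]] VC Csub by blast
    have h': "lmod_map R ?F ?F h" "h ` carrier ?F \<subseteq> V"
      using h(1) VC Csub by (subst (asm) lmod_map_cod_iff; blast)+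
    then have "h ` carrier ?F = C" using nlt[of h] h(2) VC by blast
    then show False using h'(2) VC by blast
  qed
  then show ?thesis using that fr fP fmap fim by blast
qed

section \<open>Existence of free and of minimal resolutions\<close>

text \<open>Guarantees that the choice inside \<open>lmod_Ext\<close> picks an actual
  resolution.\<close>

lemma ex_free_resolution:
  assumes M: "left_module R M" and fg: "lmod_fg R M"
  shows "\<exists>n d. free_resolution R M n d"
proof -
  \<comment> \<open>The state is a rank together with the submodule of the free module that has to
    be covered next. The clause for i = 0 below pins the start, which dependent choice alone would
    leave open.\<close>
  let ?Q = "\<lambda>(n, U). submodule U R (free n)"
  let ?S = "\<lambda>(n, U) (m, V). \<exists>d \<in> lmod_hom R (free m) (free n).
    d ` carrier (free m) = U \<and> V = lmod_ker (free m) (free n) d"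
  obtain n0 e0 where e0: "lmod_map R (free n0) M e0" "e0 ` carrier (free n0) = carrier M"
    using fg_free_image[OF M fg] by blast
  define e where "e = restrict e0 (carrier (free n0))"
  have e: "e \<in> lmod_hom R (free n0) M" "e ` carrier (free n0) = carrier M"
    using restrict_lmod_hom[OF free_module e0(1)] e0(2) by (auto simp: e_def)
  let ?U0 = "lmod_ker (free n0) M e"
  have "\<exists>f. \<forall>i. (?Q (f i) \<and> (i = 0 \<longrightarrow> f i = (n0, ?U0))) \<and> ?S (f i) (f (Suc i))"
  proof (rule dependent_nat_choice)
    have "submodule ?U0 R (free n0)"
      using e(1) by (intro submodule_ker free_module M) (simp add: lmod_hom_iff)
    then show "\<exists>x. ?Q x \<and> (0 = (0::nat) \<longrightarrow> x = (n0, ?U0))" by auto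
  next
    fix x and i :: nat
    assume "?Q x \<and> (i = 0 \<longrightarrow> x = (n0, ?U0))"
    then obtain n U where x: "x = (n, U)" and U: "submodule U R (free n)" by auto
    obtain m f where f: "lmod_map R (free m) (free n) f" "f ` carrier (free m) = U"
      using submodule_free_image[OF free_module flen_free U] by blast
    define d where "d = restrict f (carrier (free m))"
    have d: "d \<in> lmod_hom R (free m) (free n)" "d ` carrier (free m) = U"
      using restrict_lmod_hom[OF free_module f(1)] f(2) by (auto simp: d_def)
    then have "submodule (lmod_ker (free m) (free n) d) R (free m)"
      by (intro submodule_ker free_module) (simp add: lmod_hom_iff)
    then show "\<exists>y. (?Q y \<and> (Suc i = 0 \<longrightarrow> y = (n0, ?U0))) \<and> ?S x y"
      using d x by (intro exI[of _ "(m, lmod_ker (free m) (free n) d)"]) auto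
  qed
  then obtain s where s0: "\<forall>i. (?Q (s i) \<and> (i = 0 \<longrightarrow> s i = (n0, ?U0))) \<and> ?S (s i) (s (Suc i))"
    by (rule exE)
  note s = s0[rule_format, THEN conjunct2] s0[rule_format, THEN conjunct1, THEN conjunct2, rule_format, OF refl]
  define n where "n i = fst (s i)" for i
  define U where "U i = snd (s i)" for i
  have "\<exists>d \<in> lmod_hom R (free (n (Suc i))) (free (n i)).
    d ` carrier (free (n (Suc i))) = U i \<and> U (Suc i) = lmod_ker (free (n (Suc i))) (free (n i)) d" for i
    using s(1)[of i] by (simp add: n_def U_def case_prod_unfold)
  then obtain d where d: "\<And>i. d i \<in> lmod_hom R (free (n (Suc i))) (free (n i))"
    "\<And>i. d i ` carrier (free (n (Suc i))) = U i"
    "\<And>i. U (Suc i) = lmod_ker (free (n (Suc i))) (free (n i)) (d i)" by metis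
  have 0: "n 0 = n0" "U 0 = ?U0" using s(2) by (auto simp: n_def U_def)
  have "free_resolution R M n d" unfolding free_resolution_def
    using d e 0 by (auto simp: One_nat_def intro!: bexI[of _ e])
  then show ?thesis by blast
qed

end

text \<open>The resolved module is left out, since its element type differs from that of the \<open>P i\<close>.\<close>

locale minimal_resolution = artin_algebra +
  fixes P :: "nat \<Rightarrow> ('a, nat \<Rightarrow> 'a) module" and U and p
  assumes free_retract_P: "free_retract R (P i)" and flen_P: "flen (P i)"
    and U_jmul: "U i \<subseteq> jmul (P i) (carrier (P i))"
    and p_map: "lmod_map R (P (Suc i)) (P i) (p i)"
    and p_image: "p i ` carrier (P (Suc i)) = U i"
    and U_ker: "U (Suc i) = lmod_ker (P (Suc i)) (P i) (p i)"
begin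

lemma P_left_module: "left_module R (P i)"
  by (rule free_retract_left_module[OF free_retract_P])

lemma U_submodule: "submodule (U i) R (P i)"
  using submodule_range[OF P_left_module P_left_module p_map] p_image by simp

lemma U_carrier: "U i \<subseteq> carrier (P i)"
  using U_submodule[of i] P_left_module[of i] by (simp add: left_module.submodule_iff)

lemma syzygy_left_module: "left_module R (P i\<lparr>carrier := U i\<rparr>)"
  by (rule left_module.sub_left_module[OF P_left_module U_submodule])

lemma p_map_syzygy: "lmod_map R (P (Suc i)) (P i\<lparr>carrier := U i\<rparr>) (p i)"
  using p_map p_image by (simp add: lmod_map_cod_iff[OF U_carrier])

lemma p_image_syzygy: "p i ` carrier (P (Suc i)) = carrier (P i\<lparr>carrier := U i\<rparr>)"
  using p_image by simp

lemma p_ker_syzygy: "lmod_ker (P (Suc i)) (P i\<lparr>carrier := U i\<rparr>) (p i) = U (Suc i)"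
  using U_ker by (simp add: lmod_ker_def)

end

lemma (in artin_algebra) ex_minimal_resolution:
  assumes M: "left_module R M" and fg: "lmod_fg R M"
  obtains P U p q where "minimal_resolution R Z P U p"
    "lmod_map R (P 0) M q" "q ` carrier (P 0) = carrier M" "U 0 = lmod_ker (P 0) M q"
proof -
  \<comment> \<open>The state carries the invariants of a minimal resolution along: a projective of
    finite length and a syzygy inside its radical.\<close>
  let ?Q = "\<lambda>(P :: ('a, nat \<Rightarrow> 'a) module, U). free_retract R P \<and> flen P \<and> U \<subseteq> jmul P (carrier P) \<and> submodule U R P"
  let ?S = "\<lambda>(P :: ('a, nat \<Rightarrow> 'a) module, U) (P' :: ('a, nat \<Rightarrow> 'a) module, U').
    \<exists>p. lmod_map R P' P p \<and> p ` carrier P' = U \<and> U' = lmod_ker P' P p"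
  obtain n0 e0 where e0: "lmod_map R (free n0) M e0" "e0 ` carrier (free n0) = carrier M"
    using fg_free_image[OF M fg] by blast
  obtain P0 :: "('a, nat \<Rightarrow> 'a) module" and q where P0: "free_retract R P0" "flen P0" "lmod_map R P0 M q"
    "q ` carrier P0 = carrier M" "lmod_ker P0 M q \<subseteq> jmul P0 (carrier P0)"
    using ex_projective_cover[OF M e0(1)] unfolding e0(2) by metis
  let ?U0 = "lmod_ker P0 M q"
  have "\<exists>f. \<forall>i. (?Q (f i) \<and> (i = 0 \<longrightarrow> f i = (P0, ?U0))) \<and> ?S (f i) (f (Suc i))"
  proof (rule dependent_nat_choice)
    have "submodule ?U0 R P0"
      using P0 by (intro submodule_ker M) (auto intro: free_retract_left_module)
    then show "\<exists>x. ?Q x \<and> (0 = (0::nat) \<longrightarrow> x = (P0, ?U0))" using P0 by auto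
  next
    fix x and i :: nat
    assume "?Q x \<and> (i = 0 \<longrightarrow> x = (P0, ?U0))"
    then obtain P U where x: "x = (P, U)" and P: "free_retract R P" "flen P" and U: "submodule U R P" by auto
    have P': "left_module R P" by (rule free_retract_left_module[OF P(1)])
    obtain m f where f: "lmod_map R (free m) P f" "f ` carrier (free m) = U"
      using submodule_free_image[OF P' P(2) U] by blast
    obtain P1 :: "('a, nat \<Rightarrow> 'a) module" and p where P1: "free_retract R P1" "flen P1" "lmod_map R P1 P p"
      "p ` carrier P1 = U" "lmod_ker P1 P p \<subseteq> jmul P1 (carrier P1)"
      using ex_projective_cover[OF P' f(1)] unfolding f(2) by metis
    then have "submodule (lmod_ker P1 P p) R P1"
      by (intro submodule_ker P') (auto intro: free_retract_left_module)
    then show "\<exists>y. (?Q y \<and> (Suc i = 0 \<longrightarrow> y = (P0, ?U0))) \<and> ?S x y"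
      using P1 x by (intro exI[of _ "(P1, lmod_ker P1 P p)"]) auto
  qed
  then obtain s where s0: "\<forall>i. (?Q (s i) \<and> (i = 0 \<longrightarrow> s i = (P0, ?U0))) \<and> ?S (s i) (s (Suc i))"
    by (rule exE)
  note s = s0[rule_format, THEN conjunct1, THEN conjunct1] s0[rule_format, THEN conjunct2]
    s0[rule_format, THEN conjunct1, THEN conjunct2, rule_format, OF refl]
  define P where "P i = fst (s i)" for i
  define U where "U i = snd (s i)" for i
  have "\<exists>p. lmod_map R (P (Suc i)) (P i) p \<and> p ` carrier (P (Suc i)) = U i \<and> U (Suc i) = lmod_ker (P (Suc i)) (P i) p" for i
    using s(2)[of i] by (simp add: P_def U_def case_prod_unfold)
  then obtain p where p: "\<And>i. lmod_map R (P (Suc i)) (P i) (p i)" "\<And>i. p i ` carrier (P (Suc i)) = U i"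
    "\<And>i. U (Suc i) = lmod_ker (P (Suc i)) (P i) (p i)" by metis
  have Q: "free_retract R (P i)" "flen (P i)" "U i \<subseteq> jmul (P i) (carrier (P i))" for i
    using s(1)[of i] by (simp_all add: P_def U_def case_prod_unfold)
  have 0: "P 0 = P0" "U 0 = ?U0" using s(3) by (auto simp: P_def U_def)
  have "minimal_resolution R Z P U p"
    by (intro minimal_resolution.intro artin_algebra_axioms minimal_resolution_axioms.intro Q p)
  then show ?thesis using that P0 0 by auto
qed

section \<open>Vanishing of Ext along a minimal resolution\<close>

lemma dsum_left_module:
  assumes "left_module R M" "left_module R N" shows "left_module R (lmod_dsum M N)"
proof -
  interpret M: left_module R M by fact
  interpret N: left_module R N by fact
  have "abelian_group (lmod_dsum M N)"
  proof (rule abelian_groupI)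
    fix x assume "x \<in> carrier (lmod_dsum M N)"
    then show "\<exists>y\<in>carrier (lmod_dsum M N). y \<oplus>\<^bsub>lmod_dsum M N\<^esub> x = \<zero>\<^bsub>lmod_dsum M N\<^esub>"
      by (intro bexI[of _ "(\<ominus>\<^bsub>M\<^esub> fst x, \<ominus>\<^bsub>N\<^esub> snd x)"]) (auto simp: lmod_dsum_def M.M.l_neg N.M.l_neg)
  qed (auto simp: lmod_dsum_def M.M.a_ac N.M.a_ac)
  then show ?thesis
    by (intro left_module.intro M.R.ring_axioms left_module_axioms.intro)
      (auto simp: lmod_dsum_def M.smult_l_distr M.smult_r_distr M.smult_assoc
        N.smult_l_distr N.smult_r_distr N.smult_assoc)
qed

lemma extends_dsum:
  assumes "left_module R M" "left_module R N" "extends R P U (lmod_dsum M N)"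
  shows "extends R P U M" "extends R P U N"
proof -
  interpret M: left_module R M by fact
  interpret N: left_module R N by fact
  have "lmod_map R M (lmod_dsum M N) (\<lambda>x. (x, \<zero>\<^bsub>N\<^esub>))" "lmod_map R (lmod_dsum M N) M fst"
    "lmod_map R N (lmod_dsum M N) (\<lambda>x. (\<zero>\<^bsub>M\<^esub>, x))" "lmod_map R (lmod_dsum M N) N snd"
    by (auto simp: lmod_map_def lmod_dsum_def)
  then show "extends R P U M" "extends R P U N"
    by (auto intro: extends_retract[OF assms(3)])
qed

text \<open>A map \<open>f\<close> on the image of \<open>d i\<close> gives the cocycle f o d_i in
  degree i + 1. It is a coboundary g o d_i, and then \<open>g\<close> agrees with \<open>f\<close>
  on that image.\<close>

lemma trivial_ext_extends:
  assumes R: "ring R" and N: "left_module R N" and res: "free_resolution R M n d"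
    and triv: "trivial_group (ext_cohomology R n d N (Suc i))"
  shows "extends R (free_lmod R (n i)) (d i ` carrier (free_lmod R (n (Suc i)))) N"
  unfolding extends_def
proof (intro allI impI)
  interpret ring R by fact
  interpret N: left_module R N by fact
  let ?F = "\<lambda>i. free_lmod R (n i)"
  have F: "left_module R (?F i)" for i by (rule free_module)
  have dm: "lmod_map R (?F (Suc j)) (?F j) (d j)" for j
    using res by (auto simp: free_resolution_def lmod_hom_iff)
  have dd: "d i (d (Suc i) x) = \<zero>\<^bsub>?F i\<^esub>" if "x \<in> carrier (?F (Suc (Suc i)))" for x
  proof -
    have "d (Suc i) ` carrier (?F (Suc (Suc i))) = lmod_ker (?F (Suc i)) (?F i) (d i)"
      using res by (simp add: free_resolution_def)
    then show ?thesis using that by (auto simp: lmod_ker_def)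
  qed
  fix f assume f: "lmod_map R (?F i\<lparr>carrier := d i ` carrier (?F (Suc i))\<rparr>) N f"
  have d': "lmod_map R (?F (Suc i)) (?F i\<lparr>carrier := d i ` carrier (?F (Suc i))\<rparr>) (d i)"
    using dm lmod_mapD(1)[OF dm] by (subst lmod_map_cod_iff) auto
  define c where "c = restrict (\<lambda>x. f (d i x)) (carrier (?F (Suc i)))"
  have c: "c \<in> lmod_hom R (?F (Suc i)) N"
    unfolding c_def by (rule restrict_lmod_hom[OF F lmod_map_comp[OF d' f]])
  have sub: "submodule (d i ` carrier (?F (Suc i))) R (?F i)"
    by (rule submodule_range[OF F F dm])
  have f0: "f \<zero>\<^bsub>?F i\<^esub> = \<zero>\<^bsub>N\<^esub>"
    using lmod_map_zero[OF left_module.sub_left_module[OF F sub] N f] by simp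
  let ?G = "(ext_cochains R n N (Suc i))\<lparr>carrier :=
    kernel (ext_cochains R n N (Suc i)) (ext_cochains R n N (Suc (Suc i))) (ext_delta R n d (Suc i))\<rparr>"
  let ?H = "ext_coboundaries R n d N (Suc i)"
  have "ext_delta R n d (Suc i) c = (\<lambda>x\<in>carrier (?F (Suc (Suc i))). \<zero>\<^bsub>N\<^esub>)"
    unfolding ext_delta_def compose_def
    by (rule restrict_ext) (use dd f0 lmod_mapD(1)[OF dm] in \<open>simp add: c_def\<close>)
  then have cG: "c \<in> carrier ?G"
    using c by (simp add: kernel_def ext_cochains_def lmod_Hom_def)
  \<comment> \<open>In a trivial factor group the coboundaries are the only coset. They contain the
    zero cochain, so \<open>c\<close> lies in its own coset and is itself a coboundary.\<close>
  have tr: "carrier (?G Mod ?H) = {?H}"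
    using triv by (simp add: trivial_group_def ext_cohomology_def FactGroup_def)
  have "?H #>\<^bsub>?G\<^esub> c \<in> carrier (?G Mod ?H)"
    using cG by (auto simp: FactGroup_def RCOSETS_def)
  then have Hc: "?H #>\<^bsub>?G\<^esub> c = ?H" using tr by blast
  define c0 where "c0 = (\<lambda>x\<in>carrier (?F (Suc i)). \<zero>\<^bsub>N\<^esub>)"
  have "(\<lambda>x\<in>carrier (?F i). \<zero>\<^bsub>N\<^esub>) \<in> lmod_hom R (?F i) N"
    by (rule restrict_lmod_hom[OF F lmod_map_null[OF N]])
  moreover have "ext_delta R n d i (\<lambda>x\<in>carrier (?F i). \<zero>\<^bsub>N\<^esub>) = c0"
    unfolding ext_delta_def compose_def c0_def
    by (rule restrict_ext) (use lmod_mapD(1)[OF dm] in simp)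
  ultimately have c0H: "c0 \<in> ?H" by (auto simp: ext_cochains_def lmod_Hom_def)
  have "c0 \<otimes>\<^bsub>?G\<^esub> c = c"
    using c lmod_mapD(1)[of R "?F (Suc i)" N c]
    by (auto simp: ext_cochains_def lmod_Hom_def c0_def fun_eq_iff lmod_hom_iff extensional_def)
  then have "c \<in> ?H #>\<^bsub>?G\<^esub> c" using c0H unfolding r_coset_def by force
  then have "c \<in> ?H" using Hc by simp
  then obtain g where g: "g \<in> lmod_hom R (?F i) N" "c = ext_delta R n d i g"
    by (auto simp: ext_cochains_def lmod_Hom_def)
  have "g x = f x" if "x \<in> d i ` carrier (?F (Suc i))" for x
  proof -
    from that obtain y where y: "y \<in> carrier (?F (Suc i))" "x = d i y" by (rule imageE)
    have "c y = f x" using y by (simp add: c_def)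
    moreover have "c y = g x" using y by (simp add: g(2) ext_delta_def compose_def)
    ultimately show ?thesis by simp
  qed
  then show "\<exists>g. lmod_map R (?F i) N g \<and> (\<forall>x\<in>d i ` carrier (?F (Suc i)). g x = f x)"
    using g(1) by (auto simp: lmod_hom_iff)
qed

text \<open>The quotient of \<open>P i\<close> by \<open>U i\<close> is U_(i-1) for i > 0 and the
  resolved module for i = 0. Hence \<open>extends_syzygy\<close> is Ext^1(U_(i-1), U_b) = 0, and the
  strict b < i means b \<le> i - 1.\<close>

locale orthogonal_resolution = minimal_resolution +
  assumes extends_regular: "extends R (P i) (U i) reg"
    and extends_syzygy: "b < i \<Longrightarrow> extends R (P i) (U i) (P b\<lparr>carrier := U b\<rparr>)"

text \<open>The vanishing is known for the resolution chosen in \<open>lmod_Ext\<close>. Stable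
  retracts carry it over to the minimal resolution, and dimension shifting then replaces
  \<open>M\<close> by the syzygies in the second variable.\<close>

lemma (in artin_algebra) ex_orthogonal_resolution:
  fixes M :: "('a, 'm) module"
  assumes M: "left_module R M" and fg: "lmod_fg R M"
    and ext: "\<And>i. i > 0 \<Longrightarrow> trivial_group (lmod_Ext R i M (lmod_dsum M reg))"
  obtains P U p q where "orthogonal_resolution R Z P U p"
    "lmod_map R (P 0) M q" "q ` carrier (P 0) = carrier M" "U 0 = lmod_ker (P 0) M q"
proof -
  \<comment> \<open>The pair hidden in \<open>lmod_Ext\<close>, named so that all degrees refer to
    the same resolution.\<close>
  define nd where "nd = (SOME (n, d). free_resolution R M n d)"
  define n where "n = fst nd"
  define d where "d = snd nd"
  have nd: "nd = (n, d)" by (simp add: n_def d_def)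
  have "\<exists>x. (case x of (n, d) \<Rightarrow> free_resolution R M n d)" using ex_free_resolution[OF M fg] by auto
  from someI_ex[OF this] have res: "free_resolution R M n d"
    by (simp only: nd[unfolded nd_def] prod.case)
  have coh: "trivial_group (ext_cohomology R n d (lmod_dsum M reg) (Suc i))" for i
    using ext[of "Suc i"] by (simp add: lmod_Ext_def nd[unfolded nd_def])
  let ?F = "\<lambda>i. free (n i)"
  define N where "N i = d i ` carrier (?F (Suc i))" for i
  have ex: "extends R (?F i) (N i) M" "extends R (?F i) (N i) reg" for i
    using extends_dsum[OF M reg_module trivial_ext_extends[OF ring_axioms
        dsum_left_module[OF M reg_module] res coh]] unfolding N_def by auto
  obtain e where "e \<in> lmod_hom R (?F 0) M" "e ` carrier (?F 0) = carrier M" "N 0 = lmod_ker (?F 0) M e"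
    using res unfolding free_resolution_def N_def One_nat_def by blast
  then have e: "lmod_map R (?F 0) M e" "e ` carrier (?F 0) = carrier M" "N 0 = lmod_ker (?F 0) M e"
    by (auto simp: lmod_hom_iff)
  have dm: "lmod_map R (?F (Suc i)) (?F i) (d i)" and Nk: "N (Suc i) = lmod_ker (?F (Suc i)) (?F i) (d i)" for i
    using res by (auto simp: free_resolution_def lmod_hom_iff N_def)
  obtain P U p q where res': "minimal_resolution R Z P U p"
    and q: "lmod_map R (P 0) M q" "q ` carrier (P 0) = carrier M" "U 0 = lmod_ker (P 0) M q"
    using ex_minimal_resolution[OF M fg] by blast
  interpret minimal_resolution R Z P U p by fact
  have Fm: "left_module R (?F i)" for i by (rule free_module)
  have Ff: "free_retract R (?F i)" for i by (rule free_retract_free)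
  have sN: "submodule (N i) R (?F i)" for i
    unfolding N_def by (rule submodule_range[OF Fm Fm dm])
  have Nm: "left_module R (?F i\<lparr>carrier := N i\<rparr>)" for i by (rule left_module.sub_left_module[OF Fm sN])
  have Nc: "N i \<subseteq> carrier (?F i)" for i using sN[of i] Fm[of i] by (simp add: left_module.submodule_iff)
  have dN: "lmod_map R (?F (Suc i)) (?F i\<lparr>carrier := N i\<rparr>) (d i)" for i
    unfolding lmod_map_cod_iff[OF Nc] using dm by (simp add: N_def)
  have di: "d i ` carrier (?F (Suc i)) = carrier (?F i\<lparr>carrier := N i\<rparr>)" for i by (simp add: N_def)
  have dk: "lmod_ker (?F (Suc i)) (?F i\<lparr>carrier := N i\<rparr>) (d i) = N (Suc i)" for i
    using Nk by (simp add: lmod_ker_def)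
  \<comment> \<open>Both resolutions start from \<open>M\<close>, and being a stable summand passes
    from each pair of syzygies to the next.\<close>
  have sr: "stable_retract R (P i\<lparr>carrier := U i\<rparr>) (?F i\<lparr>carrier := N i\<rparr>)" for i
  proof (induction i)
    case 0
    show ?case
      using stable_retract_syzygy[OF stable_retract_refl[OF M] M M free_retract_P Ff q(1,2) e(1,2)] q(3) e(3) by simp
  next
    case (Suc i)
    show ?case
      using stable_retract_syzygy[OF Suc syzygy_left_module Nm free_retract_P Ff p_map_syzygy p_image_syzygy dN di] unfolding p_ker_syzygy dk .
  qed
  \<comment> \<open>Degree 0 is treated apart because the module covered there is \<open>M\<close>,
    whose element type differs from that of the syzygies.\<close>
  have exR: "extends R (P i) (U i) reg" for i
    by (cases i; insert stable_retract_extends[OF stable_retract_refl[OF M] M M free_retract_P Ff q(1,2) e(1,2) reg_module]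
      stable_retract_extends[OF sr syzygy_left_module Nm free_retract_P Ff p_map_syzygy p_image_syzygy dN di reg_module] ex(2); simp add: q(3) p_ker_syzygy dk flip: e(3))
  have exM: "extends R (P i) (U i) M" for i
    by (cases i; insert stable_retract_extends[OF stable_retract_refl[OF M] M M free_retract_P Ff q(1,2) e(1,2) M]
      stable_retract_extends[OF sr syzygy_left_module Nm free_retract_P Ff p_map_syzygy p_image_syzygy dN di M] ex(1); simp add: q(3) p_ker_syzygy dk flip: e(3))
  have exPP: "extends R (P i) (U i) (P b)" for i b
    by (rule extends_free_retract[OF P_left_module exR free_retract_P])
  \<comment> \<open>Induction along 0 -> U_b -> P_b -> U_(b-1) -> 0, with \<open>M\<close> in the
    role of U_(-1). Each shift lowers both indices by one, so b < i is preserved.\<close>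
  have exU: "extends R (P i) (U i) (P b\<lparr>carrier := U b\<rparr>)" if "b < i" for i b
    using that
  proof (induction b arbitrary: i)
    case 0
    then obtain j where i: "i = Suc j" by (cases i) auto
    have eB: "extends R (P (Suc j)) (lmod_ker (P (Suc j)) (P j) (p j)) (P 0)" using exPP[of "Suc j" 0] U_ker by simp
    have eY: "extends R (P j) (p j ` carrier (P (Suc j))) M" using exM p_image by simp
    show ?case using extends_shift[OF P_left_module free_retract_P P_left_module M p_map q(1,2) eB eY] U_ker q(3) i by simp
  next
    case (Suc b)
    then obtain j where i: "i = Suc j" "b < j" by (cases i) auto
    have eB: "extends R (P (Suc j)) (lmod_ker (P (Suc j)) (P j) (p j)) (P (Suc b))" using exPP[of "Suc j"] U_ker by simp
    have eY: "extends R (P j) (p j ` carrier (P (Suc j))) (P b\<lparr>carrier := U b\<rparr>)" using Suc.IH[OF i(2)] p_image by simp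
    show ?case using extends_shift[OF P_left_module free_retract_P P_left_module syzygy_left_module p_map p_map_syzygy p_image_syzygy eB eY] U_ker i(1) p_ker_syzygy by simp
  qed
  have "orthogonal_resolution R Z P U p"
    by (intro orthogonal_resolution.intro orthogonal_resolution_axioms.intro res' exR exU)
  then show ?thesis using that q by blast
qed

context orthogonal_resolution
begin

lemma extends_P: "extends R (P i) (U i) (P b)"
  by (rule extends_free_retract[OF P_left_module extends_regular free_retract_P])

text \<open>Downward induction from the degree where the syzygy vanishes and the zero map is a
  section. Each descent rests on Ext^1 of a syzygy into a projective being zero.\<close>

lemma split_of_zero_syzygy:
  assumes "U b = {\<zero>\<^bsub>P b\<^esub>}" and "i \<le> b"
  shows "\<exists>s. lmod_map R (P i\<lparr>carrier := U i\<rparr>) (P (Suc i)) s \<and> (\<forall>x\<in>U i. p i (s x) = x)"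
  using assms(2)
proof (induction rule: inc_induct)
  case base
  have "lmod_map R (P b\<lparr>carrier := U b\<rparr>) (P (Suc b)) (\<lambda>_. \<zero>\<^bsub>P (Suc b)\<^esub>)"
    by (rule lmod_map_null[OF P_left_module])
  then show ?case using assms(1) lmod_map_zero[OF P_left_module P_left_module p_map] by auto
next
  case (step i)
  then obtain s where s: "lmod_map R (P (Suc i)\<lparr>carrier := U (Suc i)\<rparr>) (P (Suc (Suc i))) s"
    "\<And>x. x \<in> U (Suc i) \<Longrightarrow> p (Suc i) (s x) = x" by blast
  have im: "p i ` carrier (P (Suc i)) = carrier (P i\<lparr>carrier := U i\<rparr>)"
    "p (Suc i) ` carrier (P (Suc (Suc i))) = lmod_ker (P (Suc i)) (P i\<lparr>carrier := U i\<rparr>) (p i)"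
    using p_image by (auto simp: p_ker_syzygy)
  note split = split_epi_descend[OF P_left_module syzygy_left_module P_left_module p_map_syzygy im(1) p_map im(2),
    unfolded p_ker_syzygy]
  obtain t where t: "lmod_map R (P i\<lparr>carrier := U i\<rparr>) (P (Suc i)) t"
    "\<And>x. x \<in> carrier (P i\<lparr>carrier := U i\<rparr>) \<Longrightarrow> p i (t x) = x"
    using split[OF s extends_P] by blast
  have "\<forall>x\<in>U i. p i (t x) = x" using t(2) by simp
  with t(1) show ?case by blast
qed

end

section \<open>Length of homomorphism groups\<close>

context artin_algebra
begin

text \<open>Scalars are meant to come from \<open>Z\<close>: for an \<open>a\<close> that is not
  central, the function a f need not be linear.\<close>

definition HomZ :: "('a, 'm, 'c) module_scheme \<Rightarrow> ('a, 'n, 'd) module_scheme \<Rightarrow> ('a, 'm \<Rightarrow> 'n) module"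
  where "HomZ M N =
    \<lparr>carrier = lmod_hom R M N, monoid.mult = undefined, one = undefined,
     ring.zero = (\<lambda>x\<in>carrier M. \<zero>\<^bsub>N\<^esub>),
     add = (\<lambda>f g. \<lambda>x\<in>carrier M. f x \<oplus>\<^bsub>N\<^esub> g x),
     smult = (\<lambda>a f. \<lambda>x\<in>carrier M. a \<odot>\<^bsub>N\<^esub> f x)\<rparr>"

definition homs_into :: "('a, 'm, 'c) module_scheme \<Rightarrow> ('a, 'n, 'd) module_scheme \<Rightarrow> 'n set \<Rightarrow> ('m \<Rightarrow> 'n) set"
  where "homs_into M N U = {f \<in> lmod_hom R M N. f ` carrier M \<subseteq> U}"

text \<open>For projective \<open>M\<close> and \<open>U\<close> inside \<open>V\<close> this is the
  length of Hom(M, V / U). All such lengths are taken inside the one module Hom(M, N).\<close>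

definition hom_length :: "('a, 'm, 'c) module_scheme \<Rightarrow> ('a, 'n, 'd) module_scheme \<Rightarrow> 'n set \<Rightarrow> 'n set \<Rightarrow> nat"
  where "hom_length M N U V = mlength RZ (HomZ M N) (homs_into M N U) (homs_into M N V)"

lemma HomZ_left_module:
  assumes M: "left_module R M" and N: "left_module R N" shows "left_module RZ (HomZ M N)"
proof -
  let ?H = "HomZ M N"
  interpret M: left_module R M by fact
  interpret N: left_module R N by fact
  have H: "f \<in> carrier ?H \<longleftrightarrow> f \<in> extensional (carrier M) \<and> lmod_map R M N f" for f
    by (simp add: HomZ_def lmod_hom_iff)
  have hom_eqI: "f = g" if "f \<in> carrier ?H" "g \<in> carrier ?H" "\<And>x. x \<in> carrier M \<Longrightarrow> f x = g x" for f g
    using that by (auto simp: H intro: extensionalityI)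
  have val: "x \<in> carrier M \<Longrightarrow> (f \<oplus>\<^bsub>?H\<^esub> g) x = f x \<oplus>\<^bsub>N\<^esub> g x"
    "x \<in> carrier M \<Longrightarrow> (a \<odot>\<^bsub>?H\<^esub> f) x = a \<odot>\<^bsub>N\<^esub> f x"
    "x \<in> carrier M \<Longrightarrow> \<zero>\<^bsub>?H\<^esub> x = \<zero>\<^bsub>N\<^esub>" for f g a x
    by (auto simp: HomZ_def)
  have closed: "f \<in> carrier ?H \<Longrightarrow> x \<in> carrier M \<Longrightarrow> f x \<in> carrier N" for f x
    by (auto simp: H lmod_map_def)
  have c_add: "f \<oplus>\<^bsub>?H\<^esub> g \<in> carrier ?H" if "f \<in> carrier ?H" "g \<in> carrier ?H" for f g
  proof -
    have "(\<lambda>x\<in>carrier M. f x \<oplus>\<^bsub>N\<^esub> g x) \<in> lmod_hom R M N"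
      by (rule restrict_lmod_hom[OF M lmod_map_add[OF N]]) (use that H in auto)
    then show ?thesis by (simp add: HomZ_def)
  qed
  have c_zero: "\<zero>\<^bsub>?H\<^esub> \<in> carrier ?H"
    using restrict_lmod_hom[OF M lmod_map_null[OF N]] by (simp add: HomZ_def)
  have c_smult: "z \<odot>\<^bsub>?H\<^esub> f \<in> carrier ?H" if z: "z \<in> Z" and f: "f \<in> carrier ?H" for z f
  proof -
    have f': "lmod_map R M N f" using f H by blast
    have z': "z \<in> carrier R" by (rule Z_carrier[OF z])
    \<comment> \<open>Centrality is what lets \<open>z\<close> move past the scalar
      \<open>a\<close>.\<close>
    have "z \<odot>\<^bsub>N\<^esub> f (a \<odot>\<^bsub>M\<^esub> x) = a \<odot>\<^bsub>N\<^esub> (z \<odot>\<^bsub>N\<^esub> f x)" if "a \<in> carrier R" "x \<in> carrier M" for a x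
      using lmod_mapD[OF f'] that z' central[OF z that(1)] by (simp flip: N.smult_assoc)
    then have "lmod_map R M N (\<lambda>x. z \<odot>\<^bsub>N\<^esub> f x)"
      using lmod_mapD[OF f'] z' unfolding lmod_map_def by (auto simp: N.smult_r_distr)
    from restrict_lmod_hom[OF M this] show ?thesis by (simp add: HomZ_def)
  qed
  have "abelian_group ?H"
  proof (rule abelian_groupI)
    fix f g h assume fgh: "f \<in> carrier ?H" "g \<in> carrier ?H" "h \<in> carrier ?H"
    show "f \<oplus>\<^bsub>?H\<^esub> g \<oplus>\<^bsub>?H\<^esub> h = f \<oplus>\<^bsub>?H\<^esub> (g \<oplus>\<^bsub>?H\<^esub> h)"
      by (rule hom_eqI) (use fgh c_add closed in \<open>auto simp: val N.M.a_assoc\<close>)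
  next
    fix f g assume fgh: "f \<in> carrier ?H" "g \<in> carrier ?H"
    show "f \<oplus>\<^bsub>?H\<^esub> g = g \<oplus>\<^bsub>?H\<^esub> f"
      by (rule hom_eqI) (use fgh c_add closed in \<open>auto simp: val N.M.a_comm\<close>)
    show "f \<oplus>\<^bsub>?H\<^esub> g \<in> carrier ?H" by (rule c_add[OF fgh])
  next
    fix f assume f: "f \<in> carrier ?H"
    show "\<zero>\<^bsub>?H\<^esub> \<oplus>\<^bsub>?H\<^esub> f = f"
      by (rule hom_eqI) (use f c_add c_zero closed in \<open>auto simp: val\<close>)
    have z: "lmod_map R M N (\<lambda>x. \<zero>\<^bsub>N\<^esub>)" by (rule lmod_map_null[OF N])
    have "restrict (\<lambda>x. \<zero>\<^bsub>N\<^esub> \<ominus>\<^bsub>N\<^esub> f x) (carrier M) \<in> lmod_hom R M N" (is "?g \<in> _")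
      by (rule restrict_lmod_hom[OF M lmod_map_diff[OF N z]]) (use f H in auto)
    then have "?g \<in> carrier ?H" by (simp add: HomZ_def)
    moreover have "?g \<oplus>\<^bsub>?H\<^esub> f = \<zero>\<^bsub>?H\<^esub>"
      by (rule hom_eqI) (use f c_add[OF calculation f] c_zero closed in \<open>auto simp: val N.diff_add_cancel\<close>)
    ultimately show "\<exists>g\<in>carrier ?H. g \<oplus>\<^bsub>?H\<^esub> f = \<zero>\<^bsub>?H\<^esub>" by blast
  qed (rule c_zero)
  moreover have "left_module_axioms RZ ?H"
  proof (rule left_module_axioms.intro)
    show "a \<odot>\<^bsub>?H\<^esub> f \<in> carrier ?H" if "a \<in> carrier RZ" "f \<in> carrier ?H" for a f
      using c_smult that by simp
  next
    fix a b f assume h: "a \<in> carrier RZ" "b \<in> carrier RZ" "f \<in> carrier ?H"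
    then have h': "a \<in> Z" "b \<in> Z" "a \<in> carrier R" "b \<in> carrier R" using Z_carrier by auto
    have ab: "a \<oplus> b \<in> Z" "a \<otimes> b \<in> Z" using h' subringE(6,7)[OF subring] by auto
    show "(a \<oplus>\<^bsub>RZ\<^esub> b) \<odot>\<^bsub>?H\<^esub> f = a \<odot>\<^bsub>?H\<^esub> f \<oplus>\<^bsub>?H\<^esub> b \<odot>\<^bsub>?H\<^esub> f"
      by (rule hom_eqI) (use h h' ab c_add c_smult closed in \<open>auto simp: val N.smult_l_distr\<close>)
    show "(a \<otimes>\<^bsub>RZ\<^esub> b) \<odot>\<^bsub>?H\<^esub> f = a \<odot>\<^bsub>?H\<^esub> (b \<odot>\<^bsub>?H\<^esub> f)"
      by (rule hom_eqI) (use h h' ab c_add c_smult closed in \<open>auto simp: val N.smult_assoc\<close>)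
  next
    fix a f g assume h: "a \<in> carrier RZ" "f \<in> carrier ?H" "g \<in> carrier ?H"
    then have h': "a \<in> Z" "a \<in> carrier R" using Z_carrier by auto
    show "a \<odot>\<^bsub>?H\<^esub> (f \<oplus>\<^bsub>?H\<^esub> g) = a \<odot>\<^bsub>?H\<^esub> f \<oplus>\<^bsub>?H\<^esub> a \<odot>\<^bsub>?H\<^esub> g"
      by (rule hom_eqI) (use h h' c_add c_smult closed in \<open>auto simp: val N.smult_r_distr\<close>)
  next
    fix f assume h: "f \<in> carrier ?H"
    have one: "\<one> \<in> Z" by (rule subringE(3)[OF subring])
    show "\<one>\<^bsub>RZ\<^esub> \<odot>\<^bsub>?H\<^esub> f = f"
      by (rule hom_eqI) (use h one c_smult closed in \<open>auto simp: val\<close>)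
  qed
  ultimately show ?thesis by (intro left_module.intro subring_is_ring[OF subring])
qed

lemma homs_into_mono: "U \<subseteq> V \<Longrightarrow> homs_into M N U \<subseteq> homs_into M N V"
  unfolding homs_into_def by (rule Collect_mono) (intro impI conjI; elim conjE; (assumption | rule subset_trans))

lemma homs_into_submodule:
  assumes M: "left_module R M" and N: "left_module R N" and U: "submodule U R N"
  shows "submodule (homs_into M N U) RZ (HomZ M N)"
proof -
  interpret N: left_module R N by fact
  interpret H: left_module RZ "HomZ M N" by (rule HomZ_left_module[OF M N])
  note u = U[unfolded N.submodule_iff]
  show ?thesis unfolding H.submodule_iff
  proof (intro conjI ballI)
    show "homs_into M N U \<subseteq> carrier (HomZ M N)" by (auto simp: homs_into_def HomZ_def)
    show "\<zero>\<^bsub>HomZ M N\<^esub> \<in> homs_into M N U"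
      using H.M.zero_closed u by (auto simp: homs_into_def HomZ_def image_subset_iff)
  next
    fix f g assume fg: "f \<in> homs_into M N U" "g \<in> homs_into M N U"
    then have "f \<oplus>\<^bsub>HomZ M N\<^esub> g \<in> carrier (HomZ M N)"
      by (intro H.M.a_closed) (auto simp: homs_into_def HomZ_def)
    then show "f \<oplus>\<^bsub>HomZ M N\<^esub> g \<in> homs_into M N U"
      using fg u by (auto simp: homs_into_def HomZ_def image_subset_iff)
  next
    fix a f assume af: "a \<in> carrier RZ" "f \<in> homs_into M N U"
    then have "a \<odot>\<^bsub>HomZ M N\<^esub> f \<in> carrier (HomZ M N)"
      by (intro H.smult_closed) (auto simp: homs_into_def HomZ_def)
    then show "a \<odot>\<^bsub>HomZ M N\<^esub> f \<in> homs_into M N U"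
      using af u Z_carrier by (auto simp: homs_into_def HomZ_def image_subset_iff)
  qed
qed

lemma homs_into_zero:
  assumes "left_module R M" "left_module R N" shows "homs_into M N {\<zero>\<^bsub>N\<^esub>} = {\<zero>\<^bsub>HomZ M N\<^esub>}"
proof -
  interpret H: left_module RZ "HomZ M N" by (rule HomZ_left_module[OF assms])
  have "f = \<zero>\<^bsub>HomZ M N\<^esub>" if "f \<in> homs_into M N {\<zero>\<^bsub>N\<^esub>}" for f
  proof (rule extensionalityI[of _ "carrier M"])
    show "f \<in> extensional (carrier M)" using that by (simp add: homs_into_def lmod_hom_iff)
  qed (use that in \<open>auto simp: homs_into_def HomZ_def\<close>)
  moreover have "\<zero>\<^bsub>HomZ M N\<^esub> \<in> homs_into M N {\<zero>\<^bsub>N\<^esub>}"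
    using H.M.zero_closed by (auto simp: homs_into_def HomZ_def)
  ultimately show ?thesis by blast
qed

text \<open>A homomorphism on \<open>P\<close> is determined by its values on the images of the
  basis vectors of a free module that retracts onto \<open>P\<close>, so finitely many evaluations
  into \<open>N\<close> separate homomorphisms.\<close>

lemma flen_HomZ:
  assumes P: "free_retract R P" and N: "left_module R N" "flen N" shows "flen (HomZ P N)"
proof -
  have P': "left_module R P" by (rule free_retract_left_module[OF P])
  obtain n s r where s: "lmod_map R P (free n) s" and r: "lmod_map R (free n) P r"
    and rs: "\<And>x. x \<in> carrier P \<Longrightarrow> r (s x) = x"
    using P unfolding free_retract_def by blast
  interpret N: left_module R N by fact
  show ?thesis
  proof (rule finite_length_separating[where T = "\<lambda>k f. f (r (free_unit n k))" and n = n])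
    show "left_module RZ (HomZ P N)" "left_module RZ N"
      by (intro HomZ_left_module P' N(1) scalars_left_module)+
    have "r (free_unit n k) \<in> carrier P" for k by (rule lmod_mapD(1)[OF r free_unit_closed])
    then show "lmod_map RZ (HomZ P N) N (\<lambda>f. f (r (free_unit n k)))" for k
      by (auto simp: lmod_map_def HomZ_def lmod_hom_iff Pi_iff)
  next
    fix f assume f: "f \<in> carrier (HomZ P N)" "\<And>k. k < n \<Longrightarrow> f (r (free_unit n k)) = \<zero>\<^bsub>N\<^esub>"
    have f': "lmod_map R P N f" "f \<in> extensional (carrier P)" using f(1) by (auto simp: HomZ_def lmod_hom_iff)
    have "{u \<in> carrier (free n). f (r u) \<in> {\<zero>\<^bsub>N\<^esub>}} = carrier (free n)"
      by (rule free_generated[OF submodule_vimage[OF free_module N(1) lmod_map_comp[OF r f'(1)] N.submodule_zero]])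
        (use f(2) in auto)
    then have "f (r (s x)) = \<zero>\<^bsub>N\<^esub>" if "x \<in> carrier P" for x using lmod_mapD(1)[OF s that] by blast
    then have "f x = \<zero>\<^bsub>N\<^esub>" if "x \<in> carrier P" for x using rs[OF that] that by metis
    then show "f = \<zero>\<^bsub>HomZ P N\<^esub>"
      using f'(2) by (intro extensionalityI[of _ "carrier P"]) (auto simp: HomZ_def)
  qed (rule N(2))
qed

lemma finite_length_homs_into:
  assumes P: "free_retract R P" and N: "left_module R N" "flen N"
    and U: "submodule U R N" and V: "submodule V R N"
  shows "finite_length RZ (HomZ P N) (homs_into P N U) (homs_into P N V)"
proof -
  have P': "left_module R P" by (rule free_retract_left_module[OF P])
  interpret H: left_module RZ "HomZ P N" by (rule HomZ_left_module[OF P' N(1)])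
  note s = homs_into_submodule[OF P' N(1)]
  show ?thesis
    using s[OF U] s[OF V]
    by (intro finite_length_sub[OF flen_HomZ[OF P N] H.submodule_zero H.submodule_self]) (auto simp: H.submodule_iff)
qed

lemma hom_length_add:
  assumes P: "free_retract R P" and N: "left_module R N" "flen N"
    and sub: "submodule U R N" "submodule V R N" "submodule W R N" and "U \<subseteq> V" "V \<subseteq> W"
  shows "hom_length P N U W = hom_length P N U V + hom_length P N V W"
proof -
  have P': "left_module R P" by (rule free_retract_left_module[OF P])
  interpret H: left_module RZ "HomZ P N" by (rule HomZ_left_module[OF P' N(1)])
  show ?thesis unfolding hom_length_def
    by (rule H.mlength_add(2)) (use assms finite_length_homs_into homs_into_submodule[OF P' N(1)] in
      \<open>auto simp: homs_into_def\<close>)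
qed

text \<open>If \<open>V / U \<cong> B / A\<close> via \<open>a \<mapsto> a s\<close> for left ideals \<open>A \<subseteq> B\<close>, then \<open>Hom(P, V / U) \<cong> Hom(P, B / A)\<close>.\<close>

lemma hom_length_cyclic:
  assumes P: "free_retract R P" and N: "left_module R N"
    and U: "submodule U R N" and s: "s \<in> carrier N" and B: "submodule B R reg"
    and A: "A = {a \<in> B. a \<odot>\<^bsub>N\<^esub> s \<in> U}" and V: "V = (\<lambda>a. a \<odot>\<^bsub>N\<^esub> s) ` B <+>\<^bsub>N\<^esub> U"
  shows "hom_length P N U V = hom_length P reg A B"
proof -
  have P': "left_module R P" by (rule free_retract_left_module[OF P])
  interpret N: left_module R N by fact
  interpret P: left_module R P by fact
  interpret L: left_module R "reg" by (rule reg_module)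
  interpret H: left_module RZ "HomZ P N" by (rule HomZ_left_module[OF P' N(1)])
  let ?T = "\<lambda>f. \<lambda>x\<in>carrier P. f x \<odot>\<^bsub>N\<^esub> s"
  let ?t = "\<lambda>a. a \<odot>\<^bsub>N\<^esub> s" and ?HB = "homs_into P reg B" and ?HU = "homs_into P N U"
  have Bc: "B \<subseteq> carrier R" using B by (simp add: L.submodule_iff)
  have Ts: "lmod_map R reg N ?t" by (rule lmod_map_smult[OF N s])
  have sB: "submodule (?t ` B) R N" by (rule N.submodule_span1[OF s B])
  have Tc: "?T f \<in> lmod_hom R P N" if "f \<in> lmod_hom R P reg" for f
    using restrict_lmod_hom[OF P' lmod_map_comp[OF _ Ts]] that by (simp add: lmod_hom_iff)
  have T: "lmod_map RZ (HomZ P reg) (HomZ P N) ?T"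
    unfolding lmod_map_def
  proof (intro conjI ballI)
    show "?T \<in> carrier (HomZ P reg) \<rightarrow> carrier (HomZ P N)" using Tc by (auto simp: HomZ_def)
  next
    fix f g assume "f \<in> carrier (HomZ P reg)" "g \<in> carrier (HomZ P reg)"
    then have "f x \<in> carrier R" "g x \<in> carrier R" if "x \<in> carrier P" for x
      using lmod_mapD(1)[of R P "reg"] that by (auto simp: HomZ_def lmod_hom_iff)
    then show "?T (f \<oplus>\<^bsub>HomZ P reg\<^esub> g) = ?T f \<oplus>\<^bsub>HomZ P N\<^esub> ?T g"
      using s by (auto simp: HomZ_def N.smult_l_distr intro!: restrict_ext)
  next
    fix a f assume "a \<in> carrier RZ" "f \<in> carrier (HomZ P reg)"
    then have "a \<in> carrier R" "f x \<in> carrier R" if "x \<in> carrier P" for x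
      using lmod_mapD(1)[of R P "reg" f x] that Z_carrier by (auto simp: HomZ_def lmod_hom_iff)
    then show "?T (a \<odot>\<^bsub>HomZ P reg\<^esub> f) = a \<odot>\<^bsub>HomZ P N\<^esub> ?T f"
      using s by (auto simp: HomZ_def N.smult_assoc intro!: restrict_ext)
  qed
  have ker: "homs_into P reg A = {f \<in> ?HB. ?T f \<in> ?HU}"
    using Tc by (auto simp: homs_into_def A image_subset_iff)
  have sV: "submodule V R N" unfolding V by (rule N.submodule_set_add[OF sB U])
  have "homs_into P N V = ?T ` ?HB <+>\<^bsub>HomZ P N\<^esub> ?HU"
  proof
    show "?T ` ?HB <+>\<^bsub>HomZ P N\<^esub> ?HU \<subseteq> homs_into P N V"
    proof (rule H.set_add_least[OF homs_into_submodule[OF P' N sV]])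
      have "?t ` B \<subseteq> V" unfolding V by (rule N.set_add_upper1[OF sB U])
      then show "?T ` ?HB \<subseteq> homs_into P N V"
        using Tc by (auto simp: homs_into_def image_subset_iff)
      show "?HU \<subseteq> homs_into P N V"
        using N.set_add_upper2[OF sB U] by (auto simp: homs_into_def V)
    qed
    show "homs_into P N V \<subseteq> ?T ` ?HB <+>\<^bsub>HomZ P N\<^esub> ?HU"
    proof
      fix f assume f: "f \<in> homs_into P N V"
      have fm: "lmod_map R P N f" "f \<in> extensional (carrier P)" and fV: "\<And>x. x \<in> carrier P \<Longrightarrow> f x \<in> V"
        using f by (auto simp: homs_into_def lmod_hom_iff)
      have BB: "left_module R (reg\<lparr>carrier := B\<rparr>)" by (rule L.sub_left_module[OF B])
      have TB: "lmod_map R (reg\<lparr>carrier := B\<rparr>) N ?t"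
        using Bc by (intro lmod_map_dom Ts) simp
      have ex: "\<exists>v\<in>carrier (reg\<lparr>carrier := B\<rparr>). f x \<ominus>\<^bsub>N\<^esub> v \<odot>\<^bsub>N\<^esub> s \<in> U" if x: "x \<in> carrier P" for x
      proof -
        obtain b u where bu: "b \<in> B" "u \<in> U" "f x = b \<odot>\<^bsub>N\<^esub> s \<oplus>\<^bsub>N\<^esub> u"
          using fV[OF x] unfolding V N.mem_set_add by blast
        have car: "b \<odot>\<^bsub>N\<^esub> s \<in> carrier N" "u \<in> carrier N" using bu Bc s U by (auto simp: N.submodule_iff)
        have "f x \<ominus>\<^bsub>N\<^esub> b \<odot>\<^bsub>N\<^esub> s = u" unfolding bu(3) using car
          by (metis N.M.a_comm N.M.add.inv_solve_right' N.M.add.m_closed N.M.minus_eq)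
        then show ?thesis using bu(1,2) by (intro bexI[of _ b]) simp_all
      qed
      \<comment> \<open>Projectivity of \<open>P\<close> enters here: \<open>f\<close> lifts modulo
        \<open>U\<close> to a map into \<open>B\<close>, and the remainder after composing with a ->
        a s takes values in \<open>U\<close>.\<close>
      obtain g where g: "lmod_map R P (reg\<lparr>carrier := B\<rparr>) g"
        "\<And>x. x \<in> carrier P \<Longrightarrow> f x \<ominus>\<^bsub>N\<^esub> g x \<odot>\<^bsub>N\<^esub> s \<in> U"
        using free_retract_lift_mod[OF P N BB fm(1) TB U ex] by blast
      have g': "lmod_map R P reg g" "g ` carrier P \<subseteq> B"
        using g(1) lmod_map_cod_iff[of B "reg" R P g] Bc by auto
      define g0 where "g0 = restrict g (carrier P)"
      have g0: "g0 \<in> ?HB"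
        using restrict_lmod_hom[OF P' g'(1)] g'(2) by (auto simp: homs_into_def g0_def)
      define h where "h = restrict (\<lambda>x. f x \<ominus>\<^bsub>N\<^esub> g x \<odot>\<^bsub>N\<^esub> s) (carrier P)"
      have h: "h \<in> ?HU"
        using restrict_lmod_hom[OF P' lmod_map_diff[OF N fm(1) lmod_map_comp[OF g'(1) Ts]]] g(2)
        by (auto simp: homs_into_def h_def)
      have "f = ?T g0 \<oplus>\<^bsub>HomZ P N\<^esub> h"
      proof (rule extensionalityI[OF fm(2)])
        fix x assume x: "x \<in> carrier P"
        have car: "f x \<in> carrier N" "g x \<odot>\<^bsub>N\<^esub> s \<in> carrier N"
          using lmod_mapD(1)[OF fm(1) x] lmod_mapD(1)[OF g'(1) x] s by auto
        have "(?T g0 \<oplus>\<^bsub>HomZ P N\<^esub> h) x = g x \<odot>\<^bsub>N\<^esub> s \<oplus>\<^bsub>N\<^esub> (f x \<ominus>\<^bsub>N\<^esub> g x \<odot>\<^bsub>N\<^esub> s)"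
          using x by (simp add: HomZ_def g0_def h_def)
        also have "\<dots> = (f x \<ominus>\<^bsub>N\<^esub> g x \<odot>\<^bsub>N\<^esub> s) \<oplus>\<^bsub>N\<^esub> g x \<odot>\<^bsub>N\<^esub> s"
          using car by (intro N.M.a_comm) auto
        also have "\<dots> = f x" by (rule N.diff_add_cancel[OF car])
        finally show "f x = (?T g0 \<oplus>\<^bsub>HomZ P N\<^esub> h) x" by simp
      qed (simp add: HomZ_def)
      then show "f \<in> ?T ` ?HB <+>\<^bsub>HomZ P N\<^esub> ?HU"
        unfolding H.mem_set_add using g0 h by blast
    qed
  qed
  then show ?thesis unfolding hom_length_def
    using mlength_iso(1)[OF HomZ_left_module[OF P' reg_module] HomZ_left_module[OF P' N] T
        homs_into_submodule[OF P' reg_module B] homs_into_submodule[OF P' N U] ker]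
    by simp
qed

section \<open>Composition multiplicities\<close>

definition composition_series :: "(nat \<Rightarrow> 'a set) \<Rightarrow> nat \<Rightarrow> bool"
  where "composition_series A n \<longleftrightarrow> A 0 = {\<zero>} \<and> A n = carrier R \<and>
    (\<forall>j\<le>n. submodule (A j) R reg) \<and>
    (\<forall>j<n. A j \<subseteq> A (Suc j) \<and>
      (\<forall>V. submodule V R reg \<and> A j \<subseteq> V \<and> V \<subset> A (Suc j) \<longrightarrow> V = A j))"

text \<open>A longest chain of left ideals has simple steps, since an intermediate left ideal would
  lengthen it. Lengths are bounded because left ideals are submodules over \<open>Z\<close>.\<close>

lemma ex_composition_series: obtains A n where "composition_series A n"
proof -
  interpret L: left_module R "reg" by (rule reg_module)
  have "submodule_chain RZ reg V W k" if "submodule_chain R reg V W k" for V W k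
    using submodule_chain_map[OF that, where f = "\<lambda>U. U" and S = RZ and N = "reg"]
      scalars_submodule[OF reg_module] by blast
  then have fin: "finite_length R reg {\<zero>} (carrier R)"
    using finite_length_self unfolding finite_length_def by blast
  define n where "n = mlength R reg {\<zero>} (carrier R)"
  have "submodule_chain R reg {\<zero>} (carrier R) n"
    unfolding n_def using mlength_chain[OF fin] L.submodule_zero L.submodule_self by simp
  then obtain A where A: "A 0 = {\<zero>}" "A n = carrier R" "\<And>j. j \<le> n \<Longrightarrow> submodule (A j) R reg"
    "\<And>j. j < n \<Longrightarrow> A j \<subset> A (Suc j)"
    unfolding submodule_chain_def by blast
  have cover: "V = A j" if V: "j < n" "submodule V R reg" "A j \<subseteq> V" "V \<subset> A (Suc j)" for j V
  proof (rule ccontr)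
    assume "V \<noteq> A j"
    then have AV: "A j \<subset> V" using V(3) by blast
    have 1: "submodule_chain R reg {\<zero>} (A j) j"
      unfolding submodule_chain_def by (rule exI[of _ A]) (use A V(1) in auto)
    have 2: "submodule_chain R reg (A (Suc j)) (carrier R) (n - Suc j)"
      unfolding submodule_chain_def by (rule exI[of _ "\<lambda>i. A (Suc j + i)"]) (use A V(1) in auto)
    have 3: "submodule_chain R reg (A j) V 1"
      by (rule submodule_chain_step[OF A(3) V(2) AV]) (use V(1) in simp)
    have 4: "submodule_chain R reg V (A (Suc j)) 1"
      by (rule submodule_chain_step[OF V(2) A(3) V(4)]) (use V(1) in simp)
    note submodule_chain_append[OF submodule_chain_append[OF submodule_chain_append[OF 1 3] 4] 2]
    from mlength_ge[OF fin this] show False using V(1) by (simp add: n_def)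
  qed
  have "composition_series A n" unfolding composition_series_def
  proof (intro conjI allI impI)
    show "A j \<subseteq> A (Suc j)" if "j < n" for j using A(4)[OF that] by (rule psubset_imp_subset)
    show "V = A j" if "j < n" "submodule V R reg \<and> A j \<subseteq> V \<and> V \<subset> A (Suc j)" for j V
      using that(2) by (elim conjE) (rule cover[OF that(1)])
  qed (use A(1-3) in auto)
  then show ?thesis by (rule that)
qed

text \<open>The order of quantifiers is the point: \<open>t\<close> depends on \<open>U\<close> but
  not on \<open>P\<close>, so the length of Hom(P, U) becomes a pairing of a vector given by
  \<open>P\<close> with one given by \<open>U\<close>. Induction splits off a simple top U / V,
  which is isomorphic to some factor A_(j+1) / A_j.\<close>

lemma hom_length_multiplicities:
  assumes series: "composition_series A n"
    and N: "left_module R N" "flen N" and U: "submodule U R N"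
  shows "\<exists>t :: nat \<Rightarrow> nat. \<forall>P :: ('a, 'p) module. free_retract R P \<longrightarrow>
    hom_length P N {\<zero>\<^bsub>N\<^esub>} U = (\<Sum>j<n. t j * hom_length P reg (A j) (A (Suc j)))"
  using U
proof (induction "mlength RZ N {\<zero>\<^bsub>N\<^esub>} U" arbitrary: U rule: less_induct)
  case less
  interpret N: left_module R N by fact
  interpret N': left_module RZ N by (rule scalars_left_module[OF N(1)])
  have A: "A 0 = {\<zero>}" "A n = carrier R" "\<And>j. j \<le> n \<Longrightarrow> submodule (A j) R reg"
    and AS: "\<And>j. j < n \<Longrightarrow> A j \<subseteq> A (Suc j)"
    using series by (simp_all add: composition_series_def)
  note cover = series[unfolded composition_series_def, THEN conjunct2, THEN conjunct2, THEN conjunct2,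
    rule_format, THEN conjunct2, rule_format]
  interpret L: left_module R "reg" by (rule reg_module)
  have zU: "{\<zero>\<^bsub>N\<^esub>} \<subseteq> U" using less.prems by (simp add: N.submodule_iff)
  show ?case
  proof (cases "U = {\<zero>\<^bsub>N\<^esub>}")
    case True
    have "hom_length P N {\<zero>\<^bsub>N\<^esub>} U = 0" if "free_retract R P" for P :: "('a, 'p) module"
      unfolding True hom_length_def
      by (rule mlength_self(1)[OF homs_into_submodule[OF free_retract_left_module[OF that] N(1) N.submodule_zero]])
    then show ?thesis by (intro exI[of _ "\<lambda>_. 0"]) simp
  next
    case False
    let ?S = "{V. submodule V R N \<and> V \<subset> U}"
    have "{\<zero>\<^bsub>N\<^esub>} \<in> ?S" using False zU by auto
    then have "?S \<noteq> {}" by blast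
    then obtain V where V: "V \<in> ?S" and max: "\<And>V'. V' \<in> ?S \<Longrightarrow> V \<subseteq> V' \<Longrightarrow> V' = V"
      using ex_maximal[OF N, of ?S] by blast
    have sV: "submodule V R N" "V \<subset> U" using V by auto
    have zV: "{\<zero>\<^bsub>N\<^esub>} \<subseteq> V" using sV by (simp add: N.submodule_iff)
    have "mlength RZ N {\<zero>\<^bsub>N\<^esub>} V < mlength RZ N {\<zero>\<^bsub>N\<^esub>} U"
      by (rule mlength_strict[OF flen_sub(2)[OF N less.prems] N'.submodule_zero scalars_submodule[OF N(1) sV(1)]
            scalars_submodule[OF N(1) less.prems] zV sV(2)])
    from less.hyps[OF this sV(1)] obtain t :: "nat \<Rightarrow> nat" where t: "\<And>P :: ('a, 'p) module. free_retract R P \<Longrightarrow>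
      hom_length P N {\<zero>\<^bsub>N\<^esub>} V = (\<Sum>j<n. t j * hom_length P reg (A j) (A (Suc j)))" by blast
    obtain s where s: "s \<in> U" "s \<notin> V" using sV by blast
    have sN: "s \<in> carrier N" using s less.prems by (auto simp: N.submodule_iff)
    let ?B = "\<lambda>j. (\<lambda>a. a \<odot>\<^bsub>N\<^esub> s) ` A j"
    have "\<not> ?B n \<subseteq> V" 
    proof
      assume "?B n \<subseteq> V"
      moreover have "\<one> \<odot>\<^bsub>N\<^esub> s \<in> ?B n" unfolding A(2) by (rule imageI[OF one_closed])
      ultimately show False using s(2) sN by auto
    qed
    moreover have "?B 0 \<subseteq> V" using A(1) sN zV by simp
    \<comment> \<open>The submodules A_j s climb from 0 to R s, which is not inside
      \<open>V\<close>; this \<open>j\<close> is the last index before they leave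
      \<open>V\<close>.\<close>
    ultimately obtain j where j: "j < n" "?B j \<subseteq> V" "\<not> ?B (Suc j) \<subseteq> V"
      using ex_least_nat_less[of "\<lambda>j. \<not> ?B j \<subseteq> V" n] by (metis order_refl)
    have sB: "submodule (?B (Suc j)) R N" using N.submodule_span1[OF sN A(3)] j(1) by simp
    have BU: "?B (Suc j) \<subseteq> U" using A(3)[of "Suc j"] j(1) s(1) less.prems
      by (auto simp: N.submodule_iff L.submodule_iff)
    have sW: "submodule (?B (Suc j) <+>\<^bsub>N\<^esub> V) R N" by (rule N.submodule_set_add[OF sB sV(1)])
    have U: "U = ?B (Suc j) <+>\<^bsub>N\<^esub> V"
    proof (rule ccontr)
      assume "U \<noteq> ?B (Suc j) <+>\<^bsub>N\<^esub> V"
      then have "?B (Suc j) <+>\<^bsub>N\<^esub> V \<in> ?S" using sW N.set_add_least[OF less.prems BU] sV(2) by blast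
      from max[OF this N.set_add_upper2[OF sB sV(1)]] show False
        using N.set_add_upper1[OF sB sV(1)] j(3) by blast
    qed
    \<comment> \<open>This left ideal lies between A_j and A_(j+1) and is not all of A_(j+1), so
      simplicity of the factor forces A_j. Hence U / V is isomorphic to A_(j+1) / A_j.\<close>
    have "{a \<in> A (Suc j). a \<odot>\<^bsub>N\<^esub> s \<in> V} = A j"
    proof (rule cover[OF j(1)], intro conjI)
      have "{a \<in> A (Suc j). a \<odot>\<^bsub>N\<^esub> s \<in> V} = A (Suc j) \<inter> {a \<in> carrier reg. a \<odot>\<^bsub>N\<^esub> s \<in> V}"
        using A(3)[of "Suc j"] j(1) by (auto simp: L.submodule_iff)
      then show "submodule {a \<in> A (Suc j). a \<odot>\<^bsub>N\<^esub> s \<in> V} R reg"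
        using L.submodule_inter[OF A(3)[of "Suc j"] submodule_vimage[OF reg_module N(1) lmod_map_smult[OF N(1) sN] sV(1)]] j(1)
        by simp
    qed (use j AS in auto)
    then have st: "hom_length P N V U = hom_length P reg (A j) (A (Suc j))" if "free_retract R P" for P :: "('a, 'p) module"
      using hom_length_cyclic[OF that N(1) sV(1) sN A(3)[of "Suc j"] _ U] j(1) by simp
    show ?thesis
    proof (intro exI[of _ "t(j := Suc (t j))"] allI impI)
      fix P :: "('a, 'p) module" assume P: "free_retract R P"
      let ?c = "\<lambda>j. hom_length P reg (A j) (A (Suc j))"
      have "hom_length P N {\<zero>\<^bsub>N\<^esub>} U = (\<Sum>i<n. t i * ?c i) + ?c j"
        using hom_length_add[OF P N N.submodule_zero sV(1) less.prems zV] sV(2) t[OF P] st[OF P] by auto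
      also have "\<dots> = (\<Sum>i<n. t i * ?c i + (if i = j then ?c j else 0))"
        using j(1) by (simp add: sum.distrib)
      also have "\<dots> = (\<Sum>i<n. (t(j := Suc (t j))) i * ?c i)"
        by (rule sum.cong) auto
      finally show "hom_length P N {\<zero>\<^bsub>N\<^esub>} U = (\<Sum>i<n. (t(j := Suc (t j))) i * ?c i)" .
    qed
  qed
qed

end

section \<open>Triangular pairings and radical cube zero\<close>

text \<open>Elimination of one coordinate \<open>x\<close>. With w_c(x) nonzero as pivot, the later
  w_b are cleared at \<open>x\<close> by subtracting multiples of w_c; their pairings with the later
  a_i do not change, because a_i is orthogonal to w_c for i > c. The families shifted past c are
  triangular over one coordinate fewer, and over no coordinates the diagonal would be zero.\<close>

lemma no_triangular_pairing:
  fixes a w :: "nat \<Rightarrow> 'k \<Rightarrow> real"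
  assumes "finite K" and "\<And>i b. b < i \<Longrightarrow> (\<Sum>k\<in>K. a i k * w b k) = 0" and "\<And>b. (\<Sum>k\<in>K. a b k * w b k) \<noteq> 0"
  shows False
  using assms
proof (induction K arbitrary: a w rule: finite_induct)
  case empty
  then show ?case by simp
next
  case (insert x K)
  show ?case
  proof (cases "\<forall>b. w b x = 0")
    case True
    show ?thesis using insert.prems insert.hyps True by (intro insert.IH[of a w]) auto
  next
    case False
    then obtain c where c: "w c x \<noteq> 0" by blast
    define u where "u b k = w (Suc (c + b)) k - w (Suc (c + b)) x / w c x * w c k" for b k
    have *: "(\<Sum>k\<in>K. a (Suc (c + i)) k * u b k) = (\<Sum>k\<in>insert x K. a (Suc (c + i)) k * w (Suc (c + b)) k)" for i b
    proof -
      have "(\<Sum>k\<in>K. a (Suc (c + i)) k * u b k) = (\<Sum>k\<in>insert x K. a (Suc (c + i)) k * u b k)"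
        using c insert.hyps by (simp add: u_def)
      also have "\<dots> = (\<Sum>k\<in>insert x K. a (Suc (c + i)) k * w (Suc (c + b)) k)
        - w (Suc (c + b)) x / w c x * (\<Sum>k\<in>insert x K. a (Suc (c + i)) k * w c k)"
        unfolding sum_distrib_left sum_subtractf[symmetric] u_def by (rule sum.cong) (auto simp: algebra_simps)
      also have "(\<Sum>k\<in>insert x K. a (Suc (c + i)) k * w c k) = 0" by (rule insert.prems(1)) simp
      finally show ?thesis by simp
    qed
    show ?thesis
      using insert.prems by (intro insert.IH[of "\<lambda>i. a (Suc (c + i))" u]) (simp_all only: *, auto)
  qed
qed

section \<open>Radical layers when the radical has cube zero\<close>

context ring
begin

lemma jmul_mono: "U \<subseteq> V \<Longrightarrow> jmul M U \<subseteq> jmul M V"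
  unfolding jmul_def by (rule Inter_anti_mono) blast

lemma jmul_eq_zero:
  assumes M: "left_module R M" and U: "U \<subseteq> carrier M"
    and z: "\<And>a u. a \<in> J \<Longrightarrow> u \<in> U \<Longrightarrow> a \<odot>\<^bsub>M\<^esub> u = \<zero>\<^bsub>M\<^esub>"
  shows "jmul M U = {\<zero>\<^bsub>M\<^esub>}"
proof -
  interpret M: left_module R M by fact
  have "jmul M U \<subseteq> {\<zero>\<^bsub>M\<^esub>}" by (rule jmul_least[OF M.submodule_zero]) (use z in auto)
  then show ?thesis using jmul_submodule[OF M U] by (auto simp: M.submodule_iff)
qed

text \<open>\<open>V\<close> is the part of \<open>M\<close> killed by \<open>J\<close>, and
  \<open>W\<close> the part that \<open>J\<close> sends into \<open>V\<close>. Both are submodules,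
  so checking generators suffices: J^3 = 0 puts J M into \<open>W\<close>, and hence J J M into
  \<open>V\<close>.\<close>

lemma jmul_cube_zero:
  assumes M: "left_module R M"
    and J3: "\<And>a b c. \<lbrakk>a \<in> J; b \<in> J; c \<in> J\<rbrakk> \<Longrightarrow> a \<otimes> b \<otimes> c = \<zero>"
    and U: "U \<subseteq> jmul M (jmul M (carrier M))"
  shows "jmul M U = {\<zero>\<^bsub>M\<^esub>}"
proof -
  interpret M: left_module R M by fact
  define V where "V = {y \<in> carrier M. \<forall>a\<in>J. a \<odot>\<^bsub>M\<^esub> y \<in> {\<zero>\<^bsub>M\<^esub>}}"
  define W where "W = {y \<in> carrier M. \<forall>a\<in>J. a \<odot>\<^bsub>M\<^esub> y \<in> V}"
  have V: "submodule V R M" unfolding V_def by (rule submodule_annihilated[OF M M.submodule_zero])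
  have W: "submodule W R M" unfolding W_def by (rule submodule_annihilated[OF M V])
  have "jmul M (carrier M) \<subseteq> W"
  proof (rule jmul_least[OF W])
    fix c u assume c: "c \<in> J" and u: "u \<in> carrier M"
    have "a \<odot>\<^bsub>M\<^esub> (b \<odot>\<^bsub>M\<^esub> (c \<odot>\<^bsub>M\<^esub> u)) = \<zero>\<^bsub>M\<^esub>" if "a \<in> J" "b \<in> J" for a b
    proof -
      have "a \<odot>\<^bsub>M\<^esub> (b \<odot>\<^bsub>M\<^esub> (c \<odot>\<^bsub>M\<^esub> u)) = (a \<otimes> b \<otimes> c) \<odot>\<^bsub>M\<^esub> u"
        using jacobson_carrier that c u by (simp add: M.smult_assoc)
      then show ?thesis using J3[OF that c] u by simp
    qed
    then show "c \<odot>\<^bsub>M\<^esub> u \<in> W" using jacobson_carrier c u by (simp add: W_def V_def)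
  qed
  then have "jmul M (jmul M (carrier M)) \<subseteq> V"
    by (intro jmul_least[OF V]) (auto simp: W_def)
  then show ?thesis using U by (intro jmul_eq_zero[OF M]) (auto simp: V_def)
qed

end

lemma (in artin_algebra) HomZ_precomp:
  assumes P: "left_module R P" and g: "lmod_map R P' P g" and P': "left_module R P'"
  shows "lmod_map RZ (HomZ P N) (HomZ P' N) (\<lambda>f. \<lambda>x\<in>carrier P'. f (g x))"
  unfolding lmod_map_def
proof (intro conjI ballI)
  have "restrict (\<lambda>x. f (g x)) (carrier P') \<in> lmod_hom R P' N" if "f \<in> lmod_hom R P N" for f
    by (rule restrict_lmod_hom[OF P' lmod_map_comp[OF g]]) (use that in \<open>simp add: lmod_hom_iff\<close>)
  then show "(\<lambda>f. \<lambda>x\<in>carrier P'. f (g x)) \<in> carrier (HomZ P N) \<rightarrow> carrier (HomZ P' N)"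
    by (simp add: HomZ_def)
qed (use lmod_mapD(1)[OF g] in \<open>auto simp: HomZ_def intro!: restrict_ext\<close>)

locale cube_zero_resolution = orthogonal_resolution +
  assumes J3: "\<lbrakk>a \<in> J; b \<in> J; c \<in> J\<rbrakk> \<Longrightarrow> a \<otimes> b \<otimes> c = \<zero>"
begin

abbreviation HZ :: "nat \<Rightarrow> nat \<Rightarrow> ('a, (nat \<Rightarrow> 'a) \<Rightarrow> nat \<Rightarrow> 'a) module"
  where "HZ i b \<equiv> HomZ (P i) (P b)"

abbreviation homs :: "nat \<Rightarrow> nat \<Rightarrow> (nat \<Rightarrow> 'a) set \<Rightarrow> ((nat \<Rightarrow> 'a) \<Rightarrow> nat \<Rightarrow> 'a) set"
  where "homs i b \<equiv> homs_into (P i) (P b)"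

abbreviation hlen :: "nat \<Rightarrow> nat \<Rightarrow> (nat \<Rightarrow> 'a) set \<Rightarrow> nat"
  where "hlen i b \<equiv> hom_length (P i) (P b) {\<zero>\<^bsub>P b\<^esub>}"

abbreviation JU :: "nat \<Rightarrow> (nat \<Rightarrow> 'a) set" where "JU b \<equiv> jmul (P b) (U b)"

lemma JU_submodule: "submodule (JU b) R (P b)"
  by (rule jmul_submodule[OF P_left_module U_carrier])

lemma JU_subset: "JU b \<subseteq> U b"
  by (rule jmul_subset[OF P_left_module U_submodule])

text \<open>\<open>U b\<close> lies in J P_b, so \<open>JU b\<close> lies in J J P_b, which
  \<open>J\<close> kills.\<close>

lemma JJU_zero: "jmul (P b) (JU b) = {\<zero>\<^bsub>P b\<^esub>}"
  by (rule jmul_cube_zero[OF P_left_module J3 jmul_mono[OF U_jmul]])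

text \<open>Nakayama for a nilpotent radical: J U = U would give U = J J U = 0.\<close>

lemma JU_neq: "U b \<noteq> {\<zero>\<^bsub>P b\<^esub>} \<Longrightarrow> JU b \<noteq> U b"
  using JJU_zero by metis

lemma zero_in: "\<zero>\<^bsub>P b\<^esub> \<in> U b" "\<zero>\<^bsub>P b\<^esub> \<in> JU b"
  using U_submodule[of b] JU_submodule[of b] left_module.submodule_iff[OF P_left_module] by auto

definition precomp :: "nat \<Rightarrow> ((nat \<Rightarrow> 'a) \<Rightarrow> nat \<Rightarrow> 'a) \<Rightarrow> (nat \<Rightarrow> 'a) \<Rightarrow> nat \<Rightarrow> 'a"
  where "precomp i f = (\<lambda>x\<in>carrier (P (Suc i)). f (p i x))"

lemma precomp_map: "lmod_map RZ (HomZ (P i) N) (HomZ (P (Suc i)) N) (precomp i)"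
  unfolding precomp_def by (rule HomZ_precomp[OF P_left_module p_map P_left_module])

text \<open>The kernel of precomposition on Hom(P_i, U_b), written as the preimage of a singleton to
  fit \<open>mlength_iso\<close>. By \<open>hom_ker_iff\<close> it consists of the maps that vanish
  on U_i.\<close>

definition hom_ker :: "nat \<Rightarrow> nat \<Rightarrow> ((nat \<Rightarrow> 'a) \<Rightarrow> nat \<Rightarrow> 'a) set"
  where "hom_ker i b = {f \<in> homs i b (U b). precomp i f \<in> {\<zero>\<^bsub>HZ (Suc i) b\<^esub>}}"

lemma hom_ker_iff:
  "f \<in> hom_ker i b \<longleftrightarrow> f \<in> homs i b (U b) \<and> (\<forall>x\<in>U i. f x = \<zero>\<^bsub>P b\<^esub>)"
proof -
  have "precomp i f = \<zero>\<^bsub>HZ (Suc i) b\<^esub> \<longleftrightarrow> (\<forall>x\<in>carrier (P (Suc i)). f (p i x) = \<zero>\<^bsub>P b\<^esub>)"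
    unfolding precomp_def HomZ_def by (auto simp: restrict_def fun_eq_iff dest: fun_cong split: if_splits)
  also have "\<dots> \<longleftrightarrow> (\<forall>x\<in>U i. f x = \<zero>\<^bsub>P b\<^esub>)" unfolding p_image[symmetric] by blast
  finally show ?thesis by (auto simp: hom_ker_def)
qed

text \<open>Minimality at work: U_i lies in J P_i, and a homomorphism into \<open>W\<close> carries
  J P_i into J W. Restriction to a syzygy costs one radical layer.\<close>

lemma homs_into_jmul:
  assumes "f \<in> homs i b W" "W \<subseteq> carrier (P b)" "x \<in> U i" shows "f x \<in> jmul (P b) W"
proof -
  have "lmod_map R (P i) (P b) f" "f ` carrier (P i) \<subseteq> W"
    using assms(1) by (auto simp: homs_into_def lmod_hom_iff)
  from jmul_map[OF P_left_module P_left_module this(1) order_refl assms(2) this(2)]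
  show ?thesis using U_jmul[of i] assms(3) by blast
qed

lemma homs_into_U_jmul: "f \<in> homs i b (U b) \<Longrightarrow> x \<in> U i \<Longrightarrow> f x \<in> JU b"
  by (rule homs_into_jmul[OF _ U_carrier])

lemma homs_into_JU_vanish: "f \<in> homs i b (JU b) \<Longrightarrow> x \<in> U i \<Longrightarrow> f x = \<zero>\<^bsub>P b\<^esub>"
  using homs_into_jmul[OF _ subset_trans[OF JU_subset U_carrier]] JJU_zero by blast

lemma homs_into_JU_hom_ker: "homs i b (JU b) \<subseteq> hom_ker i b"
proof
  fix f assume f: "f \<in> homs i b (JU b)"
  then have "f \<in> homs i b (U b)" unfolding homs_into_def using JU_subset[of b] by blast
  then show "f \<in> hom_ker i b" unfolding hom_ker_iff using homs_into_JU_vanish[OF f] by blast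
qed

text \<open>A map that kills U_(i+1) is a map on U_i, the quotient of P_(i+1), and Ext^1(U_(i-1),
  U_b) = 0 extends it over P_i. This is exactness at P_(i+1) of the Hom complex into U_b.\<close>

lemma factor_extend:
  assumes f: "f \<in> homs (Suc i) b (U b)" and v: "\<And>x. x \<in> U (Suc i) \<Longrightarrow> f x = \<zero>\<^bsub>P b\<^esub>" and "b < i"
  obtains e where "e \<in> homs i b (U b)" "\<And>x. x \<in> carrier (P (Suc i)) \<Longrightarrow> e (p i x) = f x"
proof -
  have fm: "lmod_map R (P (Suc i)) (P b) f" and fU: "\<And>x. x \<in> carrier (P (Suc i)) \<Longrightarrow> f x \<in> U b"
    using f by (auto simp: homs_into_def lmod_hom_iff)
  have k: "f x = \<zero>\<^bsub>P b\<^esub>" if "x \<in> carrier (P (Suc i))" "p i x = \<zero>\<^bsub>P i\<^esub>" for x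
    using v that by (simp add: U_ker lmod_ker_def)
  obtain q where q: "lmod_map R (P i\<lparr>carrier := p i ` carrier (P (Suc i))\<rparr>) (P b) q"
    "\<And>x. x \<in> carrier (P (Suc i)) \<Longrightarrow> q (p i x) = f x"
    using lmod_map_factor[OF P_left_module P_left_module P_left_module p_map fm k] by blast
  have q1: "lmod_map R (P i\<lparr>carrier := U i\<rparr>) (P b) q" using q(1) unfolding p_image .
  have "q ` (p i ` carrier (P (Suc i))) \<subseteq> U b" using q(2) fU by auto
  then have "q ` U i \<subseteq> U b" unfolding p_image .
  then have "lmod_map R (P i\<lparr>carrier := U i\<rparr>) (P b\<lparr>carrier := U b\<rparr>) q"
    unfolding lmod_map_cod_iff[OF U_carrier] using q1 by simp
  then obtain e where e: "lmod_map R (P i) (P b\<lparr>carrier := U b\<rparr>) e" "\<And>x. x \<in> U i \<Longrightarrow> e x = q x"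
    using extends_syzygy[OF \<open>b < i\<close>, unfolded extends_def, rule_format] by blast
  then have e': "lmod_map R (P i) (P b) e" "e ` carrier (P i) \<subseteq> U b" by (simp_all add: lmod_map_cod_iff[OF U_carrier])
  have "restrict e (carrier (P i)) \<in> homs i b (U b)"
    using restrict_lmod_hom[OF P_left_module e'(1)] e'(2) by (auto simp: homs_into_def)
  moreover have "restrict e (carrier (P i)) (p i x) = f x" if x: "x \<in> carrier (P (Suc i))" for x
    using e(2)[of "p i x"] p_image[of i] q(2)[OF x] x lmod_mapD(1)[OF p_map x] by auto
  ultimately show ?thesis using that by blast
qed

text \<open>Values fall into J U_b because p_i lands in J P_i. Conversely, a map into J U_b kills
  U_(i+1), so \<open>factor_extend\<close> writes it as e o p_i with \<open>e\<close> into
  U_b.\<close>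

lemma precomp_image:
  assumes "b < i"
  shows "precomp i ` homs i b (U b) = homs (Suc i) b (JU b)"
proof
  show "precomp i ` homs i b (U b) \<subseteq> homs (Suc i) b (JU b)"
  proof (rule image_subsetI)
    fix f assume f: "f \<in> homs i b (U b)"
    have "precomp i f \<in> lmod_hom R (P (Suc i)) (P b)"
      using lmod_mapD(1)[OF precomp_map, of f i "P b"] f by (auto simp: homs_into_def HomZ_def)
    moreover have "f (p i x) \<in> JU b" if "x \<in> carrier (P (Suc i))" for x
      using homs_into_U_jmul[OF f] p_image that by blast
    ultimately show "precomp i f \<in> homs (Suc i) b (JU b)"
      by (auto simp: homs_into_def precomp_def)
  qed
  show "homs (Suc i) b (JU b) \<subseteq> precomp i ` homs i b (U b)"
  proof
    fix g assume g: "g \<in> homs (Suc i) b (JU b)"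
    then have gU: "g \<in> homs (Suc i) b (U b)" using JU_subset by (auto simp: homs_into_def)
    obtain e where e: "e \<in> homs i b (U b)" "\<And>x. x \<in> carrier (P (Suc i)) \<Longrightarrow> e (p i x) = g x"
      using factor_extend[OF gU homs_into_JU_vanish[OF g] assms] by blast
    have "g = precomp i e"
    proof (rule extensionalityI[of _ "carrier (P (Suc i))"])
      show "g \<in> extensional (carrier (P (Suc i)))" using g by (simp add: homs_into_def lmod_hom_iff)
    qed (use e(2) in \<open>auto simp: precomp_def\<close>)
    then show "g \<in> precomp i ` homs i b (U b)" using e(1) by blast
  qed
qed

lemma hom_ker_submodule: "submodule (hom_ker i b) RZ (HZ i b)"
proof -
  interpret H: left_module RZ "HZ i b" by (rule HomZ_left_module[OF P_left_module P_left_module])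
  interpret H': left_module RZ "HZ (Suc i) b" by (rule HomZ_left_module[OF P_left_module P_left_module])
  have "hom_ker i b = homs i b (U b) \<inter>
    {f \<in> carrier (HZ i b). precomp i f \<in> {\<zero>\<^bsub>HZ (Suc i) b\<^esub>}}"
    by (auto simp: hom_ker_def) (auto simp: homs_into_def HomZ_def)
  then show ?thesis
    using H.submodule_inter[OF homs_into_submodule[OF P_left_module P_left_module U_submodule]
        submodule_vimage[OF H.left_module_axioms H'.left_module_axioms precomp_map H'.submodule_zero]]
    by simp
qed

text \<open>Rank and nullity of precomposition, whose image is known from
  \<open>precomp_image\<close>.\<close>

lemma hom_length_hom_ker:
  assumes "b < i"
  shows "hlen i b (U b) =
    mlength RZ (HZ i b) (homs i b {\<zero>\<^bsub>P b\<^esub>}) (hom_ker i b) +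
    hlen (Suc i) b (JU b)"
proof -
  interpret H: left_module RZ "HZ i b" by (rule HomZ_left_module[OF P_left_module P_left_module])
  interpret H': left_module RZ "HZ (Suc i) b" by (rule HomZ_left_module[OF P_left_module P_left_module])
  interpret Pb: left_module R "P b" by (rule P_left_module)
  note sub = homs_into_submodule[OF P_left_module P_left_module]
  note fl = finite_length_homs_into[OF free_retract_P P_left_module flen_P]
  have z: "homs j b {\<zero>\<^bsub>P b\<^esub>} = {\<zero>\<^bsub>HZ j b\<^esub>}" for j
    by (rule homs_into_zero[OF P_left_module P_left_module])
  have im: "precomp i ` homs i b (U b) <+>\<^bsub>HZ (Suc i) b\<^esub> {\<zero>\<^bsub>HZ (Suc i) b\<^esub>} =
    homs (Suc i) b (JU b)" (is "?V <+>\<^bsub>_\<^esub> _ = _")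
  proof -
    have V: "submodule ?V RZ (HZ (Suc i) b)"
      unfolding precomp_image[OF assms] by (rule sub[OF JU_submodule])
    then have "{\<zero>\<^bsub>HZ (Suc i) b\<^esub>} \<subseteq> ?V" by (simp add: H'.submodule_iff)
    then have "?V <+>\<^bsub>HZ (Suc i) b\<^esub> {\<zero>\<^bsub>HZ (Suc i) b\<^esub>} = ?V"
      by (intro equalityI H'.set_add_upper1[OF V H'.submodule_zero] H'.set_add_least[OF V order_refl])
    then show ?thesis using precomp_image[OF assms] by simp
  qed
  have 1: "mlength RZ (HZ i b) (hom_ker i b) (homs i b (U b)) =
    hlen (Suc i) b (JU b)"
    unfolding hom_length_def z
    by (rule mlength_iso(1)[OF H.left_module_axioms H'.left_module_axioms precomp_map sub[OF U_submodule] H'.submodule_zero])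
      (simp_all add: hom_ker_def im)
  have KU: "hom_ker i b \<subseteq> homs i b (U b)" by (auto simp: hom_ker_def)
  have zK: "homs i b {\<zero>\<^bsub>P b\<^esub>} \<subseteq> hom_ker i b"
    using hom_ker_submodule[of i b] unfolding z by (simp add: H.submodule_iff)
  have "hlen i b (U b) =
    mlength RZ (HZ i b) (homs i b {\<zero>\<^bsub>P b\<^esub>}) (hom_ker i b) +
    mlength RZ (HZ i b) (hom_ker i b) (homs i b (U b))"
    unfolding hom_length_def
    by (rule H.mlength_add(2)[OF sub[OF Pb.submodule_zero] hom_ker_submodule sub[OF U_submodule] _ _ zK KU])
      (rule finite_length_sub[OF fl[OF Pb.submodule_zero U_submodule] sub[OF Pb.submodule_zero] sub[OF U_submodule]];
        fact sub[OF Pb.submodule_zero] sub[OF U_submodule] hom_ker_submodule zK KU order_refl)+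
  then show ?thesis using 1 by simp
qed

text \<open>The kernel in degree i + 1 is exactly Hom(P_(i+1), J U_b): a kernel element is e o p_i
  by \<open>factor_extend\<close>, and p_i lands in J P_i. Surjectivity in degree i + 1 would allow
  b = i; this description of the kernel is what asks for b < i.\<close>

lemma hom_length_eq:
  assumes "b < i"
  shows "hlen (Suc i) b (U b) =
    hlen (Suc i) b (JU b) + hlen (Suc (Suc i)) b (JU b)"
proof -
  have "hom_ker (Suc i) b \<subseteq> homs (Suc i) b (JU b)"
  proof
    fix f assume "f \<in> hom_ker (Suc i) b"
    then have f: "f \<in> homs (Suc i) b (U b)" "\<And>x. x \<in> U (Suc i) \<Longrightarrow> f x = \<zero>\<^bsub>P b\<^esub>"
      by (auto simp: hom_ker_iff)
    obtain e where e: "e \<in> homs i b (U b)" "\<And>x. x \<in> carrier (P (Suc i)) \<Longrightarrow> e (p i x) = f x"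
      using factor_extend[OF f assms] by blast
    have "f x \<in> JU b" if x: "x \<in> carrier (P (Suc i))" for x
    proof -
      have "e (p i x) \<in> JU b" by (rule homs_into_U_jmul[OF e(1)]) (use p_image x in blast)
      then show ?thesis using e(2)[OF x] by simp
    qed
    then show "f \<in> homs (Suc i) b (JU b)" using f(1) by (auto simp: homs_into_def)
  qed
  then have "hom_ker (Suc i) b = homs (Suc i) b (JU b)" using homs_into_JU_hom_ker by blast
  then show ?thesis using hom_length_hom_ker[of b "Suc i"] assms by (simp add: hom_length_def)
qed

text \<open>At i = b surjectivity persists but injectivity fails. The differential p_b, as a map
  onto U_b, is killed by p_(b+1), and its image U_b is not contained in J U_b, so the kernel is
  strictly larger than Hom(P_(b+1), J U_b).\<close>

lemma hom_length_less:
  assumes "U b \<noteq> {\<zero>\<^bsub>P b\<^esub>}"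
  shows "hlen (Suc b) b (JU b) + hlen (Suc (Suc b)) b (JU b)
    < hlen (Suc b) b (U b)"
proof -
  interpret Pb: left_module R "P b" by (rule P_left_module)
  note sub = homs_into_submodule[OF P_left_module P_left_module]
  define f where "f = restrict (p b) (carrier (P (Suc b)))"
  have fh: "f \<in> lmod_hom R (P (Suc b)) (P b)" unfolding f_def by (rule restrict_lmod_hom[OF P_left_module p_map])
  have fim: "f ` carrier (P (Suc b)) = U b" unfolding f_def image_restrict_eq by (rule p_image)
  have "f \<in> homs (Suc b) b (U b)" unfolding homs_into_def using fh fim by blast
  moreover have "f x = \<zero>\<^bsub>P b\<^esub>" if "x \<in> U (Suc b)" for x
  proof -
    have "x \<in> carrier (P (Suc b))" "p b x = \<zero>\<^bsub>P b\<^esub>" using that unfolding U_ker lmod_ker_def by blast+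
    then show ?thesis by (simp add: f_def)
  qed
  ultimately have "f \<in> hom_ker (Suc b) b" unfolding hom_ker_iff by blast
  moreover have "f \<notin> homs (Suc b) b (JU b)"
  proof
    assume "f \<in> homs (Suc b) b (JU b)"
    then have "U b \<subseteq> JU b" unfolding homs_into_def fim[symmetric] by blast
    then show False using JU_neq[OF assms] JU_subset[of b] by blast
  qed
  ultimately have st: "homs (Suc b) b (JU b) \<subset> hom_ker (Suc b) b"
    using homs_into_JU_hom_ker by blast
  have zJ: "homs (Suc b) b {\<zero>\<^bsub>P b\<^esub>} \<subseteq> homs (Suc b) b (JU b)"
    by (rule homs_into_mono) (simp add: zero_in)
  have "finite_length RZ (HZ (Suc b) b) (homs (Suc b) b {\<zero>\<^bsub>P b\<^esub>}) (hom_ker (Suc b) b)"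
    by (rule finite_length_sub[OF finite_length_homs_into[OF free_retract_P P_left_module flen_P Pb.submodule_zero U_submodule]
          sub[OF Pb.submodule_zero] sub[OF U_submodule] sub[OF Pb.submodule_zero] hom_ker_submodule order_refl])
      (auto simp: hom_ker_def)
  from mlength_strict[OF this sub[OF Pb.submodule_zero] sub[OF JU_submodule] hom_ker_submodule zJ st]
  show ?thesis using hom_length_hom_ker[of b "Suc b"] by (simp add: hom_length_def)
qed

lemma ex_zero_syzygy: "\<exists>b. U b = {\<zero>\<^bsub>P b\<^esub>}"
proof (rule ccontr)
  assume "\<not> ?thesis"
  then have nz: "U b \<noteq> {\<zero>\<^bsub>P b\<^esub>}" for b by blast
  obtain A n where A: "composition_series A n" by (rule ex_composition_series)
  define c where "c i j = hom_length (P i) reg (A j) (A (Suc j))" for i j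
  have mult: "\<exists>t :: nat \<Rightarrow> nat. \<forall>i. hlen i b W = (\<Sum>j<n. t j * c i j)"
    if W: "submodule W R (P b)" for b W
  proof -
    obtain t :: "nat \<Rightarrow> nat" where "\<forall>Q :: ('a, nat \<Rightarrow> 'a) module. free_retract R Q \<longrightarrow>
      hom_length Q (P b) {\<zero>\<^bsub>P b\<^esub>} W = (\<Sum>j<n. t j * hom_length Q reg (A j) (A (Suc j)))"
      by (rule exE[OF hom_length_multiplicities[OF A P_left_module flen_P W]])
    then show ?thesis using free_retract_P unfolding c_def by (intro exI[of _ t] allI) simp
  qed
  have "\<forall>b. \<exists>t :: nat \<Rightarrow> nat. \<forall>i. hlen i b (U b) = (\<Sum>j<n. t j * c i j)"
    "\<forall>b. \<exists>t :: nat \<Rightarrow> nat. \<forall>i. hlen i b (JU b) = (\<Sum>j<n. t j * c i j)"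
    by (intro allI mult U_submodule JU_submodule)+
  then obtain t r :: "nat \<Rightarrow> nat \<Rightarrow> nat" where
    t: "\<And>b i. hlen i b (U b) = (\<Sum>j<n. t b j * c i j)" and
    r: "\<And>b i. hlen i b (JU b) = (\<Sum>j<n. r b j * c i j)"
    by metis
  \<comment> \<open>The index set is doubled: the two summands hold the length vectors
    \<open>c\<close> of P_(i+1) and of P_(i+2). Against them \<open>w b\<close> puts t - r and -r,
    which reproduces the difference of lengths for U_b and J U_b.\<close>
  define a :: "nat \<Rightarrow> nat + nat \<Rightarrow> real" where "a i = case_sum (\<lambda>j. real (c (Suc i) j)) (\<lambda>j. real (c (Suc (Suc i)) j))" for i
  define w :: "nat \<Rightarrow> nat + nat \<Rightarrow> real" where "w b = case_sum (\<lambda>j. real (t b j) - real (r b j)) (\<lambda>j. - real (r b j))" for b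
  let ?h = "\<lambda>i b W. real (hlen i b W)"
  have pair: "(\<Sum>k\<in>{..<n} <+> {..<n}. a i k * w b k) =
    ?h (Suc i) b (U b) - (?h (Suc i) b (JU b) + ?h (Suc (Suc i)) b (JU b))" for i b
    by (simp add: sum.Plus a_def w_def t r algebra_simps sum_subtractf sum_negf)
  show False
  proof (rule no_triangular_pairing[of "{..<n} <+> {..<n}" a w])
    show "(\<Sum>k\<in>{..<n} <+> {..<n}. a i k * w b k) = 0" if "b < i" for i b
      unfolding pair using hom_length_eq[OF that] by simp
    show "(\<Sum>k\<in>{..<n} <+> {..<n}. a b k * w b k) \<noteq> 0" for b
      unfolding pair using hom_length_less[OF nz[of b]] by simp
  qed simp
qed

end

text \<open>Once some syzygy is zero, splitting descends to P_1 -> U_0. One last descent, by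
  Ext^1(M, P_1) = 0, splits P_0 -> M, so \<open>M\<close> is a summand of the projective
  P_0.\<close>

theorem (in artin_algebra) auslander_reiten_of_cube_zero:
  assumes J3: "\<And>a b c. \<lbrakk>a \<in> J; b \<in> J; c \<in> J\<rbrakk> \<Longrightarrow> a \<otimes> b \<otimes> c = \<zero>"
  shows "auslander_reiten R TYPE('m) TYPE('x) TYPE('y)"
  unfolding auslander_reiten_def
proof (intro allI impI, elim conjE)
  fix M :: "('a, 'm) module"
  assume M: "left_module R M" and fg: "lmod_fg R M"
    and ext: "\<forall>i>0. trivial_group (lmod_Ext R i M (lmod_dsum M reg))"
  obtain P U p q where res: "orthogonal_resolution R Z P U p"
    and q: "lmod_map R (P 0) M q" "q ` carrier (P 0) = carrier M" "U 0 = lmod_ker (P 0) M q"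
    using ex_orthogonal_resolution[OF M fg ext[rule_format]] by blast
  interpret cube_zero_resolution R Z P U p
    by (intro cube_zero_resolution.intro cube_zero_resolution_axioms.intro res J3)
  obtain b where "U b = {\<zero>\<^bsub>P b\<^esub>}" using ex_zero_syzygy by blast
  then obtain s where s: "lmod_map R (P 0\<lparr>carrier := U 0\<rparr>) (P (Suc 0)) s" "\<And>x. x \<in> U 0 \<Longrightarrow> p 0 (s x) = x"
    using split_of_zero_syzygy[of b 0] by blast
  have im: "p 0 ` carrier (P (Suc 0)) = lmod_ker (P 0) M q" using p_image q(3) by simp
  note split = split_epi_descend[OF P_left_module M P_left_module q(1,2) p_map im, folded q(3)]
  obtain t where "lmod_map R M (P 0) t" "\<And>x. x \<in> carrier M \<Longrightarrow> q (t x) = x"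
    using split[OF s extends_P] by blast
  then show "lmod_projective R M TYPE('x) TYPE('y)"
    using retract_projective[OF free_retract_P M _ q(1)] by blast
qed

section \<open>Finite-dimensional algebras over a field\<close>

text \<open>The subring K 1 is central, and its submodules of \<open>A\<close> are the K-subspaces.
  A finite spanning set is adjoined one element at a time, and each enlargement has length at most
  one.\<close>

lemma (in fd_algebra) artin_algebra: "artin_algebra A ((\<lambda>c. c \<odot>\<^bsub>A\<^esub> \<one>\<^bsub>A\<^esub>) ` carrier K)"
proof -
  let ?Z = "(\<lambda>c. c \<odot>\<^bsub>A\<^esub> \<one>\<^bsub>A\<^esub>) ` carrier K"
  let ?S = "A\<lparr>carrier := ?Z\<rparr>"
  have mult: "(c \<odot>\<^bsub>A\<^esub> \<one>\<^bsub>A\<^esub>) \<otimes>\<^bsub>A\<^esub> x = c \<odot>\<^bsub>A\<^esub> x" "x \<otimes>\<^bsub>A\<^esub> (c \<odot>\<^bsub>A\<^esub> \<one>\<^bsub>A\<^esub>) = c \<odot>\<^bsub>A\<^esub> x"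
    if "c \<in> carrier K" "x \<in> carrier A" for c x
    using that by (simp_all add: smult_mult_left smult_mult_right)
  have sub: "subring ?Z A"
  proof (rule A.subringI)
    show "?Z \<subseteq> carrier A" by auto
    show "\<one>\<^bsub>A\<^esub> \<in> ?Z" by (rule image_eqI[of _ _ "\<one>\<^bsub>K\<^esub>"]) auto
    show "\<ominus>\<^bsub>A\<^esub> h \<in> ?Z" if "h \<in> ?Z" for h
    proof -
      from that obtain c where "c \<in> carrier K" "h = c \<odot>\<^bsub>A\<^esub> \<one>\<^bsub>A\<^esub>" by blast
      then show ?thesis by (intro image_eqI[of _ _ "\<ominus>\<^bsub>K\<^esub> c"]) (auto simp: smult_l_minus)
    qed
    fix g h assume "g \<in> ?Z" "h \<in> ?Z"
    then obtain c d where cd: "c \<in> carrier K" "d \<in> carrier K" "g = c \<odot>\<^bsub>A\<^esub> \<one>\<^bsub>A\<^esub>" "h = d \<odot>\<^bsub>A\<^esub> \<one>\<^bsub>A\<^esub>" by blast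
    show "g \<otimes>\<^bsub>A\<^esub> h \<in> ?Z"
      by (rule image_eqI[of _ _ "c \<otimes>\<^bsub>K\<^esub> d"]) (use cd in \<open>simp_all add: smult_mult_left smult_assoc1\<close>)
    show "g \<oplus>\<^bsub>A\<^esub> h \<in> ?Z"
      by (rule image_eqI[of _ _ "c \<oplus>\<^bsub>K\<^esub> d"]) (use cd in \<open>simp_all add: smult_l_distr\<close>)
  qed
  interpret S: ring ?S by (rule A.subring_is_ring[OF sub])
  interpret L: left_module A "A.reg" by (rule A.reg_module)
  interpret LS: left_module ?S "A.reg"
    by (intro left_module.intro S.ring_axioms L.M.abelian_group_axioms left_module_axioms.intro)
      (auto simp: A.l_distr A.r_distr A.m_assoc)
  \<comment> \<open>Transfers \<open>finite_dimensional\<close>, which speaks of scalars in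
    \<open>K\<close>, to scalars in K 1.\<close>
  have subm: "submodule N ?S A.reg \<longleftrightarrow> submodule N K A" for N
  proof -
    have "submodule N ?S A.reg \<longleftrightarrow> N \<subseteq> carrier A \<and> \<zero>\<^bsub>A\<^esub> \<in> N \<and>
      (\<forall>x\<in>N. \<forall>y\<in>N. x \<oplus>\<^bsub>A\<^esub> y \<in> N) \<and> (\<forall>c\<in>carrier K. \<forall>x\<in>N. c \<odot>\<^bsub>A\<^esub> x \<in> N)"
      unfolding LS.submodule_iff by (auto simp: mult subset_iff)
    moreover have "left_module K A"
      by (intro left_module.intro K.ring_axioms left_module_axioms.intro A.abelian_group_axioms)
        (auto simp: smult_l_distr smult_r_distr smult_assoc1)
    then have "submodule N K A \<longleftrightarrow> N \<subseteq> carrier A \<and> \<zero>\<^bsub>A\<^esub> \<in> N \<and>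
      (\<forall>x\<in>N. \<forall>y\<in>N. x \<oplus>\<^bsub>A\<^esub> y \<in> N) \<and> (\<forall>c\<in>carrier K. \<forall>x\<in>N. c \<odot>\<^bsub>A\<^esub> x \<in> N)"
      by (rule left_module.submodule_iff)
    ultimately show ?thesis by simp
  qed
  have "\<exists>N. submodule N ?S A.reg \<and> B \<subseteq> N \<and> finite_length ?S A.reg {\<zero>\<^bsub>A\<^esub>} N"
    if "finite B" "B \<subseteq> carrier A" for B
    using that
  proof (induction B rule: finite_induct)
    case empty
    show ?case using mlength_self(2)[OF LS.submodule_zero] LS.submodule_zero by auto
  next
    case (insert b B)
    then obtain N where N: "submodule N ?S A.reg" "B \<subseteq> N" "finite_length ?S A.reg {\<zero>\<^bsub>A\<^esub>} N"
      by auto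
    have b: "b \<in> carrier A" using insert.prems by simp
    let ?b = "(\<lambda>a. a \<otimes>\<^bsub>A\<^esub> b) ` ?Z"
    have "lmod_map ?S (regular_lmod ?S) A.reg (\<lambda>a. a \<odot>\<^bsub>A.reg\<^esub> b)"
      using b by (intro S.lmod_map_smult LS.left_module_axioms) simp
    then have sb: "submodule ?b ?S A.reg"
      using submodule_range[OF S.reg_module LS.left_module_axioms _]
      by simp
    define N' where "N' = N <+>\<^bsub>A.reg\<^esub> ?b"
    have N': "submodule N' ?S A.reg" unfolding N'_def by (rule LS.submodule_set_add[OF N(1) sb])
    have NN': "N \<subseteq> N'" unfolding N'_def by (rule LS.set_add_upper1[OF N(1) sb])
    have "b \<in> ?b" by (rule image_eqI[of _ _ "\<one>\<^bsub>A\<^esub>"]) (use b subringE(3)[OF sub] in auto)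
    then have bN': "b \<in> N'" unfolding N'_def using LS.set_add_upper2[OF N(1) sb] by blast
    \<comment> \<open>No subspace lies strictly between \<open>N\<close> and N + K b: an element x +
      c b outside \<open>N\<close> has c nonzero, and dividing by \<open>c\<close> recovers
      \<open>b\<close>.\<close>
    have big: "V = N'" if V: "submodule V ?S A.reg" "N \<subset> V" "V \<subseteq> N'" for V
    proof -
      obtain u where u: "u \<in> V" "u \<notin> N" using V(2) by blast
      then have "u \<in> N <+>\<^bsub>A.reg\<^esub> ?b" using V(3) by (auto simp: N'_def)
      then obtain x y where xy: "x \<in> N" "y \<in> ?b" "u = x \<oplus>\<^bsub>A\<^esub> y" by (auto simp: LS.mem_set_add)
      then obtain c where c: "c \<in> carrier K" "y = (c \<odot>\<^bsub>A\<^esub> \<one>\<^bsub>A\<^esub>) \<otimes>\<^bsub>A\<^esub> b" by blast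
      have xc: "x \<in> N" "c \<in> carrier K" "u = x \<oplus>\<^bsub>A\<^esub> c \<odot>\<^bsub>A\<^esub> b"
        using xy(1,3) c mult(1)[OF c(1) b] by simp_all
      have xA: "x \<in> carrier A" using xc(1) N(1) by (auto simp: LS.submodule_iff)
      have "c \<noteq> \<zero>\<^bsub>K\<^esub>" using xc u(2) b xA by auto
      then have ci: "inv\<^bsub>K\<^esub> c \<in> carrier K" "inv\<^bsub>K\<^esub> c \<otimes>\<^bsub>K\<^esub> c = \<one>\<^bsub>K\<^esub>"
        using xc(2) K.field_Units by auto
      have "u \<ominus>\<^bsub>A.reg\<^esub> x \<in> V" using LS.submodule_minus[OF V(1) u(1)] V(2) xc(1) by blast
      moreover have "u \<ominus>\<^bsub>A.reg\<^esub> x = c \<odot>\<^bsub>A\<^esub> b"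
        using xc xA b L.M.add.inv_solve_right'[of "c \<odot>\<^bsub>A\<^esub> b" u x] by (simp add: A.a_comm L.M.minus_eq)
      ultimately have "inv\<^bsub>K\<^esub> c \<odot>\<^bsub>A\<^esub> (c \<odot>\<^bsub>A\<^esub> b) \<in> V"
        using submodule.smult_closed[OF V(1)[unfolded subm] ci(1)] by simp
      then have "b \<in> V" using ci xc(2) b by (simp flip: smult_assoc1)
      then have "?b \<subseteq> V" using V(1) by (auto simp: LS.submodule_iff)
      then show "V = N'" using V LS.set_add_least[OF V(1)] unfolding N'_def by blast
    qed
    have "k \<le> 1" if k: "submodule_chain ?S A.reg N N' k" for k
    proof (rule ccontr)
      assume "\<not> k \<le> 1"
      obtain C where C: "C 0 = N" "C k = N'" "\<And>i. i \<le> k \<Longrightarrow> submodule (C i) ?S A.reg"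
        "\<And>i. i < k \<Longrightarrow> C i \<subset> C (Suc i)"
        using k unfolding submodule_chain_def by blast
      have "submodule_chain ?S A.reg (C 1) (C k) (k - 1)"
        unfolding submodule_chain_def by (rule exI[of _ "\<lambda>i. C (Suc i)"]) (use C \<open>\<not> k \<le> 1\<close> in auto)
      then have "C 1 \<subset> N'" using submodule_chain_bounds(4) \<open>\<not> k \<le> 1\<close> C(2) by fastforce
      then show False using big[of "C 1"] C(1) C(4)[of 0] C(3)[of 1] \<open>\<not> k \<le> 1\<close> by auto
    qed
    then have "finite_length ?S A.reg N N'" unfolding finite_length_def by blast
    then have "finite_length ?S A.reg {\<zero>\<^bsub>A\<^esub>} N'"
      using LS.mlength_add(1)[OF LS.submodule_zero N(1) N' _ _ _ NN'] N by (auto simp: LS.submodule_iff)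
    then show ?case using N' NN' N(2) bN' by blast
  qed
  moreover obtain B where "finite B" "B \<subseteq> carrier A" "\<And>N. submodule N K A \<Longrightarrow> B \<subseteq> N \<Longrightarrow> N = carrier A"
    using finite_dimensional unfolding lmod_fg_def lmod_generates_def by blast
  ultimately have "finite_length ?S A.reg {\<zero>\<^bsub>A\<^esub>} (carrier A)" using subm by metis
  then show ?thesis
    using sub mult by (intro artin_algebra.intro artin_algebra_axioms.intro A.ring_axioms) auto
qed

theorem corollary1p2:
  fixes K :: "('k, 'c) ring_scheme" and A :: "('k, 'a, 'd) module_scheme"
  assumes "fd_algebra K A"
    and "ideal_prod A (ideal_prod A (jacobson_radical A) (jacobson_radical A)) (jacobson_radical A)
           = {\<zero>\<^bsub>A\<^esub>}"
  shows "(split_algebra K A \<longrightarrow> auslander_reiten A TYPE('m) TYPE('x) TYPE('y)) \<and>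
         (algebraically_closed K \<longrightarrow> auslander_reiten A TYPE('m) TYPE('x) TYPE('y))"
proof -
  \<comment> \<open>A triple product is one of the generators of the product ideal, so J^3 = 0 can
    be used elementwise.\<close>
  have "a \<otimes>\<^bsub>A\<^esub> b \<otimes>\<^bsub>A\<^esub> c = \<zero>\<^bsub>A\<^esub>"
    if "a \<in> jacobson_radical A" "b \<in> jacobson_radical A" "c \<in> jacobson_radical A" for a b c
    using ideal_prod.prod[OF ideal_prod.prod[OF that(1,2)] that(3)] assms(2) by blast
  then show ?thesis
    using artin_algebra.auslander_reiten_of_cube_zero[OF fd_algebra.artin_algebra[OF assms(1)]] by blast
qed

end
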